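(* Let $G_\Gamma$ and $G_\Omega$ be graph products over finite simplicial graphs $\Gamma,\Omega$ whose vertex groups are finite, non-trivial and directly indecomposable. The following are equivalent: (1) $G_\Gamma\cong G_\Omega$; (2) $\Gamma\cong\Omega$ as vertex-labelled graphs, i.e. there is a graph isomorphism $\Gamma\to\Omega$ such that the vertex group of each vertex of $\Gamma$ is isomorphic to the vertex group of its image; (3) there is an order isomorphism $\psi\colon\mathcal{CF}(G_\Gamma)\to\mathcal{CF}(G_\Omega)$ such that for every $[A]\in\mathcal{CF}(G_\Gamma)$ and every $B\in\psi([A])$ we have $A\cong B$.
   Context: Graph product: for a finite simplicial graph $\Gamma=(V,E)$ with non-trivial vertex groups $G_v$, $G_\Gamma=(\ast_{v\in V}G_v)/\langle\langle [a,b] : a\in G_v,b\in G_w,\{v,w\}\in E\rangle\rangle$. For a group $G$, $\mathcal{CF}(G)$ denotes the set of conjugacy classes of finite subgroups of $G$, partially ordered by $[A]\le[B]$ iff $A\subseteq gBg^{-1}$ for some $g\in G$. *)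

theory Defs
  imports "HOL-Algebra.Algebra"
begin

definition simplicial_graph :: "'v set \<Rightarrow> ('v \<Rightarrow> 'v \<Rightarrow> bool) \<Rightarrow> bool" where
  "simplicial_graph V E \<longleftrightarrow> finite V \<and>
     (\<forall>v w. E v w \<longrightarrow> v \<in> V \<and> w \<in> V) \<and>
     (\<forall>v w. E v w \<longrightarrow> E w v) \<and> (\<forall>v. \<not> E v v)"

definition gp_word :: "'v set \<Rightarrow> ('v \<Rightarrow> 'g monoid) \<Rightarrow> ('v \<times> 'g) list \<Rightarrow> bool" where
  "gp_word V G w \<longleftrightarrow> (\<forall>(v, g) \<in> set w. v \<in> V \<and> g \<in> carrier (G v))"

text \<open>The congruence on words defining the graph product
  (free product of the G_v modulo commutation of adjacent vertex groups),
  i.e. the monoid presentation: generators all elements of all G_v, relations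
  g h = (g h) in G_v, 1_{G_v} = empty word, and [g,h] = 1 for g in G_v, h in G_w, v ~ w.\<close>
inductive gp_rel :: "'v set \<Rightarrow> ('v \<Rightarrow> 'v \<Rightarrow> bool) \<Rightarrow> ('v \<Rightarrow> 'g monoid)
    \<Rightarrow> ('v \<times> 'g) list \<Rightarrow> ('v \<times> 'g) list \<Rightarrow> bool"
  for V E G where
  gp_refl: "gp_word V G x \<Longrightarrow> gp_rel V E G x x"
| gp_sym: "gp_rel V E G x y \<Longrightarrow> gp_rel V E G y x"
| gp_trans: "gp_rel V E G x y \<Longrightarrow> gp_rel V E G y z \<Longrightarrow> gp_rel V E G x z"
| gp_merge: "\<lbrakk>gp_word V G u; gp_word V G w; v \<in> V; g \<in> carrier (G v); h \<in> carrier (G v)\<rbrakk>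
    \<Longrightarrow> gp_rel V E G (u @ [(v, g), (v, h)] @ w) (u @ [(v, g \<otimes>\<^bsub>G v\<^esub> h)] @ w)"
| gp_unit: "\<lbrakk>gp_word V G u; gp_word V G w; v \<in> V\<rbrakk>
    \<Longrightarrow> gp_rel V E G (u @ [(v, \<one>\<^bsub>G v\<^esub>)] @ w) (u @ w)"
| gp_comm: "\<lbrakk>gp_word V G u; gp_word V G w; E v v'; g \<in> carrier (G v); h \<in> carrier (G v')\<rbrakk>
    \<Longrightarrow> gp_rel V E G (u @ [(v, g), (v', h)] @ w) (u @ [(v', h), (v, g)] @ w)"

definition gp_class :: "'v set \<Rightarrow> ('v \<Rightarrow> 'v \<Rightarrow> bool) \<Rightarrow> ('v \<Rightarrow> 'g monoid)
    \<Rightarrow> ('v \<times> 'g) list \<Rightarrow> ('v \<times> 'g) list set" where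
  "gp_class V E G x = {y. gp_rel V E G x y}"

definition graph_product :: "'v set \<Rightarrow> ('v \<Rightarrow> 'v \<Rightarrow> bool) \<Rightarrow> ('v \<Rightarrow> 'g monoid)
    \<Rightarrow> ('v \<times> 'g) list set monoid" where
  "graph_product V E G =
     \<lparr> carrier = gp_class V E G ` {w. gp_word V G w},
       monoid.mult = (\<lambda>P Q. {z. \<exists>x\<in>P. \<exists>y\<in>Q. gp_rel V E G (x @ y) z}),
       monoid.one = gp_class V E G [] \<rparr>"

definition directly_indecomposable :: "('a, 'b) monoid_scheme \<Rightarrow> bool" where
  "directly_indecomposable G \<longleftrightarrow> carrier G \<noteq> {\<one>\<^bsub>G\<^esub>} \<and>
     \<not> (\<exists>H K. H \<lhd> G \<and> K \<lhd> G \<and> H \<inter> K = {\<one>\<^bsub>G\<^esub>} \<and> H <#>\<^bsub>G\<^esub> K = carrier G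
            \<and> H \<noteq> {\<one>\<^bsub>G\<^esub>} \<and> K \<noteq> {\<one>\<^bsub>G\<^esub>})"

definition conj_set :: "('a, 'b) monoid_scheme \<Rightarrow> 'a \<Rightarrow> 'a set \<Rightarrow> 'a set" where
  "conj_set G g A = (\<lambda>a. g \<otimes>\<^bsub>G\<^esub> a \<otimes>\<^bsub>G\<^esub> inv\<^bsub>G\<^esub> g) ` A"

definition subgroup_conj_class :: "('a, 'b) monoid_scheme \<Rightarrow> 'a set \<Rightarrow> 'a set set" where
  "subgroup_conj_class G A = {conj_set G g A | g. g \<in> carrier G}"

definition CF :: "('a, 'b) monoid_scheme \<Rightarrow> 'a set set set" where
  "CF G = {subgroup_conj_class G A | A. subgroup A G \<and> finite A}"

definition CF_le :: "('a, 'b) monoid_scheme \<Rightarrow> 'a set set \<Rightarrow> 'a set set \<Rightarrow> bool" where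
  "CF_le G P Q \<longleftrightarrow> (\<exists>S\<in>P. \<exists>T\<in>Q. \<exists>g\<in>carrier G. S \<subseteq> conj_set G g T)"

definition labelled_graph_iso ::
  "'v set \<Rightarrow> ('v \<Rightarrow> 'v \<Rightarrow> bool) \<Rightarrow> ('v \<Rightarrow> ('g, 'c) monoid_scheme)
   \<Rightarrow> 'w set \<Rightarrow> ('w \<Rightarrow> 'w \<Rightarrow> bool) \<Rightarrow> ('w \<Rightarrow> ('h, 'd) monoid_scheme) \<Rightarrow> bool" where
  "labelled_graph_iso V E G W F H \<longleftrightarrow>
     (\<exists>f. bij_betw f V W \<and> (\<forall>v\<in>V. \<forall>v'\<in>V. E v v' \<longleftrightarrow> F (f v) (f v'))
          \<and> (\<forall>v\<in>V. G v \<cong> H (f v)))"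

end

theory Submission
  imports Defs
begin

text \<open>
  Killing the vertex groups outside a set \<open>S\<close> of vertices is a retraction \<open>ret S\<close> of the graph
  product onto the subgroup \<open>par S\<close> generated by the vertex groups in \<open>S\<close>, and
  \<open>ret S\<close> after \<open>ret T\<close> is \<open>ret (S \<inter> T)\<close>. Hence a subgroup that is conjugate into
  \<open>par S\<close> and into \<open>par T\<close> is conjugate into \<open>par (S \<inter> T)\<close>, and for cliques \<open>K\<close>, \<open>L\<close>
  the subgroup \<open>par K\<close> is conjugate into \<open>par L\<close> only if \<open>K \<subseteq> L\<close>.

  A finite subgroup is conjugate into \<open>par K\<close> for some clique \<open>K\<close>. For a vertex \<open>v\<close>, the graph product
  acts on the free product of the conjugates of \<open>G v\<close> by \<open>par (V - {v})\<close>, a tree of cliques with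
  respect to word length. The points minimising the maximal distance to a finite orbit form an
  invariant clique, so that a finite subgroup is conjugate into \<open>par (V - {v})\<close> or into
  \<open>par\<close> of the star of \<open>v\<close>. If \<open>v\<close> lies in a set \<open>S\<close> that is not a clique, both options
  allow us to shrink \<open>S\<close> for a suitable choice of \<open>v\<close>.

  Therefore the maximal elements of \<open>CF\<close> are the classes of \<open>par K\<close> for maximal cliques \<open>K\<close>, and
  their meets are the classes of \<open>par\<close> of the intersections. By Krull--Schmidt, an isomorphism in
  the sense of (3) determines how many vertices of each isomorphism type lie in each intersection of
  maximal cliques, hence by inclusion-exclusion the labelled graph.
\<close>

section \<open>Fitting's lemma and the exchange property\<close>

text \<open>Order and isomorphism types do not single out vertices: a vertex subgroup need not be
  \<open>par\<close> of an intersection of maximal cliques, and an isomorphism between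
  \<open>par K\<close> and \<open>par L\<close> need not match their vertex subgroups. So the
  reconstruction can only count, and the vertex bijection is chosen at the end, arbitrarily among
  vertices with equal labels.

  Retractions take the place of normal forms for graph products: membership in \<open>par S\<close>
  is the equation \<open>ret S x = x\<close>, and applying a retraction to a conjugation relation
  produces the next conjugator. Normal forms occur only for a free product, one vertex at a time.
  The graph product is the semidirect product of this free product with
  \<open>par (V - {v})\<close>, so reduced words stand for the cosets of
  \<open>par (V - {v})\<close>, and no tree has to be built: a distance on words and the inequality
  \<open>rdist_between\<close>, which says that a letter is a cut point, carry the fixed-point
  argument.\<close>

text \<open>Endomorphisms that commute with all conjugations. The relation
  \<open>y = a x a^-1\<close> is written without inverses so that it passes unchanged to a subgroup
  given by a smaller carrier.\<close>

definition normal_endo :: "('a, 'b) monoid_scheme \<Rightarrow> ('a \<Rightarrow> 'a) \<Rightarrow> bool" where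
  "normal_endo A \<theta> \<longleftrightarrow> \<theta> \<in> hom A A \<and>
     (\<forall>a\<in>carrier A. \<forall>x\<in>carrier A. \<forall>y\<in>carrier A.
        a \<otimes>\<^bsub>A\<^esub> x = y \<otimes>\<^bsub>A\<^esub> a \<longrightarrow> a \<otimes>\<^bsub>A\<^esub> \<theta> x = \<theta> y \<otimes>\<^bsub>A\<^esub> a)"

lemma normal_endo_id: "normal_endo A (\<lambda>x. x)"
  by (auto simp: normal_endo_def hom_def)

lemma normal_endo_comp:
  assumes "normal_endo A \<alpha>" "normal_endo A \<beta>"
  shows "normal_endo A (\<lambda>x. \<alpha> (\<beta> x))"
  using assms unfolding normal_endo_def hom_def Pi_def by auto

lemma normal_endo_funpow:
  assumes "normal_endo A \<alpha>"
  shows "normal_endo A (\<alpha> ^^ n)"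
proof (induction n)
  case 0
  then show ?case by (simp add: normal_endo_id id_def)
next
  case (Suc n)
  then show ?case using normal_endo_comp[OF assms Suc.IH] by (simp add: comp_def)
qed

context group
begin

lemma normal_endo_group_hom: "normal_endo G \<theta> \<Longrightarrow> group_hom G G \<theta>"
  by (simp add: normal_endo_def group_hom_def group_hom_axioms_def is_group)

lemma normal_endo_image_normal:
  assumes "normal_endo G \<theta>"
  shows "\<theta> ` carrier G \<lhd> G"
proof -
  interpret h: group_hom G G \<theta> by (rule normal_endo_group_hom[OF assms])
  have "x \<otimes> \<theta> y \<otimes> inv x \<in> \<theta> ` carrier G" if x: "x \<in> carrier G" and y: "y \<in> carrier G" for x y
  proof -
    have "x \<otimes> y = (x \<otimes> y \<otimes> inv x) \<otimes> x" using x y by (simp add: m_assoc)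
    then have "x \<otimes> \<theta> y = \<theta> (x \<otimes> y \<otimes> inv x) \<otimes> x"
      using assms x y unfolding normal_endo_def by blast
    then have "x \<otimes> \<theta> y \<otimes> inv x = \<theta> (x \<otimes> y \<otimes> inv x)" using x y by (simp add: m_assoc)
    then show ?thesis using x y by (metis image_eqI inv_closed m_closed)
  qed
  then show ?thesis by (auto simp: normal_inv_iff h.img_is_subgroup)
qed

text \<open>Once the images of the powers of \<open>\<theta>\<close> have stopped shrinking, a power
  \<open>\<phi>\<close> permutes its own image, so the group is the direct product of the kernel and
  the image of \<open>\<phi>\<close>. The image is normal because \<open>\<phi>\<close> commutes
  with conjugation, and indecomposability makes one of the two trivial.\<close>

lemma fitting:
  assumes fin: "finite (carrier G)" and ind: "directly_indecomposable G"
    and ne: "normal_endo G \<theta>"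
  shows "inj_on \<theta> (carrier G) \<or> (\<exists>n. \<forall>x\<in>carrier G. (\<theta> ^^ n) x = \<one>)"
proof -
  \<comment> \<open>The exponent is \<open>Suc m\<close> so that \<open>\<phi>\<close> factors
    through \<open>\<theta>\<close>: injectivity of \<open>\<phi>\<close> then gives injectivity of
    \<open>\<theta>\<close>.\<close>
  obtain m where m: "\<And>n. card ((\<theta> ^^ Suc m) ` carrier G) \<le> card ((\<theta> ^^ Suc n) ` carrier G)"
    using ex_has_least_nat[of "\<lambda>_. True" undefined "\<lambda>n. card ((\<theta> ^^ Suc n) ` carrier G)"] by blast
  define \<phi> where "\<phi> = \<theta> ^^ Suc m"
  have ne\<phi>: "normal_endo G \<phi>" unfolding \<phi>_def by (rule normal_endo_funpow[OF ne])
  interpret h: group_hom G G \<phi> by (rule normal_endo_group_hom[OF ne\<phi>])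
  have "card (\<phi> ` carrier G) \<le> card ((\<theta> ^^ Suc (m + Suc m)) ` carrier G)"
    unfolding \<phi>_def by (rule m)
  also have "\<theta> ^^ Suc (m + Suc m) = \<phi> \<circ> \<phi>"
    unfolding \<phi>_def using funpow_add[of "Suc m" "Suc m" \<theta>] by simp
  finally have "card (\<phi> ` carrier G) \<le> card (\<phi> ` \<phi> ` carrier G)" by (simp add: image_comp)
  then have c: "card (\<phi> ` \<phi> ` carrier G) = card (\<phi> ` carrier G)"
    using card_image_le[of "\<phi> ` carrier G" \<phi>] fin by simp
  then have inj: "inj_on \<phi> (\<phi> ` carrier G)" using fin by (simp add: eq_card_imp_inj_on)
  have "\<phi> ` \<phi> ` carrier G \<subseteq> \<phi> ` carrier G" by auto
  then have surj: "\<phi> ` \<phi> ` carrier G = \<phi> ` carrier G"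
    using c fin by (simp add: card_subset_eq)
  let ?K = "kernel G G \<phi>" and ?I = "\<phi> ` carrier G"
  have "?K \<inter> ?I = {\<one>}"
  proof -
    have "x = \<one>" if "x \<in> ?K" "x \<in> ?I" for x
    proof -
      have "\<phi> x = \<phi> \<one>" using that by (simp add: kernel_def)
      moreover have "\<one> \<in> ?I" using h.hom_one by (metis image_eqI one_closed)
      ultimately show ?thesis using inj that by (meson inj_onD)
    qed
    moreover have "\<one> \<in> ?I" using h.hom_one by (metis image_eqI one_closed)
    moreover have "\<one> \<in> ?K" by (simp add: kernel_def)
    ultimately show ?thesis by blast
  qed
  moreover have "?K <#> ?I = carrier G"
  proof
    show "?K <#> ?I \<subseteq> carrier G" by (auto simp: set_mult_def kernel_def)
    show "carrier G \<subseteq> ?K <#> ?I"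
    proof
      fix x assume x: "x \<in> carrier G"
      then obtain y where y: "y \<in> carrier G" "\<phi> x = \<phi> (\<phi> y)" using surj by blast
      have "x \<otimes> inv (\<phi> y) \<in> ?K" using x y by (simp add: kernel_def)
      moreover have "x = (x \<otimes> inv (\<phi> y)) \<otimes> \<phi> y" using x y by (simp add: m_assoc)
      ultimately show "x \<in> ?K <#> ?I" using y unfolding set_mult_def by blast
    qed
  qed
  ultimately have "?K = {\<one>} \<or> ?I = {\<one>}"
    using ind h.normal_kernel normal_endo_image_normal[OF ne\<phi>]
    unfolding directly_indecomposable_def by blast
  then show ?thesis
  proof
    assume "?K = {\<one>}"
    then have "inj_on \<phi> (carrier G)" using h.inj_iff_trivial_ker by blast
    moreover have "\<phi> = (\<theta> ^^ m) \<circ> \<theta>" unfolding \<phi>_def by (simp add: funpow_swap1 comp_def fun_eq_iff)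
    ultimately show ?thesis using inj_on_imageI2 by metis
  next
    assume "?I = {\<one>}"
    then show ?thesis unfolding \<phi>_def by blast
  qed
qed

text \<open>The analogue of a local endomorphism ring. After composing with the inverse of
  \<open>\<sigma>\<close> the summands add up to the identity. If the first is not injective, it is
  nilpotent by \<open>fitting\<close>; but it fixes every element of the kernel of
  \<open>\<beta>\<close>, so that kernel is trivial.\<close>

lemma normal_endo_inj_summand:
  assumes fin: "finite (carrier G)" and ind: "directly_indecomposable G"
    and ne: "normal_endo G \<sigma>" "normal_endo G \<alpha>" "normal_endo G \<beta>"
    and sum: "\<And>x. x \<in> carrier G \<Longrightarrow> \<sigma> x = \<alpha> x \<otimes> \<beta> x"
    and inj: "inj_on \<sigma> (carrier G)"
  shows "inj_on \<alpha> (carrier G) \<or> inj_on \<beta> (carrier G)"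
proof -
  interpret s: group_hom G G \<sigma> by (rule normal_endo_group_hom[OF ne(1)])
  interpret a: group_hom G G \<alpha> by (rule normal_endo_group_hom[OF ne(2)])
  interpret b: group_hom G G \<beta> by (rule normal_endo_group_hom[OF ne(3)])
  have surj: "\<sigma> ` carrier G = carrier G"
    using inj fin by (metis card_image card_subset_eq s.hom_closed image_subsetI)
  define \<tau> where "\<tau> = inv_into (carrier G) \<sigma>"
  have st: "\<sigma> (\<tau> x) = x" "\<tau> x \<in> carrier G" if "x \<in> carrier G" for x
    using that surj unfolding \<tau>_def by (auto simp: f_inv_into_f inv_into_into)
  have ts: "\<tau> (\<sigma> x) = x" if "x \<in> carrier G" for x
    using that inj unfolding \<tau>_def by simp
  have \<tau>hom: "\<tau> (x \<otimes> y) = \<tau> x \<otimes> \<tau> y" if "x \<in> carrier G" "y \<in> carrier G" for x y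
    using that st ts[of "\<tau> x \<otimes> \<tau> y"] by simp
  have \<tau>: "normal_endo G \<tau>"
    unfolding normal_endo_def
  proof (intro conjI ballI impI)
    show "\<tau> \<in> hom G G" using st \<tau>hom by (auto simp: hom_def)
    fix a x y assume c: "a \<in> carrier G" "x \<in> carrier G" "y \<in> carrier G" and e: "a \<otimes> x = y \<otimes> a"
    let ?z = "a \<otimes> \<tau> x \<otimes> inv a"
    have z: "a \<otimes> \<tau> x = ?z \<otimes> a" using c st by (simp add: m_assoc)
    then have "a \<otimes> \<sigma> (\<tau> x) = \<sigma> ?z \<otimes> a" using ne(1) c st unfolding normal_endo_def
      by (meson inv_closed m_closed)
    then have "y = \<sigma> ?z" using c st e by simp
    then have "\<tau> y = ?z" using ts c st by (metis inv_closed m_closed)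
    then show "a \<otimes> \<tau> x = \<tau> y \<otimes> a" using z by simp
  qed
  define \<alpha>' where "\<alpha>' = (\<lambda>x. \<tau> (\<alpha> x))"
  have ne': "normal_endo G \<alpha>'" unfolding \<alpha>'_def by (rule normal_endo_comp[OF \<tau> ne(2)])
  from fitting[OF fin ind ne'] show ?thesis
  proof
    assume "inj_on \<alpha>' (carrier G)"
    then show ?thesis unfolding \<alpha>'_def by (metis comp_def inj_on_imageI2 inj_on_cong)
  next
    assume "\<exists>n. \<forall>x\<in>carrier G. (\<alpha>' ^^ n) x = \<one>"
    then obtain n where n: "\<And>x. x \<in> carrier G \<Longrightarrow> (\<alpha>' ^^ n) x = \<one>" by blast
    have "x = \<one>" if x: "x \<in> carrier G" "\<beta> x = \<one>" for x
    proof -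
      have "\<alpha>' x = x" using sum[OF x(1)] x ts unfolding \<alpha>'_def by (metis a.hom_closed r_one)
      then have "(\<alpha>' ^^ n) x = x" by (induction n) auto
      then show ?thesis using n x by simp
    qed
    then have "kernel G G \<beta> = {\<one>}" by (auto simp: kernel_def)
    then show ?thesis using b.inj_iff_trivial_ker by blast
  qed
qed

end

text \<open>A direct decomposition is encoded by the projections onto all partial products:
  \<open>p J\<close> is the projection onto the product of the factors with index in \<open>J\<close>.\<close>

locale direct_decomposition = group D for D :: "'a monoid" (structure) +
  fixes I :: "'i set" and p :: "'i set \<Rightarrow> 'a \<Rightarrow> 'a"
  assumes finite_index: "finite I"
    and proj_hom: "J \<subseteq> I \<Longrightarrow> p J \<in> hom D D"
    and proj_all: "x \<in> carrier D \<Longrightarrow> p I x = x"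
    and proj_none: "x \<in> carrier D \<Longrightarrow> p {} x = \<one>"
    and proj_proj: "J \<subseteq> I \<Longrightarrow> J' \<subseteq> I \<Longrightarrow> x \<in> carrier D \<Longrightarrow> p J (p J' x) = p (J \<inter> J') x"
    and proj_Un: "J \<subseteq> I \<Longrightarrow> J' \<subseteq> I \<Longrightarrow> J \<inter> J' = {} \<Longrightarrow> x \<in> carrier D
      \<Longrightarrow> p (J \<union> J') x = p J x \<otimes> p J' x"
begin

abbreviation (input) factor :: "'i set \<Rightarrow> 'a monoid" where
  "factor J \<equiv> D\<lparr>carrier := p J ` carrier D\<rparr>"

lemma proj_group_hom: "J \<subseteq> I \<Longrightarrow> group_hom D D (p J)"
  by (simp add: group_hom_def group_hom_axioms_def is_group proj_hom)

lemma proj_closed: "J \<subseteq> I \<Longrightarrow> x \<in> carrier D \<Longrightarrow> p J x \<in> carrier D"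
  using proj_hom by (auto simp: hom_def)

lemma proj_mult: "J \<subseteq> I \<Longrightarrow> x \<in> carrier D \<Longrightarrow> y \<in> carrier D \<Longrightarrow> p J (x \<otimes> y) = p J x \<otimes> p J y"
  using proj_hom by (auto simp: hom_def)

lemma proj_one: "J \<subseteq> I \<Longrightarrow> p J \<one> = \<one>"
  using group_hom.hom_one[OF proj_group_hom] .

lemma factor_subgroup: "J \<subseteq> I \<Longrightarrow> subgroup (p J ` carrier D) D"
  using group_hom.img_is_subgroup[OF proj_group_hom] .

lemma factor_group: "J \<subseteq> I \<Longrightarrow> group (factor J)"
  using factor_subgroup subgroup_imp_group by blast

lemma proj_compl: "J \<subseteq> I \<Longrightarrow> x \<in> carrier D \<Longrightarrow> x = p J x \<otimes> p (I - J) x"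
  using proj_Un[of J "I - J" x] proj_all by (simp add: Un_absorb1)

lemma proj_commute:
  assumes J: "J \<subseteq> I" "J' \<subseteq> I" "J \<inter> J' = {}" and x: "x \<in> carrier D" "y \<in> carrier D"
  shows "p J x \<otimes> p J' y = p J' y \<otimes> p J x"
proof -
  let ?z = "p J x \<otimes> p J' y"
  have "J' \<inter> J = {}" using J by blast
  then have z: "?z \<in> carrier D" "p J ?z = p J x" "p J' ?z = p J' y"
    using J x by (auto simp: proj_closed proj_mult proj_proj proj_none)
  have "p J ?z \<otimes> p J' ?z = p J' ?z \<otimes> p J ?z"
    using proj_Un[OF J z(1)] proj_Un[OF J(2,1) \<open>J' \<inter> J = {}\<close> z(1)] by (simp add: Un_commute)
  then show ?thesis using z by simp
qed

text \<open>Split \<open>a\<close> into its \<open>J\<close>-part and the complementary part. The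
  latter commutes with the image of \<open>p J\<close>; for the former, apply \<open>p J\<close> to
  the relation between \<open>x\<close> and \<open>y\<close>.\<close>

lemma proj_normal_endo:
  assumes J: "J \<subseteq> I"
  shows "normal_endo D (p J)"
  unfolding normal_endo_def
proof (intro conjI ballI impI)
  show "p J \<in> hom D D" using proj_hom J .
  fix a x y assume c: "a \<in> carrier D" "x \<in> carrier D" "y \<in> carrier D" and e: "a \<otimes> x = y \<otimes> a"
  let ?b = "p J a" and ?c = "p (I - J) a"
  have bc: "a = ?b \<otimes> ?c" "?b \<in> carrier D" "?c \<in> carrier D"
    using proj_compl[OF J c(1)] J c by (auto simp: proj_closed)
  have px: "p J x \<in> carrier D" "p J y \<in> carrier D" using J c by (auto simp: proj_closed)
  have e': "?b \<otimes> p J x = p J y \<otimes> ?b" using e J c proj_mult by metis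
  have cx: "?c \<otimes> p J x = p J x \<otimes> ?c"
    by (rule proj_commute) (use J c in auto)
  have "a \<otimes> p J x = ?b \<otimes> (?c \<otimes> p J x)" using bc px m_assoc by metis
  also have "\<dots> = (?b \<otimes> p J x) \<otimes> ?c" using bc px cx by (simp add: m_assoc)
  also have "\<dots> = p J y \<otimes> (?b \<otimes> ?c)" using bc px e' by (simp add: m_assoc)
  finally show "a \<otimes> p J x = p J y \<otimes> a" using bc by simp
qed

text \<open>Lets complements be compared by counting: in the exchange argument it upgrades an
  injection between complements to an isomorphism.\<close>

lemma card_factor_compl:
  assumes J: "J \<subseteq> I"
  shows "card (carrier D) = card (p J ` carrier D) * card (p (I - J) ` carrier D)"
proof -
  have "bij_betw (\<lambda>x. (p J x, p (I - J) x)) (carrier D) ((p J ` carrier D) \<times> (p (I - J) ` carrier D))"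
  proof (rule bij_betw_imageI)
    show "inj_on (\<lambda>x. (p J x, p (I - J) x)) (carrier D)"
    proof (rule inj_onI)
      fix x y assume "x \<in> carrier D" "y \<in> carrier D" "(p J x, p (I - J) x) = (p J y, p (I - J) y)"
      then show "x = y" using proj_compl[OF J, of x] proj_compl[OF J, of y] by simp
    qed
    have "\<exists>z\<in>carrier D. p J z = p J x \<and> p (I - J) z = p (I - J) y"
      if "x \<in> carrier D" "y \<in> carrier D" for x y
    proof -
      have "p J (p (I - J) y) = \<one>" "p (I - J) (p J x) = \<one>"
        using J that by (auto simp: proj_proj proj_none Int_absorb Diff_disjoint inf_commute)
      moreover have "p J (p J x) = p J x" "p (I - J) (p (I - J) y) = p (I - J) y"
        using J that by (auto simp: proj_proj)
      ultimately show ?thesis using that J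
        by (intro bexI[of _ "p J x \<otimes> p (I - J) y"]) (auto simp: proj_mult proj_closed)
    qed
    then show "(\<lambda>x. (p J x, p (I - J) x)) ` carrier D = (p J ` carrier D) \<times> (p (I - J) ` carrier D)"
      using J by (auto simp: image_iff) metis
  qed
  then show ?thesis by (metis bij_betw_same_card card_cartesian_product)
qed

lemma factor_decomposition:
  assumes J: "J \<subseteq> I"
  shows "direct_decomposition (factor J) J p"
proof -
  interpret f: group "factor J" using factor_group[OF J] .
  have sub: "p J ` carrier D \<subseteq> carrier D" using J proj_closed by blast
  have clo: "p K (p J x) \<in> p J ` carrier D" if "K \<subseteq> J" "x \<in> carrier D" for K x
  proof -
    have "p K (p J x) = p J (p K x)" using that J proj_proj[of K J x] proj_proj[of J K x]
      by (simp add: Int_commute subset_trans)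
    then show ?thesis using that J proj_closed[of K x] by blast
  qed
  show ?thesis
  proof
    show "finite J" using J finite_index finite_subset by blast
  next
    fix K assume K: "K \<subseteq> J"
    then show "p K \<in> hom (factor J) (factor J)"
      using clo sub proj_mult[of K] J by (auto simp: hom_def proj_closed)
  next
    fix x assume "x \<in> carrier (factor J)"
    then show "p J x = x" using J by (auto simp: proj_proj)
  next
    fix x assume "x \<in> carrier (factor J)"
    then show "p {} x = \<one>\<^bsub>factor J\<^esub>" using sub by (auto simp: proj_none)
  next
    fix K L x assume "K \<subseteq> J" "L \<subseteq> J" "x \<in> carrier (factor J)"
    then show "p K (p L x) = p (K \<inter> L) x" using J sub proj_proj[of K L x] by auto
  next
    fix K L x assume "K \<subseteq> J" "L \<subseteq> J" "K \<inter> L = {}" "x \<in> carrier (factor J)"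
    then show "p (K \<union> L) x = p K x \<otimes>\<^bsub>factor J\<^esub> p L x" using J sub proj_Un[of K L x] by auto
  qed
qed

end

section \<open>Exchange of an indecomposable factor between two decompositions of one group\<close>

text \<open>On the factor \<open>?A\<close> of \<open>i\<close> the identity is the product of the
  maps \<open>p {i}\<close> after \<open>q {j}\<close>, so one of these is injective. For that
  \<open>j\<close> the factor \<open>?B\<close> is the direct product of the image \<open>?M\<close>
  of \<open>?A\<close> and the kernel \<open>?N\<close> of \<open>p {i}\<close>; indecomposability
  leaves \<open>?M = ?B\<close> and \<open>?N\<close> trivial. The first gives the isomorphism of
  factors, the second that of complements.\<close>

lemma decomposition_exchange:
  assumes dp: "direct_decomposition D I p" and dq: "direct_decomposition D I' q"
    and fin: "finite (carrier D)" and i: "i \<in> I"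
    and indp: "directly_indecomposable (D\<lparr>carrier := p {i} ` carrier D\<rparr>)"
    and indq: "\<And>j. j \<in> I' \<Longrightarrow> directly_indecomposable (D\<lparr>carrier := q {j} ` carrier D\<rparr>)"
  obtains j where "j \<in> I'"
    and "D\<lparr>carrier := p {i} ` carrier D\<rparr> \<cong> D\<lparr>carrier := q {j} ` carrier D\<rparr>"
    and "D\<lparr>carrier := p (I - {i}) ` carrier D\<rparr> \<cong> D\<lparr>carrier := q (I' - {j}) ` carrier D\<rparr>"
proof -
  interpret p: direct_decomposition D I p by (rule dp)
  interpret q: direct_decomposition D I' q by (rule dq)
  let ?A = "p.factor {i}"
  have iI: "{i} \<subseteq> I" using i by simp
  interpret A: group ?A by (rule p.factor_group[OF iI])
  have Asub: "carrier ?A \<subseteq> carrier D" using p.proj_closed[OF iI] by auto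
  have finA: "finite (carrier ?A)" using fin by simp
  have pA: "p {i} a = a" if "a \<in> carrier ?A" for a using that iI by (auto simp: p.proj_proj)
  have A1: "\<exists>a\<in>carrier ?A. a \<noteq> \<one>\<^bsub>D\<^esub>"
    using indp A.one_closed unfolding directly_indecomposable_def by auto
  have oneA: "\<one>\<^bsub>D\<^esub> \<in> carrier ?A" using A.one_closed by simp
  define \<sigma> where "\<sigma> J x = p {i} (q J x)" for J x
  have ne: "normal_endo ?A (\<sigma> J)" if J: "J \<subseteq> I'" for J
  proof -
    have "normal_endo D (\<sigma> J)" unfolding \<sigma>_def
      by (rule normal_endo_comp[OF p.proj_normal_endo[OF iI] q.proj_normal_endo[OF J]])
    then show ?thesis using Asub q.proj_closed[OF J] unfolding normal_endo_def hom_def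
      by (auto simp: \<sigma>_def Pi_iff subset_iff)
  qed
  have "\<exists>j\<in>J. inj_on (\<sigma> {j}) (carrier ?A)" if "J \<subseteq> I'" "inj_on (\<sigma> J) (carrier ?A)" for J
  proof -
    have "finite J" using that q.finite_index finite_subset by blast
    then show ?thesis using that
    proof (induction J)
      \<comment> \<open>\<open>\<sigma> {}\<close> is constant and so cannot be injective on the
        non-trivial group \<open>?A\<close>.\<close>
      case empty
      obtain a where a: "a \<in> carrier ?A" "a \<noteq> \<one>\<^bsub>D\<^esub>" using A1 by blast
      have "\<sigma> {} a = \<sigma> {} \<one>\<^bsub>D\<^esub>" using a Asub unfolding \<sigma>_def
        by (auto simp: q.proj_none p.proj_one)
      then have "a = \<one>\<^bsub>D\<^esub>" using empty(2) a A.one_closed by (auto dest!: inj_onD)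
      then show ?case using a by simp
    next
      case (insert j J)
      have sub: "{j} \<subseteq> I'" "J \<subseteq> I'" using insert by auto
      have "inj_on (\<sigma> {j}) (carrier ?A) \<or> inj_on (\<sigma> J) (carrier ?A)"
      proof (rule A.normal_endo_inj_summand[OF finA indp ne[OF insert.prems(1)] ne[OF sub(1)] ne[OF sub(2)] _ insert.prems(2)])
        fix x assume x: "x \<in> carrier ?A"
        then have xD: "x \<in> carrier D" using Asub by blast
        have "q (insert j J) x = q {j} x \<otimes>\<^bsub>D\<^esub> q J x"
          using q.proj_Un[OF sub _ xD] insert.hyps by simp
        then show "\<sigma> (insert j J) x = \<sigma> {j} x \<otimes>\<^bsub>?A\<^esub> \<sigma> J x"
          using sub xD iI unfolding \<sigma>_def by (simp add: p.proj_mult q.proj_closed)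
      qed
      then show ?case using insert by auto
    qed
  qed
  moreover have "inj_on (\<sigma> I') (carrier ?A)"
    using pA Asub unfolding \<sigma>_def by (intro inj_onI) (metis q.proj_all subsetD)
  ultimately obtain j where j: "j \<in> I'" and inj: "inj_on (\<sigma> {j}) (carrier ?A)" by blast
  have jI: "{j} \<subseteq> I'" using j by simp
  let ?B = "q.factor {j}"
  interpret B: group ?B by (rule q.factor_group[OF jI])
  have Bsub: "carrier ?B \<subseteq> carrier D" using q.proj_closed[OF jI] by auto
  have injq: "inj_on (q {j}) (carrier ?A)"
    using inj unfolding \<sigma>_def by (auto simp: inj_on_def)
  have surj: "\<sigma> {j} ` carrier ?A = carrier ?A"
  proof (rule card_subset_eq[OF finA])
    show "\<sigma> {j} ` carrier ?A \<subseteq> carrier ?A" using ne[OF jI] unfolding normal_endo_def hom_def by blast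
    show "card (\<sigma> {j} ` carrier ?A) = card (carrier ?A)" using inj by (rule card_image)
  qed
  let ?M = "q {j} ` carrier ?A" and ?N = "{b \<in> carrier ?B. p {i} b = \<one>\<^bsub>D\<^esub>}"
  have inv: "inv\<^bsub>?B\<^esub> b = inv\<^bsub>D\<^esub> b" if "b \<in> carrier ?B" for b
    using p.m_inv_consistent[OF q.factor_subgroup[OF jI]] that by simp
  have Adq: "subgroup ?M D"
  proof -
    have "group_hom D D (q {j})" using q.proj_group_hom jI .
    then show ?thesis using group_hom.subgroup_img_is_subgroup p.factor_subgroup[OF iI] by fastforce
  qed
  have MB: "?M \<subseteq> carrier ?B" using Asub by auto
  have An: "x \<otimes>\<^bsub>D\<^esub> a \<otimes>\<^bsub>D\<^esub> inv\<^bsub>D\<^esub> x \<in> carrier ?A" if "x \<in> carrier D" "a \<in> carrier ?A" for x a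
  proof -
    have "\<forall>h\<in>carrier ?A. x \<otimes>\<^bsub>D\<^esub> h \<otimes>\<^bsub>D\<^esub> inv\<^bsub>D\<^esub> x \<in> carrier ?A"
      using p.normal_endo_image_normal[OF p.proj_normal_endo[OF iI]] that(1)
      unfolding p.normal_inv_iff by auto
    then show ?thesis using that(2) by blast
  qed
  \<comment> \<open>As \<open>b = q {j} b\<close>, conjugating \<open>q {j} a\<close> by
    \<open>b\<close> amounts to applying \<open>q {j}\<close> to a conjugate of \<open>a\<close>,
    and \<open>?A\<close> is normal in \<open>D\<close>.\<close>
  have Mn: "?M \<lhd> ?B"
    unfolding B.normal_inv_iff
  proof (intro conjI ballI)
    show "subgroup ?M ?B"
      using p.subgroup_incl[OF Adq q.factor_subgroup[OF jI]] MB by simp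
    fix b m assume b: "b \<in> carrier ?B" and "m \<in> ?M"
    then obtain a where a: "a \<in> carrier ?A" "m = q {j} a" by blast
    have bD: "b \<in> carrier D" "a \<in> carrier D" using b a Bsub Asub by auto
    have "b = q {j} b" using b jI by (auto simp: q.proj_proj)
    then have "b \<otimes>\<^bsub>D\<^esub> m \<otimes>\<^bsub>D\<^esub> inv\<^bsub>D\<^esub> b = q {j} (b \<otimes>\<^bsub>D\<^esub> a \<otimes>\<^bsub>D\<^esub> inv\<^bsub>D\<^esub> b)"
      using bD a jI group_hom.hom_inv[OF q.proj_group_hom[OF jI] bD(1)]
      by (simp add: q.proj_mult)
    then show "b \<otimes>\<^bsub>?B\<^esub> m \<otimes>\<^bsub>?B\<^esub> inv\<^bsub>?B\<^esub> b \<in> ?M" using An[OF bD(1) a(1)] inv[OF b] by auto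
  qed
  have homB: "group_hom ?B D (p {i})"
    unfolding group_hom_def group_hom_axioms_def
    using B.is_group p.is_group Bsub iI by (auto simp: hom_def p.proj_closed p.proj_mult subset_iff)
  then have Nn: "?N \<lhd> ?B" using group_hom.normal_kernel[of ?B D "p {i}"] by (simp add: kernel_def)
  have "?M \<inter> ?N = {\<one>\<^bsub>?B\<^esub>}"
  proof -
    have "x = \<one>\<^bsub>D\<^esub>" if "x \<in> ?M" "x \<in> ?N" for x
    proof -
      from that(1) obtain a where a: "x = q {j} a" "a \<in> carrier ?A" by (rule imageE)
      have "p {i} x = \<one>\<^bsub>D\<^esub>" using that(2) by blast
      then have "\<sigma> {j} a = \<sigma> {j} \<one>\<^bsub>D\<^esub>"
        unfolding \<sigma>_def using a(1) q.proj_one[OF jI] p.proj_one[OF iI] by simp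
      then have "a = \<one>\<^bsub>D\<^esub>" using a A.one_closed inj by (auto dest!: inj_onD)
      then show ?thesis using a jI by (simp add: q.proj_one)
    qed
    moreover have "\<one>\<^bsub>D\<^esub> \<in> ?M" using subgroup.one_closed[OF Adq] .
    moreover from this have "\<one>\<^bsub>D\<^esub> \<in> ?N" using B.one_closed p.proj_one[OF iI] by simp
    ultimately have "?M \<inter> ?N = {\<one>\<^bsub>D\<^esub>}" by (intro equalityI subsetI) (erule IntE, simp, simp)
    then show ?thesis by simp
  qed
  moreover have "?M <#>\<^bsub>?B\<^esub> ?N = carrier ?B"
  proof
    show "?M <#>\<^bsub>?B\<^esub> ?N \<subseteq> carrier ?B" using MB B.m_closed unfolding set_mult_def by blast
    show "carrier ?B \<subseteq> ?M <#>\<^bsub>?B\<^esub> ?N"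
    proof
      fix b assume b: "b \<in> carrier ?B"
      then have "p {i} b \<in> carrier ?A" using Bsub by auto
      then have "p {i} b \<in> \<sigma> {j} ` carrier ?A" unfolding surj .
      \<comment> \<open>\<open>\<sigma> {j}\<close> is onto \<open>?A\<close>, so some
        \<open>q {j} a\<close> has the same image under \<open>p {i}\<close> as \<open>b\<close>;
        their quotient lies in \<open>?N\<close>.\<close>
      then obtain a where a: "p {i} b = \<sigma> {j} a" "a \<in> carrier ?A"  by (rule imageE)
      let ?m = "q {j} a"
      have mM: "?m \<in> ?M" using a(2) by (rule imageI)
      then have m: "?m \<in> carrier ?B" using MB by (rule rev_subsetD)
      have mD: "?m \<in> carrier D" "b \<in> carrier D" using m b Bsub by auto
      have n: "inv\<^bsub>?B\<^esub> ?m \<otimes>\<^bsub>?B\<^esub> b \<in> carrier ?B" using m b B.inv_closed B.m_closed by blast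
      have "p {i} (inv\<^bsub>D\<^esub> ?m \<otimes>\<^bsub>D\<^esub> b) = \<one>\<^bsub>D\<^esub>"
        using a(1) mD iI group_hom.hom_inv[OF p.proj_group_hom[OF iI]] 
        by (simp add: \<sigma>_def p.proj_mult p.proj_closed)
      then have "inv\<^bsub>?B\<^esub> ?m \<otimes>\<^bsub>?B\<^esub> b \<in> ?N" using n inv[OF m] by simp
      moreover have "b = ?m \<otimes>\<^bsub>?B\<^esub> (inv\<^bsub>?B\<^esub> ?m \<otimes>\<^bsub>?B\<^esub> b)"
        using B.m_assoc[symmetric] B.r_inv B.l_one B.inv_closed m b by metis
      ultimately show "b \<in> ?M <#>\<^bsub>?B\<^esub> ?N" using mM unfolding set_mult_def
        by (intro UN_I) (assumption, assumption, simp)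
    qed
  qed
  moreover have "?M \<noteq> {\<one>\<^bsub>?B\<^esub>}"
  proof
    assume M1: "?M = {\<one>\<^bsub>?B\<^esub>}"
    obtain a where a: "a \<in> carrier ?A" "a \<noteq> \<one>\<^bsub>D\<^esub>" using A1 by blast
    have "q {j} a \<in> ?M" using a(1) by (rule imageI)
    then have "q {j} a = \<one>\<^bsub>D\<^esub>" unfolding M1 by simp
    then have "a = \<one>\<^bsub>D\<^esub>" 
      using inj_onD[OF injq _ a(1) oneA] q.proj_one[OF jI] by simp
    then show False using a by simp
  qed
  ultimately have N1: "?N = {\<one>\<^bsub>?B\<^esub>}"
    using indq[OF j] Mn Nn unfolding directly_indecomposable_def by blast
  have MBeq: "?M = carrier ?B"
  proof
    show "?M \<subseteq> carrier ?B" by (rule MB)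
    have "carrier ?B = ?M <#>\<^bsub>?B\<^esub> {\<one>\<^bsub>?B\<^esub>}" using \<open>?M <#>\<^bsub>?B\<^esub> ?N = carrier ?B\<close> N1 by simp
    moreover have "?M <#>\<^bsub>?B\<^esub> {\<one>\<^bsub>?B\<^esub>} = ?M"
    proof -
      have "m \<otimes>\<^bsub>?B\<^esub> \<one>\<^bsub>?B\<^esub> = m" if "m \<in> ?M" for m using MB that B.r_one by blast
      then show ?thesis unfolding set_mult_def by simp
    qed
    ultimately show "carrier ?B \<subseteq> ?M" by simp
  qed
  have isoAB: "?A \<cong> ?B"
  proof (rule is_isoI)
    show "q {j} \<in> iso ?A ?B" unfolding iso_def bij_betw_def
      using injq MBeq Asub jI by (auto simp: hom_def q.proj_mult subset_iff)
  qed
  let ?C = "p.factor (I - {i})" and ?E = "q.factor (I' - {j})"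
  have sub: "I - {i} \<subseteq> I" "I' - {j} \<subseteq> I'" by auto
  have Csub: "carrier ?C \<subseteq> carrier D" using p.proj_closed[OF sub(1)] by auto
  have pC: "p {i} c = \<one>\<^bsub>D\<^esub>" if "c \<in> carrier ?C" for c
    using that iI sub by (auto simp: p.proj_proj p.proj_none)
  interpret C: group ?C by (rule p.factor_group[OF sub(1)])
  interpret E: group ?E by (rule q.factor_group[OF sub(2)])
  have hC: "group_hom ?C ?E (q (I' - {j}))"
    unfolding group_hom_def group_hom_axioms_def
    using C.is_group E.is_group Csub sub by (auto simp: hom_def q.proj_mult subset_iff)
  have injC: "inj_on (q (I' - {j})) (carrier ?C)"
  proof -
    have "c = \<one>\<^bsub>D\<^esub>" if c: "c \<in> carrier ?C" "q (I' - {j}) c = \<one>\<^bsub>D\<^esub>" for c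
    proof -
      have cD: "c \<in> carrier D" using c Csub by blast
      \<comment> \<open>An element killed by \<open>q (I' - {j})\<close> lies in \<open>?B\<close>;
        as \<open>p {i}\<close> kills it too, it lies in the trivial group
        \<open>?N\<close>.\<close>
      have "c = q {j} c" using q.proj_compl[OF jI cD] c jI cD by (simp add: q.proj_closed)
      then have "c \<in> carrier ?B" using cD by auto
      then show ?thesis using N1 pC[OF c(1)] by auto
    qed
    then have "kernel ?C ?E (q (I' - {j})) = {\<one>\<^bsub>?C\<^esub>}"
      using C.one_closed q.proj_one[OF sub(2)] by (auto simp: kernel_def)
    then show ?thesis using group_hom.inj_iff_trivial_ker[OF hC] by blast
  qed
  have "card (carrier ?A) = card (carrier ?B)" using MBeq injq card_image by metis
  moreover have "card (carrier ?A) > 0" using finA A.one_closed card_gt_0_iff by blast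
  ultimately have "card (carrier ?C) = card (carrier ?E)"
    using p.card_factor_compl[OF iI] q.card_factor_compl[OF jI] by simp
  then have "q (I' - {j}) ` carrier ?C = carrier ?E"
    using Csub fin injC by (intro card_subset_eq) (auto simp: card_image subset_iff)
  then have "q (I' - {j}) \<in> iso ?C ?E"
    using hC injC unfolding iso_def bij_betw_def group_hom_def group_hom_axioms_def by blast
  then have "?C \<cong> ?E" by (rule is_isoI)
  with j isoAB show thesis by (rule that)
qed

section \<open>Transport along isomorphisms and the Krull-Schmidt theorem\<close>

lemma iso_normal_image:
  assumes "group A" "group B" "h \<in> iso A B" "H \<lhd> A"
  shows "h ` H \<lhd> B"
proof -
  interpret A: group A by fact
  interpret B: group B by fact
  interpret h: group_hom A B h
    using assms by (simp add: group_hom_def group_hom_axioms_def iso_def)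
  have H: "subgroup H A" "\<And>x a. x \<in> carrier A \<Longrightarrow> a \<in> H \<Longrightarrow> x \<otimes>\<^bsub>A\<^esub> a \<otimes>\<^bsub>A\<^esub> inv\<^bsub>A\<^esub> x \<in> H"
    using assms(4) A.normal_inv_iff by blast+
  have surj: "h ` carrier A = carrier B" using assms(3) by (simp add: iso_def bij_betw_def)
  have "y \<otimes>\<^bsub>B\<^esub> h a \<otimes>\<^bsub>B\<^esub> inv\<^bsub>B\<^esub> y \<in> h ` H" if y: "y \<in> carrier B" and a: "a \<in> H" for y a
  proof -
    obtain x where x: "x \<in> carrier A" "y = h x" using y surj by blast
    have "a \<in> carrier A" using subgroup.subset[OF H(1)] a by blast
    then have "y \<otimes>\<^bsub>B\<^esub> h a \<otimes>\<^bsub>B\<^esub> inv\<^bsub>B\<^esub> y = h (x \<otimes>\<^bsub>A\<^esub> a \<otimes>\<^bsub>A\<^esub> inv\<^bsub>A\<^esub> x)" using x by simp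
    then show ?thesis using H(2) x a by blast
  qed
  then show ?thesis
    using h.subgroup_img_is_subgroup[OF H(1)] by (auto simp: B.normal_inv_iff)
qed

lemma directly_indecomposable_iso:
  assumes "group A" "group B" "A \<cong> B" "directly_indecomposable A"
  shows "directly_indecomposable B"
proof -
  interpret A: group A by fact
  interpret B: group B by fact
  obtain h where h: "h \<in> iso B A" using A.iso_sym assms(3) B.iso_sym unfolding is_iso_def by blast
  interpret h: group_hom B A h
    using h by (simp add: group_hom_def group_hom_axioms_def iso_def A.is_group B.is_group)
  have surj: "h ` carrier B = carrier A" and inj: "inj_on h (carrier B)"
    using h by (auto simp: iso_def bij_betw_def)
  have tri: "h ` S = {\<one>\<^bsub>A\<^esub>} \<longleftrightarrow> S = {\<one>\<^bsub>B\<^esub>}" if "S \<subseteq> carrier B" for S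
    using inj_on_image_eq_iff[OF inj that, of "{\<one>\<^bsub>B\<^esub>}"] by simp
  show ?thesis
    unfolding directly_indecomposable_def
  proof (intro conjI notI)
    assume "carrier B = {\<one>\<^bsub>B\<^esub>}"
    then show False using assms(4) surj unfolding directly_indecomposable_def by auto
  next
    assume "\<exists>H K. H \<lhd> B \<and> K \<lhd> B \<and> H \<inter> K = {\<one>\<^bsub>B\<^esub>} \<and> H <#>\<^bsub>B\<^esub> K = carrier B
      \<and> H \<noteq> {\<one>\<^bsub>B\<^esub>} \<and> K \<noteq> {\<one>\<^bsub>B\<^esub>}"
    then obtain H K where HK: "H \<lhd> B" "K \<lhd> B" "H \<inter> K = {\<one>\<^bsub>B\<^esub>}" "H <#>\<^bsub>B\<^esub> K = carrier B"
      "H \<noteq> {\<one>\<^bsub>B\<^esub>}" "K \<noteq> {\<one>\<^bsub>B\<^esub>}" by blast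
    have sub: "H \<subseteq> carrier B" "K \<subseteq> carrier B"
      using HK(1,2) by (auto simp: normal_def subgroup.subset dest: subgroup.subset)
    have "h ` H \<inter> h ` K = {\<one>\<^bsub>A\<^esub>}"
      using inj_on_image_Int[OF inj sub] HK(3) by simp
    moreover have "h ` H <#>\<^bsub>A\<^esub> h ` K = carrier A"
      using h.hom_mult sub surj HK(4) h.homh set_mult_hom[of h B A H K] by simp
    ultimately show False
      using assms(4) HK tri[OF sub(1)] tri[OF sub(2)]
        iso_normal_image[OF B.is_group A.is_group h HK(1)]
        iso_normal_image[OF B.is_group A.is_group h HK(2)]
      unfolding directly_indecomposable_def by blast
  qed
qed

lemma iso_restrict_subgroup:
  assumes "h \<in> iso A B" "S \<subseteq> carrier A"
  shows "h \<in> iso (A\<lparr>carrier := S\<rparr>) (B\<lparr>carrier := h ` S\<rparr>)"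
  using assms unfolding iso_def bij_betw_def hom_def by (auto intro: inj_on_subset simp: subset_iff)

definition transport_proj ::
  "('a, 'c) monoid_scheme \<Rightarrow> ('a \<Rightarrow> 'b) \<Rightarrow> ('i set \<Rightarrow> 'a \<Rightarrow> 'a) \<Rightarrow> 'i set \<Rightarrow> 'b \<Rightarrow> 'b" where
  "transport_proj A h q J x = h (q J (inv_into (carrier A) h x))"

text \<open>The exchange argument compares two decompositions of a single group; carrying one of
  them across an isomorphism reduces the case of two isomorphic groups to it.\<close>

lemma direct_decomposition_transport:
  assumes "direct_decomposition A I q" "group B" "h \<in> iso A B"
  shows "direct_decomposition B I (transport_proj A h q)" 
    and "\<And>J. J \<subseteq> I \<Longrightarrow>
      A\<lparr>carrier := q J ` carrier A\<rparr> \<cong> B\<lparr>carrier := transport_proj A h q J ` carrier B\<rparr>"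
proof -
  let ?q' = "transport_proj A h q"
  interpret q: direct_decomposition A I q by fact
  interpret B: group B by fact
  interpret h: group_hom A B h
    using assms by (simp add: group_hom_def group_hom_axioms_def iso_def q.is_group)
  have surj: "h ` carrier A = carrier B" and inj: "inj_on h (carrier A)"
    using assms(3) by (auto simp: iso_def bij_betw_def)
  have q': "?q' J (h x) = h (q J x)" if "x \<in> carrier A" for J x
    unfolding transport_proj_def using that inj by simp
  have ex: "\<exists>a\<in>carrier A. x = h a" if "x \<in> carrier B" for x using that surj by blast
  show "direct_decomposition B I ?q'"
  proof
    show "finite I" by (rule q.finite_index)
  next
    fix J assume J: "J \<subseteq> I"
    have "?q' J (h x) \<in> carrier B" if "x \<in> carrier A" for x
      using that J by (simp add: q' q.proj_closed)
    moreover have "?q' J (h x \<otimes>\<^bsub>B\<^esub> h y) = ?q' J (h x) \<otimes>\<^bsub>B\<^esub> ?q' J (h y)"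
      if "x \<in> carrier A" "y \<in> carrier A" for x y
      using that J q'[of "x \<otimes>\<^bsub>A\<^esub> y"] by (simp add: q' q.proj_closed q.proj_mult)
    ultimately show "?q' J \<in> hom B B" unfolding hom_def surj[symmetric] by auto
  next
    fix x assume "x \<in> carrier B"
    then show "?q' I x = x" "?q' {} x = \<one>\<^bsub>B\<^esub>"
      using ex[of x] by (auto simp: q' q.proj_all q.proj_none)
  next
    fix J J' x assume "J \<subseteq> I" "J' \<subseteq> I" "x \<in> carrier B"
    then show "?q' J (?q' J' x) = ?q' (J \<inter> J') x"
      using ex[of x] by (auto simp: q' q.proj_proj q.proj_closed)
  next
    fix J J' x assume "J \<subseteq> I" "J' \<subseteq> I" "J \<inter> J' = {}" "x \<in> carrier B"
    then show "?q' (J \<union> J') x = ?q' J x \<otimes>\<^bsub>B\<^esub> ?q' J' x"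
      using ex[of x] by (auto simp: q' q.proj_Un q.proj_closed)
  qed
  fix J assume J: "J \<subseteq> I"
  have "?q' J ` carrier B = h ` (q J ` carrier A)"
    unfolding surj[symmetric] using q' by (simp add: image_image)
  moreover have "q J ` carrier A \<subseteq> carrier A" using q.proj_closed[OF J] by blast
  ultimately show "A\<lparr>carrier := q J ` carrier A\<rparr> \<cong> B\<lparr>carrier := ?q' J ` carrier B\<rparr>"
    using iso_restrict_subgroup[OF assms(3), of "q J ` carrier A"] by (simp add: is_isoI)
qed

text \<open>Induction on the number of factors: the exchange matches one factor on each side and
  leaves isomorphic complements, which the same projections decompose over the remaining
  indices.\<close>

theorem krull_schmidt:
  assumes "direct_decomposition A I p" "direct_decomposition B I' q"
    and "finite (carrier A)" "A \<cong> B"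
    and "\<And>i. i \<in> I \<Longrightarrow> directly_indecomposable (A\<lparr>carrier := p {i} ` carrier A\<rparr>)"
    and "\<And>j. j \<in> I' \<Longrightarrow> directly_indecomposable (B\<lparr>carrier := q {j} ` carrier B\<rparr>)"
  shows "\<exists>f. bij_betw f I I' \<and>
    (\<forall>i\<in>I. A\<lparr>carrier := p {i} ` carrier A\<rparr> \<cong> B\<lparr>carrier := q {f i} ` carrier B\<rparr>)"
  using assms
proof (induction "card I" arbitrary: I I' A B)
  case 0
  interpret p: direct_decomposition A I p by fact
  interpret q: direct_decomposition B I' q by fact
  have I: "I = {}" using 0 p.finite_index by simp
  have "carrier A = {\<one>\<^bsub>A\<^esub>}" using p.proj_all p.proj_none I by force
  then have "card (carrier B) = 1" using iso_same_card[OF \<open>A \<cong> B\<close>] by simp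
  then have B: "carrier B = {\<one>\<^bsub>B\<^esub>}" using q.one_closed by (metis card_1_singletonE singletonD)
  \<comment> \<open>By definition the trivial group is not directly indecomposable, so
    \<open>I'\<close> has to be empty as well.\<close>
  have "False" if "j \<in> I'" for j
    using 0(7)[OF that] B q.proj_one[of "{j}"] that unfolding directly_indecomposable_def by simp
  then have "I' = {}" by blast
  then show ?case using I by (simp add: bij_betw_def)
next
  case (Suc n)
  interpret p: direct_decomposition A I p by fact
  interpret q: direct_decomposition B I' q by fact
  obtain i where i: "i \<in> I" using Suc(2) by fastforce
  obtain h where h: "h \<in> iso B A"
    using p.iso_sym[OF \<open>A \<cong> B\<close>] unfolding is_iso_def by blast
  define q' where "q' = transport_proj B h q"
  note tr = direct_decomposition_transport[OF q.direct_decomposition_axioms p.is_group h, folded q'_def]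
  interpret q': direct_decomposition A I' q' by (rule tr(1))
  have ind': "directly_indecomposable (q'.factor {j})" if "j \<in> I'" for j
    by (rule directly_indecomposable_iso[OF q.factor_group q'.factor_group tr(2) Suc(8)])
      (use that in auto)
  obtain j where j: "j \<in> I'" and ij: "p.factor {i} \<cong> q'.factor {j}"
    and rest: "p.factor (I - {i}) \<cong> q'.factor (I' - {j})"
    by (rule decomposition_exchange[OF Suc(3) tr(1) Suc(5) i Suc(7)[OF i] ind'])
  have sub: "I - {i} \<subseteq> I" "I' - {j} \<subseteq> I'" "{j} \<subseteq> I'" using j by auto
  have q'q: "q'.factor J \<cong> q.factor J" if "J \<subseteq> I'" for J
    using group.iso_sym[OF q.factor_group[OF that] tr(2)[OF that]] .
  \<comment> \<open>The induction hypothesis speaks of factors inside the complement. They are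
    factors of the whole group, since \<open>p {k}\<close> absorbs
    \<open>p (I - {i})\<close>.\<close>
  have fp: "(p.factor (I - {i}))\<lparr>carrier := p {k} ` carrier (p.factor (I - {i}))\<rparr> = p.factor {k}"
    if "k \<in> I - {i}" for k
  proof -
    have "p {k} ` p (I - {i}) ` carrier A = p {k} ` carrier A"
      unfolding image_image using that
      by (intro image_cong) (auto simp: p.proj_proj Int_absorb2 intro!: arg_cong2[of _ _ _ _ p])
    then show ?thesis by simp
  qed
  have fq: "(q.factor (I' - {j}))\<lparr>carrier := q {k} ` carrier (q.factor (I' - {j}))\<rparr> = q.factor {k}"
    if "k \<in> I' - {j}" for k
  proof -
    have "q {k} ` q (I' - {j}) ` carrier B = q {k} ` carrier B"
      unfolding image_image using that
      by (intro image_cong) (auto simp: q.proj_proj Int_absorb2 intro!: arg_cong2[of _ _ _ _ q])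
    then show ?thesis by simp
  qed
  have "\<exists>f. bij_betw f (I - {i}) (I' - {j}) \<and> (\<forall>k\<in>I - {i}.
      (p.factor (I - {i}))\<lparr>carrier := p {k} ` carrier (p.factor (I - {i}))\<rparr> \<cong>
      (q.factor (I' - {j}))\<lparr>carrier := q {f k} ` carrier (q.factor (I' - {j}))\<rparr>)"
  proof (rule Suc.hyps(1))
    show "n = card (I - {i})" using Suc(2) i p.finite_index by simp
    show "direct_decomposition (p.factor (I - {i})) (I - {i}) p"
      by (rule p.factor_decomposition[OF sub(1)])
    show "direct_decomposition (q.factor (I' - {j})) (I' - {j}) q"
      by (rule q.factor_decomposition[OF sub(2)])
    show "finite (carrier (p.factor (I - {i})))" using Suc(5) by simp
    show "p.factor (I - {i}) \<cong> q.factor (I' - {j})" using iso_trans[OF rest q'q[OF sub(2)]] .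
  qed (use fp fq Suc(7,8) in \<open>metis Diff_iff\<close>)+
  then obtain f where f: "bij_betw f (I - {i}) (I' - {j})"
    and fk': "\<And>k. k \<in> I - {i} \<Longrightarrow>
      (p.factor (I - {i}))\<lparr>carrier := p {k} ` carrier (p.factor (I - {i}))\<rparr> \<cong>
      (q.factor (I' - {j}))\<lparr>carrier := q {f k} ` carrier (q.factor (I' - {j}))\<rparr>" by blast
  have fk: "p.factor {k} \<cong> q.factor {f k}" if "k \<in> I - {i}" for k
    using fk'[OF that] unfolding fp[OF that] fq[OF bij_betwE[OF f, rule_format, OF that]] .
  have "bij_betw (f(i := j)) (insert i (I - {i})) (insert j (I' - {j}))"
    using f unfolding bij_betw_def by (auto simp: inj_on_def)
  then have "bij_betw (f(i := j)) I I'" using i j by (simp add: insert_absorb)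
  moreover have "p.factor {k} \<cong> q.factor {(f(i := j)) k}" if "k \<in> I" for k
    using that fk iso_trans[OF ij q'q[OF sub(3)]] by simp
  ultimately show ?case by blast
qed

section \<open>Graph products and parabolic subgroups\<close>

locale graph_prod =
  fixes V :: "'v set" and E :: "'v \<Rightarrow> 'v \<Rightarrow> bool" and G :: "'v \<Rightarrow> 'g monoid"
  assumes graph: "simplicial_graph V E"
    and vgroup: "v \<in> V \<Longrightarrow> group (G v)"
begin

abbreviation "wd \<equiv> gp_word V G"
abbreviation "rel \<equiv> gp_rel V E G"
abbreviation "cls \<equiv> gp_class V E G"
abbreviation "GP \<equiv> graph_product V E G"

lemma adj_in: "E v w \<Longrightarrow> v \<in> V \<and> w \<in> V"
  and adj_sym: "E v w \<Longrightarrow> E w v"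
  and adj_irrefl: "\<not> E v v"
  and finite_V: "finite V"
  using graph by (auto simp: simplicial_graph_def)

lemma wd_Nil [simp]: "wd []"
  and wd_Cons [simp]: "wd ((v, g) # w) \<longleftrightarrow> v \<in> V \<and> g \<in> carrier (G v) \<and> wd w"
  and wd_append [simp]: "wd (x @ y) \<longleftrightarrow> wd x \<and> wd y"
  by (auto simp: gp_word_def)

lemma rel_wd: "rel x y \<Longrightarrow> wd x \<and> wd y"
proof (induction rule: gp_rel.induct)
  case (gp_merge u w v g h)
  then interpret group "G v" using vgroup by blast
  show ?case using gp_merge by simp
next
  case (gp_unit u w v)
  then interpret group "G v" using vgroup by blast
  show ?case using gp_unit by simp
next
  case (gp_comm u w v v' g h)
  then show ?case using adj_in[of v v'] by simp
qed auto

lemma rel_context: "rel x y \<Longrightarrow> wd a \<Longrightarrow> wd b \<Longrightarrow> rel (a @ x @ b) (a @ y @ b)"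
proof (induction rule: gp_rel.induct)
  case (gp_merge u w v g h)
  then show ?case using gp_rel.gp_merge[of V G "a @ u" "w @ b" v g h E] by simp
next
  case (gp_unit u w v)
  then show ?case using gp_rel.gp_unit[of V G "a @ u" "w @ b" v E] by simp
next
  case (gp_comm u w v v' g h)
  then show ?case using gp_rel.gp_comm[of V G "a @ u" "w @ b" E v v' g h] by simp
qed (auto intro: gp_rel.intros)

lemma rel_append: "rel x y \<Longrightarrow> rel x' y' \<Longrightarrow> rel (x @ x') (y @ y')"
  using rel_context[of x y "[]" x'] rel_context[of x' y' y "[]"] rel_wd
  by (auto intro: gp_trans)

lemma cls_eq_iff: "wd x \<Longrightarrow> cls x = cls y \<longleftrightarrow> rel x y"
  unfolding gp_class_def by (auto intro: gp_refl gp_sym gp_trans)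

lemma cls_self: "wd x \<Longrightarrow> x \<in> cls x"
  by (simp add: gp_class_def gp_refl)

lemma carrier_GP: "carrier GP = cls ` {w. wd w}"
  and one_GP: "\<one>\<^bsub>GP\<^esub> = cls []"
  by (simp_all add: graph_product_def)

lemma cls_closed: "wd x \<Longrightarrow> cls x \<in> carrier GP"
  by (simp add: carrier_GP)

lemma cls_mult: 
  assumes "wd x" "wd y"
  shows "cls x \<otimes>\<^bsub>GP\<^esub> cls y = cls (x @ y)"
proof -
  have "(\<exists>x'\<in>cls x. \<exists>y'\<in>cls y. rel (x' @ y') z) \<longleftrightarrow> rel (x @ y) z" for z
  proof
    assume "\<exists>x'\<in>cls x. \<exists>y'\<in>cls y. rel (x' @ y') z"
    then show "rel (x @ y) z" unfolding gp_class_def by (auto intro: gp_trans rel_append)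
  next
    assume "rel (x @ y) z"
    then show "\<exists>x'\<in>cls x. \<exists>y'\<in>cls y. rel (x' @ y') z" using assms cls_self by blast
  qed
  then show ?thesis by (simp add: graph_product_def gp_class_def)
qed

lemma rel_inverse:
  assumes "wd w"
  shows "\<exists>w'. wd w' \<and> rel (w' @ w) []"
  using assms
proof (induction w)
  case Nil
  then show ?case by (auto intro!: exI[of _ "[]"] gp_refl)
next
  case (Cons a w)
  obtain v g where a: "a = (v, g)" by fastforce
  with Cons obtain w' where w': "wd w'" "rel (w' @ w) []" by auto
  have vg: "v \<in> V" "g \<in> carrier (G v)" "wd w" using Cons a by auto
  interpret group "G v" using vg vgroup by blast
  have "rel (w' @ [(v, inv\<^bsub>G v\<^esub> g), (v, g)] @ w) (w' @ [(v, inv\<^bsub>G v\<^esub> g \<otimes>\<^bsub>G v\<^esub> g)] @ w)"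
    using w' vg by (intro gp_merge) auto
  moreover have "rel (w' @ [(v, inv\<^bsub>G v\<^esub> g \<otimes>\<^bsub>G v\<^esub> g)] @ w) (w' @ w)"
    using gp_unit[of V G w' w v E] w' vg by simp
  ultimately have "rel ((w' @ [(v, inv\<^bsub>G v\<^esub> g)]) @ a # w) []"
    using w' a by (auto intro: gp_trans)
  then show ?case using w' vg by (intro exI[of _ "w' @ [(v, inv\<^bsub>G v\<^esub> g)]"]) auto
qed

lemma group_GP: "group GP"
proof (rule groupI)
  fix x assume "x \<in> carrier GP"
  then obtain w where w: "wd w" "x = cls w" by (auto simp: carrier_GP)
  obtain w' where w': "wd w'" "rel (w' @ w) []" using rel_inverse[OF w(1)] by blast
  then have "cls (w' @ w) = cls []" using w by (simp add: cls_eq_iff)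
  then have "cls w' \<otimes>\<^bsub>GP\<^esub> x = \<one>\<^bsub>GP\<^esub>" using w w' by (simp add: cls_mult one_GP)
  then show "\<exists>y\<in>carrier GP. y \<otimes>\<^bsub>GP\<^esub> x = \<one>\<^bsub>GP\<^esub>" using w' cls_closed by blast
qed (auto simp: carrier_GP cls_mult one_GP)

sublocale GP: group GP by (rule group_GP)

definition gen :: "'v \<Rightarrow> 'g \<Rightarrow> ('v \<times> 'g) list set" where
  "gen v g = cls [(v, g)]"

lemma gen_hom:
  assumes "v \<in> V"
  shows "gen v \<in> hom (G v) GP"
proof -
  interpret group "G v" using assms vgroup by blast
  have "rel ([] @ [(v, g), (v, h)] @ []) ([] @ [(v, g \<otimes>\<^bsub>G v\<^esub> h)] @ [])"
    if "g \<in> carrier (G v)" "h \<in> carrier (G v)" for g h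
    using that assms by (intro gp_merge) auto
  then show ?thesis using assms unfolding gen_def hom_def
    by (auto simp: cls_mult cls_closed cls_eq_iff[symmetric] gp_sym)
qed

lemma gen_closed [simp]: "v \<in> V \<Longrightarrow> g \<in> carrier (G v) \<Longrightarrow> gen v g \<in> carrier GP"
  by (simp add: gen_def cls_closed)

lemma gen_mult: "v \<in> V \<Longrightarrow> g \<in> carrier (G v) \<Longrightarrow> h \<in> carrier (G v) \<Longrightarrow>
    gen v (g \<otimes>\<^bsub>G v\<^esub> h) = gen v g \<otimes>\<^bsub>GP\<^esub> gen v h"
  using gen_hom by (auto simp: hom_def)

lemma gen_group_hom: "v \<in> V \<Longrightarrow> group_hom (G v) GP (gen v)"
  by (simp add: group_hom_def group_hom_axioms_def vgroup gen_hom GP.is_group)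

lemma gen_one: "v \<in> V \<Longrightarrow> gen v \<one>\<^bsub>G v\<^esub> = \<one>\<^bsub>GP\<^esub>"
  using group_hom.hom_one[OF gen_group_hom] .

lemma gen_commute:
  assumes "E v w" "g \<in> carrier (G v)" "h \<in> carrier (G w)"
  shows "gen v g \<otimes>\<^bsub>GP\<^esub> gen w h = gen w h \<otimes>\<^bsub>GP\<^esub> gen v g"
proof -
  have "rel ([] @ [(v, g), (w, h)] @ []) ([] @ [(w, h), (v, g)] @ [])"
    using assms by (intro gp_comm) auto
  then show ?thesis using assms adj_in[OF assms(1)] by (simp add: gen_def cls_mult cls_eq_iff)
qed

lemma cls_Cons: "wd ((v, g) # w) \<Longrightarrow> cls ((v, g) # w) = gen v g \<otimes>\<^bsub>GP\<^esub> cls w"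
  by (simp add: gen_def cls_mult)

lemma GP_induct [consumes 1, case_names one gen]:
  assumes "x \<in> carrier GP" "P \<one>\<^bsub>GP\<^esub>"
    and "\<And>v g y. v \<in> V \<Longrightarrow> g \<in> carrier (G v) \<Longrightarrow> y \<in> carrier GP \<Longrightarrow> P y \<Longrightarrow> P (gen v g \<otimes>\<^bsub>GP\<^esub> y)"
  shows "P x"
proof -
  have "P (cls w)" if "wd w" for w
    using that
  proof (induction w)
    case Nil
    then show ?case using assms(2) by (simp add: one_GP)
  next
    case (Cons a w)
    then show ?case using assms(3) by (cases a) (simp add: cls_Cons cls_closed)
  qed
  then show ?thesis using assms(1) by (auto simp: carrier_GP)
qed

lemma hom_ext:
  assumes "group K" "f \<in> hom GP K" "f' \<in> hom GP K"
    and "\<And>v g. v \<in> V \<Longrightarrow> g \<in> carrier (G v) \<Longrightarrow> f (gen v g) = f' (gen v g)"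
    and "x \<in> carrier GP"
  shows "f x = f' x"
  using assms(5)
proof (induction rule: GP_induct)
  case one
  interpret K: group K by fact
  show ?case using hom_one[OF assms(2)] hom_one[OF assms(3)] GP.is_group K.is_group by simp
next
  case (gen v g y)
  then show ?case using assms hom_mult[of f GP K] hom_mult[of f' GP K] by simp
qed

end

section \<open>Actions of the graph product and its universal property\<close>

text \<open>The relations of the presentation read as conditions on single letters. Two actions
  arise from it: left multiplication on a group, which yields homomorphisms out of the graph
  product, and the action on reduced words. The set \<open>R\<close> confines the conditions to
  group elements or reduced words.\<close>

locale gp_action = graph_prod V E G for V :: "'v set" and E and G :: "'v \<Rightarrow> 'g monoid" +
  fixes act :: "'v \<Rightarrow> 'g \<Rightarrow> 'r \<Rightarrow> 'r" and R :: "'r set"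
  assumes act_closed: "v \<in> V \<Longrightarrow> g \<in> carrier (G v) \<Longrightarrow> r \<in> R \<Longrightarrow> act v g r \<in> R"
    and act_mult: "v \<in> V \<Longrightarrow> g \<in> carrier (G v) \<Longrightarrow> h \<in> carrier (G v) \<Longrightarrow> r \<in> R
      \<Longrightarrow> act v g (act v h r) = act v (g \<otimes>\<^bsub>G v\<^esub> h) r"
    and act_one: "v \<in> V \<Longrightarrow> r \<in> R \<Longrightarrow> act v \<one>\<^bsub>G v\<^esub> r = r"
    and act_comm: "E v w \<Longrightarrow> g \<in> carrier (G v) \<Longrightarrow> h \<in> carrier (G w) \<Longrightarrow> r \<in> R
      \<Longrightarrow> act v g (act w h r) = act w h (act v g r)"
begin

definition actw :: "('v \<times> 'g) list \<Rightarrow> 'r \<Rightarrow> 'r" where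
  "actw w r = foldr (\<lambda>(v, g). act v g) w r"

lemma actw_simps [simp]:
  "actw [] r = r" "actw ((v, g) # w) r = act v g (actw w r)" "actw (w @ w') r = actw w (actw w' r)"
  by (simp_all add: actw_def)

lemma actw_closed: "wd w \<Longrightarrow> r \<in> R \<Longrightarrow> actw w r \<in> R"
  by (induction w) (auto simp: act_closed)

lemma actw_rel: "rel x y \<Longrightarrow> r \<in> R \<Longrightarrow> actw x r = actw y r"
proof (induction rule: gp_rel.induct)
  case (gp_comm u w v v' g h)
  then show ?case using adj_in[of v v'] act_comm[of v v' g h "actw w r"] actw_closed by simp
qed (auto simp: act_mult act_one actw_closed)

definition gact :: "('v \<times> 'g) list set \<Rightarrow> 'r \<Rightarrow> 'r" where
  "gact P r = actw (SOME w. w \<in> P) r"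

lemma gact_cls:
  assumes "wd w" "r \<in> R"
  shows "gact (cls w) r = actw w r"
proof -
  have "rel w (SOME w'. w' \<in> cls w)"
    using someI[of "\<lambda>w'. w' \<in> cls w" w] cls_self[OF assms(1)] by (simp add: gp_class_def)
  then show ?thesis using actw_rel[OF _ assms(2)] unfolding gact_def by metis
qed

lemma gact_closed: "x \<in> carrier GP \<Longrightarrow> r \<in> R \<Longrightarrow> gact x r \<in> R"
  by (auto simp: carrier_GP gact_cls actw_closed)

lemma gact_mult: "x \<in> carrier GP \<Longrightarrow> y \<in> carrier GP \<Longrightarrow> r \<in> R \<Longrightarrow> gact (x \<otimes>\<^bsub>GP\<^esub> y) r = gact x (gact y r)"
  by (auto simp: carrier_GP cls_mult gact_cls actw_closed)

lemma gact_one: "r \<in> R \<Longrightarrow> gact \<one>\<^bsub>GP\<^esub> r = r"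
  by (simp add: one_GP gact_cls)

lemma gact_gen: "v \<in> V \<Longrightarrow> g \<in> carrier (G v) \<Longrightarrow> r \<in> R \<Longrightarrow> gact (gen v g) r = act v g r"
  by (simp add: gen_def gact_cls)

lemma gact_inv: "x \<in> carrier GP \<Longrightarrow> r \<in> R \<Longrightarrow> gact (inv\<^bsub>GP\<^esub> x) (gact x r) = r"
  "x \<in> carrier GP \<Longrightarrow> r \<in> R \<Longrightarrow> gact x (gact (inv\<^bsub>GP\<^esub> x) r) = r"
  using gact_mult[of "inv\<^bsub>GP\<^esub> x" x r] gact_mult[of x "inv\<^bsub>GP\<^esub> x" r] by (simp_all add: gact_one)

end

context graph_prod
begin

definition lift :: "('k, 'c) monoid_scheme \<Rightarrow> ('v \<Rightarrow> 'g \<Rightarrow> 'k) \<Rightarrow> ('v \<times> 'g) list set \<Rightarrow> 'k" where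
  "lift K \<phi> P = foldr (\<lambda>(v, g) a. \<phi> v g \<otimes>\<^bsub>K\<^esub> a) (SOME w. w \<in> P) \<one>\<^bsub>K\<^esub>"

text \<open>Let a letter act on \<open>K\<close> by left multiplication with its image; the lift of
  an element is the place to which it moves the identity. It is multiplicative because left
  translations commute with right multiplication, which is the fact \<open>r\<close>.\<close>

lemma lift_hom:
  assumes "group K" and hom: "\<And>v. v \<in> V \<Longrightarrow> \<phi> v \<in> hom (G v) K"
    and comm: "\<And>v w g h. E v w \<Longrightarrow> g \<in> carrier (G v) \<Longrightarrow> h \<in> carrier (G w)
      \<Longrightarrow> \<phi> v g \<otimes>\<^bsub>K\<^esub> \<phi> w h = \<phi> w h \<otimes>\<^bsub>K\<^esub> \<phi> v g"
  shows "lift K \<phi> \<in> hom GP K"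
    and "v \<in> V \<Longrightarrow> g \<in> carrier (G v) \<Longrightarrow> lift K \<phi> (gen v g) = \<phi> v g"
proof -
  interpret K: group K by fact
  have clo: "\<phi> v g \<in> carrier K" if "v \<in> V" "g \<in> carrier (G v)" for v g
    using hom that by (auto simp: hom_def)
  interpret a: gp_action V E G "\<lambda>v g a. \<phi> v g \<otimes>\<^bsub>K\<^esub> a" "carrier K"
  proof
    fix v r assume "v \<in> V" "r \<in> carrier K"
    then show "\<phi> v \<one>\<^bsub>G v\<^esub> \<otimes>\<^bsub>K\<^esub> r = r" using hom_one[OF hom vgroup] K.is_group by simp
  next
    fix v g h r assume "v \<in> V" "g \<in> carrier (G v)" "h \<in> carrier (G v)" "r \<in> carrier K"
    then show "\<phi> v g \<otimes>\<^bsub>K\<^esub> (\<phi> v h \<otimes>\<^bsub>K\<^esub> r) = \<phi> v (g \<otimes>\<^bsub>G v\<^esub> h) \<otimes>\<^bsub>K\<^esub> r"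
      using hom_mult[OF hom, of v g h] clo by (simp add: K.m_assoc)
  next
    fix v w g h r assume *: "E v w" "g \<in> carrier (G v)" "h \<in> carrier (G w)" "r \<in> carrier K"
    then show "\<phi> v g \<otimes>\<^bsub>K\<^esub> (\<phi> w h \<otimes>\<^bsub>K\<^esub> r) = \<phi> w h \<otimes>\<^bsub>K\<^esub> (\<phi> v g \<otimes>\<^bsub>K\<^esub> r)"
      using comm[OF *(1-3)] clo adj_in[OF *(1)] by (simp add: K.m_assoc[symmetric])
  qed (use clo in auto)
  have eq: "lift K \<phi> P = a.gact P \<one>\<^bsub>K\<^esub>" for P
    unfolding lift_def a.gact_def a.actw_def ..
  have r: "a.actw w r = a.actw w \<one>\<^bsub>K\<^esub> \<otimes>\<^bsub>K\<^esub> r" if "wd w" "r \<in> carrier K" for w r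
    using that
  proof (induction w)
    case (Cons a w)
    then show ?case using clo by (cases a) (simp add: K.m_assoc a.actw_closed)
  qed simp
  have "a.gact (x \<otimes>\<^bsub>GP\<^esub> y) \<one>\<^bsub>K\<^esub> = a.gact x \<one>\<^bsub>K\<^esub> \<otimes>\<^bsub>K\<^esub> a.gact y \<one>\<^bsub>K\<^esub>"
    if "x \<in> carrier GP" "y \<in> carrier GP" for x y
  proof -
    obtain w w' where w: "wd w" "x = cls w" "wd w'" "y = cls w'" using \<open>x \<in> carrier GP\<close> \<open>y \<in> carrier GP\<close>
      by (auto simp: carrier_GP)
    then show ?thesis using r[of w "a.actw w' \<one>\<^bsub>K\<^esub>"] by (simp add: a.gact_cls cls_mult a.actw_closed)
  qed
  then show "lift K \<phi> \<in> hom GP K" by (auto simp: hom_def eq a.gact_closed)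
  show "v \<in> V \<Longrightarrow> g \<in> carrier (G v) \<Longrightarrow> lift K \<phi> (gen v g) = \<phi> v g"
    using clo by (simp add: eq a.gact_gen)
qed

text \<open>The homomorphism to \<open>G v\<close> that kills all other vertex groups is a left
  inverse. It respects the commutation relations because adjacent vertices are distinct, so that one
  of the two images is trivial.\<close>

lemma gen_inj:
  assumes v: "v \<in> V"
  shows "inj_on (gen v) (carrier (G v))"
proof -
  let ?\<phi> = "\<lambda>w g. if w = v then g else \<one>\<^bsub>G v\<^esub>"
  interpret group "G v" using v vgroup by blast
  have "lift (G v) ?\<phi> (gen v g) = g" if "g \<in> carrier (G v)" for g
  proof -
    have "lift (G v) ?\<phi> (gen v g) = ?\<phi> v g"
      by (rule lift_hom) (use that v adj_irrefl in \<open>auto simp: hom_def\<close>)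
    then show ?thesis by simp
  qed
  then show ?thesis by (rule inj_on_inverseI)
qed

lemma gen_eq_one: "v \<in> V \<Longrightarrow> g \<in> carrier (G v) \<Longrightarrow> gen v g = \<one>\<^bsub>GP\<^esub> \<longleftrightarrow> g = \<one>\<^bsub>G v\<^esub>"
  using inj_onD[OF gen_inj, of v g "\<one>\<^bsub>G v\<^esub>"] gen_one[of v]
    monoid.one_closed[OF group.is_monoid[OF vgroup[of v]]] by auto

section \<open>Retractions and parabolic subgroups\<close>

definition ret :: "'v set \<Rightarrow> ('v \<times> 'g) list set \<Rightarrow> ('v \<times> 'g) list set" where
  "ret S = lift GP (\<lambda>v g. if v \<in> S then gen v g else \<one>\<^bsub>GP\<^esub>)"

lemma ret_hom: "ret S \<in> hom GP GP"
  and ret_gen: "v \<in> V \<Longrightarrow> g \<in> carrier (G v) \<Longrightarrow> ret S (gen v g) = (if v \<in> S then gen v g else \<one>\<^bsub>GP\<^esub>)"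
proof -
  let ?\<phi> = "\<lambda>v g. if v \<in> S then gen v g else \<one>\<^bsub>GP\<^esub>"
  have 1: "?\<phi> v \<in> hom (G v) GP" if "v \<in> V" for v
    using that by (auto simp: hom_def gen_mult)
  have 2: "?\<phi> v g \<otimes>\<^bsub>GP\<^esub> ?\<phi> w h = ?\<phi> w h \<otimes>\<^bsub>GP\<^esub> ?\<phi> v g"
    if "E v w" "g \<in> carrier (G v)" "h \<in> carrier (G w)" for v w g h
    using that adj_in[OF that(1)] gen_commute[OF that] by auto
  show "ret S \<in> hom GP GP" unfolding ret_def by (rule lift_hom(1)[where \<phi> = ?\<phi>, OF GP.is_group 1 2])
  show "v \<in> V \<Longrightarrow> g \<in> carrier (G v) \<Longrightarrow> ret S (gen v g) = ?\<phi> v g"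
    unfolding ret_def by (rule lift_hom(2)[where \<phi> = ?\<phi>, OF GP.is_group 1 2])
qed

lemma ret_group_hom: "group_hom GP GP (ret S)"
  by (simp add: group_hom_def group_hom_axioms_def ret_hom GP.is_group)

lemma ret_closed [simp]: "x \<in> carrier GP \<Longrightarrow> ret S x \<in> carrier GP"
  using ret_hom by (auto simp: hom_def)

lemma ret_mult: "x \<in> carrier GP \<Longrightarrow> y \<in> carrier GP \<Longrightarrow> ret S (x \<otimes>\<^bsub>GP\<^esub> y) = ret S x \<otimes>\<^bsub>GP\<^esub> ret S y"
  using ret_hom by (auto simp: hom_def)

lemma ret_one [simp]: "ret S \<one>\<^bsub>GP\<^esub> = \<one>\<^bsub>GP\<^esub>"
  using group_hom.hom_one[OF ret_group_hom] .

lemma ret_inv: "x \<in> carrier GP \<Longrightarrow> ret S (inv\<^bsub>GP\<^esub> x) = inv\<^bsub>GP\<^esub> (ret S x)"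
  using group_hom.hom_inv[OF ret_group_hom] .

lemma ret_ret: "x \<in> carrier GP \<Longrightarrow> ret S (ret T x) = ret (S \<inter> T) x"
  by (induction rule: GP_induct) (auto simp: ret_mult ret_gen)

lemma ret_all: "x \<in> carrier GP \<Longrightarrow> ret V x = x"
  by (induction rule: GP_induct) (auto simp: ret_mult ret_gen)

lemma ret_empty: "x \<in> carrier GP \<Longrightarrow> ret {} x = \<one>\<^bsub>GP\<^esub>"
  by (induction rule: GP_induct) (auto simp: ret_mult ret_gen)

text \<open>Taken as the image of an idempotent homomorphism: the subgroup property comes for free
  and membership is a fixed-point equation, see \<open>par_iff\<close>.\<close>

definition par :: "'v set \<Rightarrow> ('v \<times> 'g) list set set" where
  "par S = ret S ` carrier GP"

lemma par_iff: "x \<in> par S \<longleftrightarrow> x \<in> carrier GP \<and> ret S x = x"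
  unfolding par_def by (auto simp: ret_ret intro: image_eqI[of _ _ x])

lemma par_closed: "x \<in> par S \<Longrightarrow> x \<in> carrier GP"
  by (simp add: par_iff)

lemma par_subset: "par S \<subseteq> carrier GP"
  using par_closed by blast

lemma par_subgroup: "subgroup (par S) GP"
  unfolding par_def using group_hom.img_is_subgroup[OF ret_group_hom] .

lemma par_mono: "S \<subseteq> T \<Longrightarrow> par S \<subseteq> par T"
proof
  fix x assume "S \<subseteq> T" "x \<in> par S"
  moreover from this have "ret T (ret S x) = ret S x"
    using ret_ret[of x T S] par_iff[of x S] by (simp add: Int_absorb1)
  ultimately show "x \<in> par T" by (simp add: par_iff)
qed

lemma par_V: "par V = carrier GP"
  by (auto simp: par_iff ret_all)

lemma par_empty: "par {} = {\<one>\<^bsub>GP\<^esub>}"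
  by (auto simp: par_iff ret_empty)

lemma gen_par: "v \<in> V \<Longrightarrow> v \<in> S \<Longrightarrow> g \<in> carrier (G v) \<Longrightarrow> gen v g \<in> par S"
  by (simp add: par_iff ret_gen)

lemma ret_par: "x \<in> par T \<Longrightarrow> ret S x \<in> par (S \<inter> T)"
proof -
  assume x: "x \<in> par T"
  have "ret (S \<inter> T) (ret S (ret T x)) = ret S (ret T x)"
    using x ret_ret[of x S T] ret_ret[of x "S \<inter> T" "S \<inter> T"] unfolding par_iff by simp
  then show ?thesis using x by (simp add: par_iff)
qed

text \<open>Serves two purposes: product decompositions over cliques, and the fact that
  \<open>par\<close> of the link of a vertex centralises its vertex group.\<close>

lemma ret_commute:
  assumes ST: "\<And>s t. s \<in> S \<Longrightarrow> t \<in> T \<Longrightarrow> E s t" and x: "x \<in> carrier GP" and y: "y \<in> carrier GP"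
  shows "ret S x \<otimes>\<^bsub>GP\<^esub> ret T y = ret T y \<otimes>\<^bsub>GP\<^esub> ret S x"
proof -
  have gen_comm: "gen s g \<otimes>\<^bsub>GP\<^esub> ret T y = ret T y \<otimes>\<^bsub>GP\<^esub> gen s g"
    if s: "s \<in> S" "s \<in> V" "g \<in> carrier (G s)" for s g
    using y
  proof (induction rule: GP_induct)
    case one
    then show ?case using s by simp
  next
    case (gen t h y)
    have c: "gen s g \<in> carrier GP" "ret T y \<in> carrier GP" "gen t h \<in> carrier GP" using gen s by auto
    show ?case
    proof (cases "t \<in> T")
      case True
      have st: "gen s g \<otimes>\<^bsub>GP\<^esub> gen t h = gen t h \<otimes>\<^bsub>GP\<^esub> gen s g"
        using gen_commute[OF ST[OF s(1) True] s(3)] gen by blast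
      have "gen s g \<otimes>\<^bsub>GP\<^esub> (gen t h \<otimes>\<^bsub>GP\<^esub> ret T y) = gen t h \<otimes>\<^bsub>GP\<^esub> (gen s g \<otimes>\<^bsub>GP\<^esub> ret T y)"
        using c st by (metis GP.m_assoc)
      then show ?thesis using gen True c by (simp add: ret_mult ret_gen GP.m_assoc)
    next
      case False
      then show ?thesis using gen s by (simp add: ret_mult ret_gen)
    qed
  qed
  show ?thesis using x
  proof (induction rule: GP_induct)
    case one
    then show ?case using y by simp
  next
    case (gen s g x)
    have c: "gen s g \<in> carrier GP" "ret T y \<in> carrier GP" "ret S x \<in> carrier GP" using gen y by auto
    show ?case
    proof (cases "s \<in> S")
      case True
      have "(gen s g \<otimes>\<^bsub>GP\<^esub> ret S x) \<otimes>\<^bsub>GP\<^esub> ret T y = (gen s g \<otimes>\<^bsub>GP\<^esub> ret T y) \<otimes>\<^bsub>GP\<^esub> ret S x"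
        using c gen by (simp add: GP.m_assoc)
      then show ?thesis using gen True c \<open>s \<in> V\<close> assms
        by (simp add: ret_mult ret_gen GP.m_assoc gen_comm)
    next
      case False
      then show ?thesis using gen y by (simp add: ret_mult ret_gen)
    qed
  qed
qed

lemma ret_Un:
  assumes ST: "\<And>s t. s \<in> S \<Longrightarrow> t \<in> T \<Longrightarrow> E s t" and x: "x \<in> carrier GP"
  shows "ret (S \<union> T) x = ret S x \<otimes>\<^bsub>GP\<^esub> ret T x"
  using x
proof (induction rule: GP_induct)
  case (gen v g y)
  have c: "gen v g \<in> carrier GP" "ret T y \<in> carrier GP" "ret S y \<in> carrier GP" using gen by auto
  have com: "ret S y \<otimes>\<^bsub>GP\<^esub> gen v g = gen v g \<otimes>\<^bsub>GP\<^esub> ret S y" if "v \<in> T"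
    using ret_commute[OF ST, of S T y "gen v g"] gen that by (simp add: ret_gen)
  \<comment> \<open>\<open>S\<close> and \<open>T\<close> are disjoint, since a common vertex would
    be adjacent to itself.\<close>
  consider "v \<in> S" "v \<notin> T" | "v \<notin> S" "v \<in> T" | "v \<notin> S" "v \<notin> T"
    using ST adj_irrefl by blast
  then show ?case
  proof cases
    case 2
    then have "ret S y \<otimes>\<^bsub>GP\<^esub> (gen v g \<otimes>\<^bsub>GP\<^esub> ret T y) = gen v g \<otimes>\<^bsub>GP\<^esub> (ret S y \<otimes>\<^bsub>GP\<^esub> ret T y)"
      using com c by (simp add: GP.m_assoc[symmetric])
    then show ?thesis using 2 gen c by (simp add: ret_mult ret_gen)
  qed (use gen c in \<open>simp_all add: ret_mult ret_gen GP.m_assoc\<close>)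
qed simp

section \<open>Parabolic subgroups of cliques as direct products\<close>

definition clique :: "'v set \<Rightarrow> bool" where
  "clique K \<longleftrightarrow> K \<subseteq> V \<and> (\<forall>v\<in>K. \<forall>w\<in>K. v \<noteq> w \<longrightarrow> E v w)"

lemma clique_subset: "clique K \<Longrightarrow> L \<subseteq> K \<Longrightarrow> clique L"
  unfolding clique_def by blast

lemma par_singleton:
  assumes v: "v \<in> V"
  shows "par {v} = gen v ` carrier (G v)"
proof
  interpret group "G v" using v vgroup by blast
  show "gen v ` carrier (G v) \<subseteq> par {v}" using v gen_par by auto
  have "ret {v} x \<in> gen v ` carrier (G v)" if "x \<in> carrier GP" for x
    using that
  proof (induction rule: GP_induct)
    case one
    then show ?case using gen_one[OF v] by (auto intro: image_eqI[of _ _ "\<one>\<^bsub>G v\<^esub>"])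
  next
    case (gen w g y)
    then obtain h where h: "h \<in> carrier (G v)" "ret {v} y = gen v h" by blast
    show ?case
    proof (cases "w = v")
      case True
      then show ?thesis using gen h
        by (auto simp: ret_mult ret_gen gen_mult intro!: image_eqI[of _ _ "g \<otimes>\<^bsub>G v\<^esub> h"])
    next
      case False
      then show ?thesis using gen h v by (simp add: ret_mult ret_gen)
    qed
  qed
  then show "par {v} \<subseteq> gen v ` carrier (G v)" unfolding par_def by blast
qed

lemma finite_par:
  assumes "clique K" "\<And>v. v \<in> K \<Longrightarrow> finite (carrier (G v))"
  shows "finite (par K)"
proof -
  have "finite K" using assms(1) finite_V finite_subset unfolding clique_def by blast
  then show ?thesis using assms
  proof (induction K)
    case empty
    then show ?case by (simp add: par_empty)
  next
    case (insert v K)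
    have st: "E s t" if "s \<in> {v}" "t \<in> K" for s t
      using insert that unfolding clique_def by auto
    have "finite (par {v} \<times> par K)"
      using insert clique_subset[OF insert.prems(1), of K] par_singleton[of v]
      by (auto simp: clique_def)
    moreover have "par (insert v K) \<subseteq> (\<lambda>(x, y). x \<otimes>\<^bsub>GP\<^esub> y) ` (par {v} \<times> par K)"
      using ret_Un[of "{v}" K, OF st] by (fastforce simp: par_def)
    ultimately show ?case using finite_surj by blast
  qed
qed

lemma par_group: "group (GP\<lparr>carrier := par S\<rparr>)"
  using GP.subgroup_imp_group par_subgroup .

text \<open>Retractions are exactly projections onto partial products: \<open>ret_ret\<close> is the
  rule for composition, and \<open>ret_Un\<close> applies because disjoint subsets of a clique are
  completely joined.\<close>

lemma par_decomposition:
  assumes K: "clique K"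
  shows "direct_decomposition (GP\<lparr>carrier := par K\<rparr>) K ret"
proof -
  have clo: "ret J x \<in> par K" if "x \<in> par K" for J x
    by (rule subsetD[OF par_mono ret_par[OF that]]) simp
  show ?thesis
  proof (intro direct_decomposition.intro direct_decomposition_axioms.intro par_group)
    show "finite K" using K finite_V finite_subset unfolding clique_def by blast
  next
    fix J show "ret J \<in> hom (GP\<lparr>carrier := par K\<rparr>) (GP\<lparr>carrier := par K\<rparr>)"
      by (simp add: hom_def clo ret_mult par_closed)
  next
    fix J J' x assume J: "J \<subseteq> K" "J' \<subseteq> K" "J \<inter> J' = {}" "x \<in> carrier (GP\<lparr>carrier := par K\<rparr>)"
    have st: "E s t" if "s \<in> J" "t \<in> J'" for s t
    proof -
      have "s \<in> K" "t \<in> K" "s \<noteq> t" using that J(1-3) by auto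
      then show ?thesis using K unfolding clique_def by simp
    qed
    have "x \<in> carrier GP" using J(4) par_closed by simp
    then show "ret (J \<union> J') x = ret J x \<otimes>\<^bsub>GP\<lparr>carrier := par K\<rparr>\<^esub> ret J' x"
      using ret_Un[of J J' x, OF st] by simp
  next
    fix x assume "x \<in> carrier (GP\<lparr>carrier := par K\<rparr>)"
    then have x: "x \<in> carrier GP" "ret K x = x" by (simp_all add: par_iff)
    then show "ret K x = x" "ret {} x = \<one>\<^bsub>GP\<lparr>carrier := par K\<rparr>\<^esub>"
      by (simp_all add: ret_empty)
    fix J J' show "ret J (ret J' x) = ret (J \<inter> J') x" using x(1) by (rule ret_ret)
  qed
qed

lemma ret_par_subset: "J \<subseteq> K \<Longrightarrow> ret J ` par K = par J"
proof (intro equalityI subsetI)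
  fix x assume J: "J \<subseteq> K"
  show "x \<in> par J" if "x \<in> ret J ` par K"
    using that ret_par[of _ K J] J by (auto simp: Int_absorb2)
  show "x \<in> ret J ` par K" if "x \<in> par J"
    using that par_mono[OF J] par_iff[of x J] by (metis imageI subsetD)
qed

lemma vertex_iso:
  assumes v: "v \<in> V"
  shows "G v \<cong> GP\<lparr>carrier := par {v}\<rparr>"
proof (rule is_isoI)
  show "gen v \<in> iso (G v) (GP\<lparr>carrier := par {v}\<rparr>)"
    using gen_hom[OF v] gen_inj[OF v] par_singleton[OF v]
    by (auto simp: iso_def bij_betw_def hom_def)
qed

end

section \<open>Finite subgroups fix a vertex or a clique\<close>

text \<open>For reduced words, the syllable length of the quotient \<open>n^-1 m\<close> in the free
  product: after the common prefix has cancelled, two letters of the same factor merge into one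
  syllable (\<open>+ 1\<close>), letters of different factors do not (\<open>+ 2\<close>).\<close>

fun rdist :: "('i \<times> 'g) list \<Rightarrow> ('i \<times> 'g) list \<Rightarrow> nat" where
  "rdist [] m = length m"
| "rdist n [] = length n"
| "rdist ((x, g) # n) ((y, h) # m) =
    (if x = y then (if g = h then rdist n m else length n + length m + 1) else length n + length m + 2)"

text \<open>The first letter of \<open>m\<close> separates \<open>[]\<close> from \<open>m\<close>.
  If \<open>r\<close> starts with that letter, \<open>r\<close> is closer to it than to
  \<open>[]\<close>; otherwise the further letters of \<open>m\<close> put \<open>m\<close> at a
  greater distance.\<close>

lemma rdist_between:
  assumes "2 \<le> length m"
  shows "rdist [hd m] r < max (length r) (rdist m r)"
proof -
  obtain x g m' where m: "m = (x, g) # m'" "m' \<noteq> []" using assms by (cases m; cases "tl m") auto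
  show ?thesis
  proof (cases r)
    case (Cons a r')
    then show ?thesis using m by (cases a) (auto simp: Suc_le_eq)
  qed (use m in simp)
qed

lemma rdist_map:
  assumes "inj_on f (fst ` (set n \<union> set m))"
  shows "rdist (map (\<lambda>(x, h). (f x, h)) n) (map (\<lambda>(x, h). (f x, h)) m) = rdist n m"
  using assms
proof (induction n m rule: rdist.induct)
  case (3 x g n y h m)
  have "inj_on f (fst ` (set n \<union> set m))" using 3(2) by (rule inj_on_subset) auto
  moreover have "f x = f y \<longleftrightarrow> x = y" using inj_onD[OF 3(2), of x y] by auto
  ultimately show ?case using 3(1) by simp
qed auto

section \<open>The action on reduced words attached to a vertex\<close>

locale graph_prod_vertex = graph_prod V E G for V :: "'v set" and E and G :: "'v \<Rightarrow> 'g monoid" +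
  fixes v :: 'v
  assumes v: "v \<in> V"
begin

sublocale Gv: group "G v" using v vgroup by blast

definition "lk = {w. E v w}"
definition "PP = par (V - {v})"
definition "CC = par lk"
text \<open>\<open>CC\<close> centralises the vertex group of \<open>v\<close>, so the conjugate of
  that group by \<open>p\<close> depends only on the coset of \<open>p\<close> modulo
  \<open>CC\<close>.\<close>

definition "idx = {p <#\<^bsub>GP\<^esub> CC | p. p \<in> PP}"

text \<open>\<open>red\<close> consists of the normal forms for the free product of copies of \<open>G v\<close> indexed by the
  cosets of \<open>CC\<close> in \<open>PP\<close>; this free product is the kernel of the retraction onto \<open>PP\<close>.\<close>

definition red :: "(('v \<times> 'g) list set set \<times> 'g) list set" where
  "red = {ws. distinct_adj (map fst ws) \<and>
    (\<forall>(x, h) \<in> set ws. x \<in> idx \<and> h \<in> carrier (G v) \<and> h \<noteq> \<one>\<^bsub>G v\<^esub>)}"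

text \<open>Makes the first syllable at index \<open>CC\<close> explicit, writing no letter when it
  is the identity. Every reduced word is \<open>cons a us\<close> with \<open>us\<close> in
  \<open>base\<close>, see \<open>red_cases\<close>, and in this form \<open>G v\<close> simply
  multiplies \<open>a\<close>.\<close>

definition cons :: "'g \<Rightarrow> (('v \<times> 'g) list set set \<times> 'g) list \<Rightarrow> (('v \<times> 'g) list set set \<times> 'g) list" where
  "cons a us = (if a = \<one>\<^bsub>G v\<^esub> then us else (CC, a) # us)"

definition base :: "(('v \<times> 'g) list set set \<times> 'g) list set" where
  "base = {us \<in> red. us = [] \<or> fst (hd us) \<noteq> CC}"

definition vmul :: "'g \<Rightarrow> (('v \<times> 'g) list set set \<times> 'g) list \<Rightarrow> (('v \<times> 'g) list set set \<times> 'g) list" where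
  "vmul g ws = (if ws \<noteq> [] \<and> fst (hd ws) = CC then cons (g \<otimes>\<^bsub>G v\<^esub> snd (hd ws)) (tl ws) else cons g ws)"

definition shift :: "('v \<times> 'g) list set \<Rightarrow> (('v \<times> 'g) list set set \<times> 'g) list \<Rightarrow> (('v \<times> 'g) list set set \<times> 'g) list" where
  "shift s ws = map (\<lambda>(x, h). (s <#\<^bsub>GP\<^esub> x, h)) ws"

text \<open>The left action on the cosets of \<open>PP\<close>, seen on normal forms in the manner
  of van der Waerden: \<open>G v\<close> multiplies from the left as the factor with index
  \<open>CC\<close>, while elements of \<open>PP\<close> fix the trivial coset and permute the
  conjugates of \<open>G v\<close>.\<close>

definition act :: "'v \<Rightarrow> 'g \<Rightarrow> (('v \<times> 'g) list set set \<times> 'g) list \<Rightarrow> (('v \<times> 'g) list set set \<times> 'g) list" where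
  "act w g ws = (if w = v then vmul g ws else shift (gen w g) ws)"

lemma act_simps: "act v g ws = vmul g ws" "w \<noteq> v \<Longrightarrow> act w g ws = shift (gen w g) ws"
  by (simp_all add: act_def)

lemma PP_closed: "p \<in> PP \<Longrightarrow> p \<in> carrier GP"
  and CC_closed: "c \<in> CC \<Longrightarrow> c \<in> carrier GP"
  by (simp_all add: PP_def CC_def par_closed)

lemma PP_subgroup: "subgroup PP GP" and CC_subgroup: "subgroup CC GP"
  by (simp_all add: PP_def CC_def par_subgroup)

lemma CC_sub: "CC \<subseteq> carrier GP"
  using CC_closed by blast

lemma CC_PP: "c \<in> CC \<Longrightarrow> c \<in> PP"
  using par_mono[of lk "V - {v}"] adj_in adj_irrefl unfolding lk_def CC_def PP_def by auto

lemma coset_CC: "c \<in> CC \<Longrightarrow> c <#\<^bsub>GP\<^esub> CC = CC"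
  using GP.coset_join3[OF CC_closed CC_subgroup] by simp

lemma coset_CC_iff: "p \<in> carrier GP \<Longrightarrow> p <#\<^bsub>GP\<^esub> CC = CC \<Longrightarrow> p \<in> CC"
  using subgroup.one_closed[OF CC_subgroup] unfolding l_coset_def by force

lemma idx_sub: "x \<in> idx \<Longrightarrow> x \<subseteq> carrier GP"
  using GP.l_coset_subset_G[OF CC_sub PP_closed] unfolding idx_def by blast

lemma idxI: "p \<in> PP \<Longrightarrow> p <#\<^bsub>GP\<^esub> CC \<in> idx"
  unfolding idx_def by blast

lemma CC_idx: "CC \<in> idx"
  using idxI[OF CC_PP] coset_CC subgroup.one_closed[OF CC_subgroup] by metis

lemma idx_shift: "s \<in> PP \<Longrightarrow> x \<in> idx \<Longrightarrow> s <#\<^bsub>GP\<^esub> x \<in> idx"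
  unfolding idx_def using GP.lcos_m_assoc[OF CC_sub] PP_closed subgroup.m_closed[OF PP_subgroup]
  by auto

lemma lcos_mult: "x \<in> idx \<Longrightarrow> s \<in> PP \<Longrightarrow> t \<in> PP \<Longrightarrow> s <#\<^bsub>GP\<^esub> (t <#\<^bsub>GP\<^esub> x) = (s \<otimes>\<^bsub>GP\<^esub> t) <#\<^bsub>GP\<^esub> x"
  using GP.lcos_m_assoc idx_sub PP_closed by simp

lemma PP_inv: "s \<in> PP \<Longrightarrow> inv\<^bsub>GP\<^esub> s \<in> PP"
  using subgroup.m_inv_closed[OF PP_subgroup] .

lemma lcos_inv: "x \<in> idx \<Longrightarrow> s \<in> PP \<Longrightarrow> inv\<^bsub>GP\<^esub> s <#\<^bsub>GP\<^esub> (s <#\<^bsub>GP\<^esub> x) = x"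
  using lcos_mult[of x "inv\<^bsub>GP\<^esub> s" s] PP_inv PP_closed GP.lcos_mult_one[OF idx_sub] by simp

lemma lcos_inj: "s \<in> PP \<Longrightarrow> inj_on ((<#\<^bsub>GP\<^esub>) s) idx"
  by (rule inj_on_inverseI[of _ "(<#\<^bsub>GP\<^esub>) (inv\<^bsub>GP\<^esub> s)"]) (rule lcos_inv)

lemma redD: "ws \<in> red \<Longrightarrow> (x, h) \<in> set ws \<Longrightarrow> x \<in> idx \<and> h \<in> carrier (G v) \<and> h \<noteq> \<one>\<^bsub>G v\<^esub>"
  unfolding red_def by blast

lemma red_fst: "ws \<in> red \<Longrightarrow> fst ` set ws \<subseteq> idx"
  using redD by fastforce

lemma red_Nil: "[] \<in> red"
  by (simp add: red_def)

lemma red_Cons: "(x, h) # ws \<in> red \<longleftrightarrow> ws \<in> red \<and> x \<in> idx \<and> h \<in> carrier (G v) \<and> h \<noteq> \<one>\<^bsub>G v\<^esub>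
    \<and> (ws = [] \<or> fst (hd ws) \<noteq> x)"
  unfolding red_def by (cases ws) auto

lemma shift_red:
  assumes "s \<in> PP" "ws \<in> red"
  shows "shift s ws \<in> red"
proof -
  have "inj_on ((<#\<^bsub>GP\<^esub>) s) (set (map fst ws))"
    using inj_on_subset[OF lcos_inj[OF assms(1)]] red_fst[OF assms(2)] by simp
  then have "distinct_adj (map ((<#\<^bsub>GP\<^esub>) s) (map fst ws))"
    using assms(2) unfolding red_def by (intro distinct_adj_mapI[of "map fst ws"]) simp_all
  moreover have "map fst (shift s ws) = map ((<#\<^bsub>GP\<^esub>) s) (map fst ws)"
    by (auto simp: shift_def)
  ultimately have "distinct_adj (map fst (shift s ws))" by (simp only:)
  moreover have "s <#\<^bsub>GP\<^esub> x \<in> idx \<and> h \<in> carrier (G v) \<and> h \<noteq> \<one>\<^bsub>G v\<^esub>" if "(x, h) \<in> set ws" for x h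
    using redD[OF assms(2) that] idx_shift[OF assms(1)] by blast
  then have "\<forall>(x, h)\<in>set (shift s ws). x \<in> idx \<and> h \<in> carrier (G v) \<and> h \<noteq> \<one>\<^bsub>G v\<^esub>"
    by (auto simp: shift_def)
  ultimately show ?thesis unfolding red_def by simp
qed

lemma shift_shift:
  assumes "ws \<in> red" "s \<in> PP" "t \<in> PP"
  shows "shift s (shift t ws) = shift (s \<otimes>\<^bsub>GP\<^esub> t) ws"
  using redD[OF assms(1)] lcos_mult[OF _ assms(2,3)] by (auto simp: shift_def)

lemma shift_one: "ws \<in> red \<Longrightarrow> shift \<one>\<^bsub>GP\<^esub> ws = ws"
  using redD GP.lcos_mult_one[OF idx_sub] unfolding shift_def by (intro map_idI) force

lemma shift_inv: "ws \<in> red \<Longrightarrow> s \<in> PP \<Longrightarrow> shift s (shift (inv\<^bsub>GP\<^esub> s) ws) = ws"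
  using shift_shift[of ws s "inv\<^bsub>GP\<^esub> s"] shift_one PP_inv PP_closed by simp

lemma shift_base:
  assumes "s \<in> CC" "us \<in> base"
  shows "shift s us \<in> base"
proof -
  have us: "us \<in> red" using assms by (simp add: base_def)
  have ne: "s <#\<^bsub>GP\<^esub> x \<noteq> CC" if "x \<in> idx" "x \<noteq> CC" for x
    using inj_onD[OF lcos_inj[OF CC_PP[OF assms(1)]] _ that(1) CC_idx] coset_CC[OF assms(1)] that(2) by auto
  show ?thesis
  proof (cases us)
    case Nil
    then show ?thesis by (simp add: base_def shift_def red_Nil)
  next
    case (Cons a us')
    then have "fst a \<in> idx" "fst a \<noteq> CC"
      using redD[OF us, of "fst a" "snd a"] assms(2) by (simp_all add: base_def)
    then show ?thesis using ne shift_red[OF CC_PP[OF assms(1)] us] Cons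
      by (cases a) (simp add: base_def shift_def)
  qed
qed

lemma red_cases:
  assumes "ws \<in> red"
  obtains a us where "a \<in> carrier (G v)" "us \<in> base" "ws = cons a us"
proof (cases "ws \<noteq> [] \<and> fst (hd ws) = CC")
  case True
  then obtain a us where "ws = (CC, a) # us" by (cases ws) auto
  then show ?thesis using that[of a us] assms by (auto simp: red_Cons base_def cons_def)
next
  case False
  then show ?thesis using that[of "\<one>\<^bsub>G v\<^esub>" ws] assms by (auto simp: base_def cons_def)
qed

lemma cons_red: "a \<in> carrier (G v) \<Longrightarrow> us \<in> base \<Longrightarrow> cons a us \<in> red"
  using CC_idx by (auto simp: cons_def base_def red_Cons)

lemma vmul_cons: "g \<in> carrier (G v) \<Longrightarrow> a \<in> carrier (G v) \<Longrightarrow> us \<in> base \<Longrightarrow>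
    vmul g (cons a us) = cons (g \<otimes>\<^bsub>G v\<^esub> a) us"
  by (auto simp: vmul_def cons_def base_def)

lemma shift_cons: "s \<in> CC \<Longrightarrow> shift s (cons a us) = cons a (shift s us)"
  using coset_CC by (simp add: shift_def cons_def)

lemma gen_PP: "w \<in> V \<Longrightarrow> w \<noteq> v \<Longrightarrow> g \<in> carrier (G w) \<Longrightarrow> gen w g \<in> PP"
  by (simp add: PP_def gen_par)

lemma gen_CC: "E v w \<Longrightarrow> g \<in> carrier (G w) \<Longrightarrow> gen w g \<in> CC"
  using adj_in[of v w] by (simp add: CC_def gen_par lk_def)

text \<open>Elements of \<open>CC\<close> fix the index \<open>CC\<close>, so shifting by them does
  not touch the syllable on which \<open>G v\<close> acts. This is the commutation of
  \<open>v\<close> with its neighbours.\<close>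

lemma vmul_shift:
  assumes "ws \<in> red" "s \<in> CC" "g \<in> carrier (G v)"
  shows "vmul g (shift s ws) = shift s (vmul g ws)"
proof -
  obtain a us where "a \<in> carrier (G v)" "us \<in> base" "ws = cons a us"
    using red_cases[OF assms(1)] .
  then show ?thesis using assms shift_base by (simp add: shift_cons vmul_cons)
qed

lemma action: "gp_action V E G act red"
proof
  fix w g r assume *: "w \<in> V" "g \<in> carrier (G w)" "r \<in> red"
  show "act w g r \<in> red"
  proof (cases "w = v")
    case True
    obtain a us where "a \<in> carrier (G v)" "us \<in> base" "r = cons a us"
      using red_cases[OF *(3)] .
    then show ?thesis using True * by (simp add: act_def vmul_cons cons_red)
  next
    case False
    then show ?thesis using * shift_red[OF gen_PP] by (simp add: act_def)
  qed
next
  fix w g h r assume *: "w \<in> V" "g \<in> carrier (G w)" "h \<in> carrier (G w)" "r \<in> red"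
  show "act w g (act w h r) = act w (g \<otimes>\<^bsub>G w\<^esub> h) r"
  proof (cases "w = v")
    case True
    obtain a us where "a \<in> carrier (G v)" "us \<in> base" "r = cons a us"
      using red_cases[OF *(4)] .
    then show ?thesis using True * by (simp add: act_def vmul_cons Gv.m_assoc)
  next
    case False
    then show ?thesis using * shift_shift[OF *(4)] gen_PP by (simp add: act_def gen_mult)
  qed
next
  fix w r assume *: "w \<in> V" "r \<in> red"
  show "act w \<one>\<^bsub>G w\<^esub> r = r"
  proof (cases "w = v")
    case True
    obtain a us where "a \<in> carrier (G v)" "us \<in> base" "r = cons a us"
      using red_cases[OF *(2)] .
    then show ?thesis using True * by (simp add: act_def vmul_cons)
  next
    case False
    then show ?thesis using * shift_one by (simp add: act_def gen_one)
  qed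
next
  fix w w' g h r assume *: "E w w'" "g \<in> carrier (G w)" "h \<in> carrier (G w')" "r \<in> red"
  note V = adj_in[OF *(1)]
  \<comment> \<open>If one of the two vertices is \<open>v\<close>, the other lies in its link;
    otherwise the relation already holds between the generators in \<open>PP\<close>.\<close>
  consider "w = v" "w' \<noteq> v" | "w \<noteq> v" "w' = v" | "w \<noteq> v" "w' \<noteq> v"
    using *(1) adj_irrefl by blast
  then show "act w g (act w' h r) = act w' h (act w g r)"
  proof cases
    case 1
    then show ?thesis using * vmul_shift[OF *(4) gen_CC] by (simp add: act_def)
  next
    case 2
    then show ?thesis using * adj_sym[OF *(1)] vmul_shift[OF *(4) gen_CC] by (simp add: act_def)
  next
    case 3
    then show ?thesis using V * shift_shift[OF *(4)] gen_PP gen_commute[OF *(1-3)]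
      by (simp add: act_def)
  qed
qed

sublocale gp_action V E G act red by (rule action)

lemma base_Nil: "[] \<in> base"
  by (simp add: base_def red_Nil)

text \<open>The right-hand side sees \<open>a\<close> and \<open>b\<close> only through their
  equality, hence does not change when both are multiplied on the left by the same element.
  Identities are covered, since words in \<open>base\<close> do not start at
  \<open>CC\<close>.\<close>

lemma rdist_cons:
  assumes "us \<in> base" "us' \<in> base"
  shows "rdist (cons a us) (cons b us') = (if a = b then rdist us us' else length us + length us' + 1)"
  using assms unfolding cons_def base_def by (cases us; cases us') (auto del: equalityI)

lemma rdist_act:
  assumes "w \<in> V" "g \<in> carrier (G w)" "r \<in> red" "r' \<in> red"
  shows "rdist (act w g r) (act w g r') = rdist r r'"
proof (cases "w = v")
  case True
  obtain a us where "a \<in> carrier (G v)" "us \<in> base" "r = cons a us" using red_cases[OF assms(3)] .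
  moreover obtain b us' where "b \<in> carrier (G v)" "us' \<in> base" "r' = cons b us'"
    using red_cases[OF assms(4)] .
  ultimately show ?thesis using True assms by (simp add: act_simps vmul_cons rdist_cons)
next
  case False
  have "inj_on ((<#\<^bsub>GP\<^esub>) (gen w g)) (fst ` (set r \<union> set r'))"
    using inj_on_subset[OF lcos_inj[OF gen_PP[OF assms(1) False assms(2)]]]
      red_fst[OF assms(3)] red_fst[OF assms(4)] by (simp add: image_Un)
  then show ?thesis using rdist_map False by (simp add: act_simps shift_def)
qed

lemma rdist_gact:
  assumes "x \<in> carrier GP" "r \<in> red" "r' \<in> red"
  shows "rdist (gact x r) (gact x r') = rdist r r'"
  using assms(1)
proof (induction rule: GP_induct)
  case one
  then show ?case using assms by (simp add: gact_one)
next
  case (gen w g y)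
  then show ?case using assms by (simp add: gact_mult gact_gen gact_closed rdist_act)
qed

text \<open>Formulated with the retraction of an arbitrary element so that induction over the
  generators of the whole graph product applies; \<open>gact_PP\<close> is the statement aimed
  at.\<close>

lemma gact_ret:
  assumes "x \<in> carrier GP" "r \<in> red"
  shows "gact (ret (V - {v}) x) r = shift (ret (V - {v}) x) r"
  using assms(1)
proof (induction rule: GP_induct)
  case one
  then show ?case using assms(2) by (simp add: gact_one shift_one)
next
  case (gen w g y)
  let ?y = "ret (V - {v}) y"
  have y: "?y \<in> PP" "?y \<in> carrier GP" using gen unfolding PP_def par_def by auto
  show ?case
  proof (cases "w = v")
    case True
    then show ?thesis using gen y by (simp add: ret_mult ret_gen)
  next
    case False
    then show ?thesis using gen y assms(2) shift_shift[OF assms(2) gen_PP y(1)] shift_red[OF y(1)]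
      by (simp add: ret_mult ret_gen gact_mult gact_gen act_simps)
  qed
qed

lemma gact_PP: "p \<in> PP \<Longrightarrow> r \<in> red \<Longrightarrow> gact p r = shift p r"
  using gact_ret[of p r] by (simp add: PP_def par_iff)

section \<open>Evaluation of reduced words in the graph product\<close>

text \<open>The copy of \<open>h\<close> in the conjugate of \<open>G v\<close> with index
  \<open>x\<close>. Any representative of the coset gives the same element, see
  \<open>cj_eq\<close>.\<close>

definition cj :: "('v \<times> 'g) list set set \<Rightarrow> 'g \<Rightarrow> ('v \<times> 'g) list set" where
  "cj x h = (let p = SOME p. p \<in> PP \<and> x = p <#\<^bsub>GP\<^esub> CC in p \<otimes>\<^bsub>GP\<^esub> gen v h \<otimes>\<^bsub>GP\<^esub> inv\<^bsub>GP\<^esub> p)"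

lemma CC_gen_commute:
  assumes "c \<in> CC" "h \<in> carrier (G v)"
  shows "c \<otimes>\<^bsub>GP\<^esub> gen v h = gen v h \<otimes>\<^bsub>GP\<^esub> c"
proof -
  have "ret lk c \<otimes>\<^bsub>GP\<^esub> ret {v} (gen v h) = ret {v} (gen v h) \<otimes>\<^bsub>GP\<^esub> ret lk c"
    by (rule ret_commute) (use assms v CC_closed adj_sym in \<open>simp_all add: lk_def\<close>)
  then show ?thesis using assms v by (simp add: CC_def par_iff ret_gen)
qed

lemma cj_eq:
  assumes p: "p \<in> PP" and h: "h \<in> carrier (G v)"
  shows "cj (p <#\<^bsub>GP\<^esub> CC) h = p \<otimes>\<^bsub>GP\<^esub> gen v h \<otimes>\<^bsub>GP\<^esub> inv\<^bsub>GP\<^esub> p"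
proof -
  define q where "q = (SOME q. q \<in> PP \<and> p <#\<^bsub>GP\<^esub> CC = q <#\<^bsub>GP\<^esub> CC)"
  have q: "q \<in> PP" "p <#\<^bsub>GP\<^esub> CC = q <#\<^bsub>GP\<^esub> CC"
    using someI[of "\<lambda>q. q \<in> PP \<and> p <#\<^bsub>GP\<^esub> CC = q <#\<^bsub>GP\<^esub> CC" p] p unfolding q_def by simp_all
  have "q \<otimes>\<^bsub>GP\<^esub> \<one>\<^bsub>GP\<^esub> \<in> q <#\<^bsub>GP\<^esub> CC"
    using subgroup.one_closed[OF CC_subgroup] unfolding l_coset_def by blast
  then obtain c where c: "c \<in> CC" "q = p \<otimes>\<^bsub>GP\<^esub> c"
    using q(2)[symmetric] PP_closed[OF q(1)] unfolding l_coset_def by auto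
  have cl: "p \<in> carrier GP" "c \<in> carrier GP" "gen v h \<in> carrier GP"
    using p c h v PP_closed CC_closed by simp_all
  have "q \<otimes>\<^bsub>GP\<^esub> gen v h \<otimes>\<^bsub>GP\<^esub> inv\<^bsub>GP\<^esub> q
      = p \<otimes>\<^bsub>GP\<^esub> (c \<otimes>\<^bsub>GP\<^esub> gen v h) \<otimes>\<^bsub>GP\<^esub> inv\<^bsub>GP\<^esub> c \<otimes>\<^bsub>GP\<^esub> inv\<^bsub>GP\<^esub> p"
    using cl c(2) by (simp add: GP.m_assoc GP.inv_mult_group)
  also have "\<dots> = p \<otimes>\<^bsub>GP\<^esub> gen v h \<otimes>\<^bsub>GP\<^esub> inv\<^bsub>GP\<^esub> p"
    unfolding CC_gen_commute[OF c(1) h] using cl by (simp add: GP.m_assoc)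
  finally show ?thesis unfolding cj_def Let_def q_def .
qed

lemma cj_CC: "h \<in> carrier (G v) \<Longrightarrow> cj CC h = gen v h"
  using cj_eq[OF CC_PP, of "\<one>\<^bsub>GP\<^esub>" h] coset_CC[of "\<one>\<^bsub>GP\<^esub>"] subgroup.one_closed[OF CC_subgroup] v by simp

lemma cj_closed: "x \<in> idx \<Longrightarrow> h \<in> carrier (G v) \<Longrightarrow> cj x h \<in> carrier GP"
  unfolding idx_def using cj_eq v PP_closed by auto

lemma cj_shift:
  assumes "x \<in> idx" "h \<in> carrier (G v)" "s \<in> PP"
  shows "cj (s <#\<^bsub>GP\<^esub> x) h = s \<otimes>\<^bsub>GP\<^esub> cj x h \<otimes>\<^bsub>GP\<^esub> inv\<^bsub>GP\<^esub> s"
proof -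
  obtain p where p: "p \<in> PP" "x = p <#\<^bsub>GP\<^esub> CC" using assms(1) unfolding idx_def by blast
  have cl: "p \<in> carrier GP" "s \<in> carrier GP" "gen v h \<in> carrier GP"
    using p assms v PP_closed by simp_all
  have "s <#\<^bsub>GP\<^esub> x = (s \<otimes>\<^bsub>GP\<^esub> p) <#\<^bsub>GP\<^esub> CC" using p GP.lcos_m_assoc[OF CC_sub cl(2,1)] by simp
  then show ?thesis
    using cj_eq[OF subgroup.m_closed[OF PP_subgroup assms(3) p(1)] assms(2)] cj_eq[OF p(1) assms(2)] p cl
    by (simp add: GP.m_assoc GP.inv_mult_group)
qed

definition ev :: "(('v \<times> 'g) list set set \<times> 'g) list \<Rightarrow> ('v \<times> 'g) list set" where
  "ev ws = foldr (\<lambda>(x, h) a. cj x h \<otimes>\<^bsub>GP\<^esub> a) ws \<one>\<^bsub>GP\<^esub>"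

lemma ev_simps [simp]: "ev [] = \<one>\<^bsub>GP\<^esub>" "ev ((x, h) # ws) = cj x h \<otimes>\<^bsub>GP\<^esub> ev ws"
  by (simp_all add: ev_def)

lemma ev_closed: "ws \<in> red \<Longrightarrow> ev ws \<in> carrier GP"
proof (induction ws)
  case (Cons a ws)
  then show ?case using cj_closed by (cases a) (simp add: red_Cons)
qed simp

lemma ev_cons: "a \<in> carrier (G v) \<Longrightarrow> us \<in> base \<Longrightarrow> ev (cons a us) = gen v a \<otimes>\<^bsub>GP\<^esub> ev us"
  using cj_CC ev_closed[of us] gen_one[OF v] by (simp add: cons_def base_def)

lemma ev_shift:
  assumes s: "s \<in> PP" and "ws \<in> red"
  shows "ev (shift s ws) = s \<otimes>\<^bsub>GP\<^esub> ev ws \<otimes>\<^bsub>GP\<^esub> inv\<^bsub>GP\<^esub> s"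
  using assms(2)
proof (induction ws)
  case Nil
  then show ?case using PP_closed[OF s] by (simp add: shift_def)
next
  case (Cons a ws)
  obtain x h where a: "a = (x, h)" by fastforce
  then have *: "ws \<in> red" "x \<in> idx" "h \<in> carrier (G v)" using Cons(2) by (auto simp: red_Cons)
  have cl: "s \<in> carrier GP" "cj x h \<in> carrier GP" "ev ws \<in> carrier GP"
    using PP_closed[OF s] cj_closed ev_closed * by simp_all
  have "ev (shift s (a # ws)) = (s \<otimes>\<^bsub>GP\<^esub> cj x h \<otimes>\<^bsub>GP\<^esub> inv\<^bsub>GP\<^esub> s) \<otimes>\<^bsub>GP\<^esub> (s \<otimes>\<^bsub>GP\<^esub> ev ws \<otimes>\<^bsub>GP\<^esub> inv\<^bsub>GP\<^esub> s)"
    using Cons.IH[OF *(1)] a cj_shift[OF *(2,3) s] by (simp add: shift_def)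
  also have "\<dots> = s \<otimes>\<^bsub>GP\<^esub> cj x h \<otimes>\<^bsub>GP\<^esub> (inv\<^bsub>GP\<^esub> s \<otimes>\<^bsub>GP\<^esub> s) \<otimes>\<^bsub>GP\<^esub> ev ws \<otimes>\<^bsub>GP\<^esub> inv\<^bsub>GP\<^esub> s"
    using cl by (simp only: GP.m_assoc GP.m_closed GP.inv_closed)
  also have "\<dots> = s \<otimes>\<^bsub>GP\<^esub> ev (a # ws) \<otimes>\<^bsub>GP\<^esub> inv\<^bsub>GP\<^esub> s"
    using cl a by (simp add: GP.m_assoc)
  finally show ?case .
qed

text \<open>A word \<open>r\<close> stands for the coset of \<open>ev r\<close> modulo
  \<open>PP\<close>, and the action on words is the action on cosets; \<open>ret (V - {v}) x\<close>
  is the correction in \<open>PP\<close>. For \<open>r = []\<close> this is the factorisation of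
  \<open>x\<close> in the semidirect product, so an element that fixes \<open>[]\<close> equals its
  own retraction.\<close>

lemma ev_gact:
  assumes "x \<in> carrier GP" "r \<in> red"
  shows "ev (gact x r) \<otimes>\<^bsub>GP\<^esub> ret (V - {v}) x = x \<otimes>\<^bsub>GP\<^esub> ev r"
  using assms(1)
proof (induction rule: GP_induct)
  case one
  then show ?case using assms(2) ev_closed by (simp add: gact_one)
next
  case (gen w g y)
  let ?r = "gact y r"
  have r: "?r \<in> red" using gen assms(2) gact_closed by simp
  have cl: "ev ?r \<in> carrier GP" "ret (V - {v}) y \<in> carrier GP" "gen w g \<in> carrier GP" "ev r \<in> carrier GP"
    using ev_closed r gen assms(2) by simp_all
  show ?case
  proof (cases "w = v")
    case True
    obtain a us where au: "a \<in> carrier (G v)" "us \<in> base" "?r = cons a us" using red_cases[OF r] .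
    have us: "ev us \<in> carrier GP" using au ev_closed by (simp add: base_def)
    have "ev (gact (gen w g \<otimes>\<^bsub>GP\<^esub> y) r) = gen v g \<otimes>\<^bsub>GP\<^esub> ev ?r"
      using True gen assms(2) au v us
      by (simp add: gact_mult gact_gen cons_red act_simps vmul_cons ev_cons gen_mult GP.m_assoc)
    then show ?thesis using True gen cl v by (simp add: ret_mult ret_gen GP.m_assoc)
  next
    case False
    have "ev (gact (gen w g \<otimes>\<^bsub>GP\<^esub> y) r) = gen w g \<otimes>\<^bsub>GP\<^esub> ev ?r \<otimes>\<^bsub>GP\<^esub> inv\<^bsub>GP\<^esub> gen w g"
      using False gen assms(2) ev_shift[OF gen_PP r] 
      by (simp add: gact_mult gact_gen r act_simps)
    moreover have "ret (V - {v}) (gen w g \<otimes>\<^bsub>GP\<^esub> y) = gen w g \<otimes>\<^bsub>GP\<^esub> ret (V - {v}) y"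
      using False gen cl by (simp add: ret_mult ret_gen)
    moreover have "gen w g \<otimes>\<^bsub>GP\<^esub> ev ?r \<otimes>\<^bsub>GP\<^esub> inv\<^bsub>GP\<^esub> gen w g \<otimes>\<^bsub>GP\<^esub> (gen w g \<otimes>\<^bsub>GP\<^esub> ret (V - {v}) y)
        = gen w g \<otimes>\<^bsub>GP\<^esub> ev ?r \<otimes>\<^bsub>GP\<^esub> (inv\<^bsub>GP\<^esub> gen w g \<otimes>\<^bsub>GP\<^esub> gen w g) \<otimes>\<^bsub>GP\<^esub> ret (V - {v}) y"
      using cl by (simp only: GP.m_assoc GP.m_closed GP.inv_closed)
    moreover have "\<dots> = gen w g \<otimes>\<^bsub>GP\<^esub> (y \<otimes>\<^bsub>GP\<^esub> ev r)"
      using gen(4)[symmetric] cl by (simp add: GP.m_assoc)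
    ultimately show ?thesis using gen cl by (simp only: GP.m_assoc)
  qed
qed

lemma stabilizer_Nil:
  assumes "x \<in> carrier GP" "gact x [] = []"
  shows "x \<in> PP"
  using ev_gact[OF assms(1) red_Nil] assms by (simp add: PP_def par_iff)

text \<open>Yields transitivity on reduced words. Shifting by the inverse of \<open>p\<close> moves
  the first index to \<open>CC\<close>; the shifted rest does not start at \<open>CC\<close> because
  the word is reduced, so acting with \<open>h\<close> writes a new letter in front of it.\<close>

lemma gact_ev: "r \<in> red \<Longrightarrow> gact (ev r) [] = r"
proof (induction r)
  case Nil
  then show ?case by (simp add: gact_one red_Nil)
next
  case (Cons a r)
  obtain x h where a: "a = (x, h)" by fastforce
  then have *: "r \<in> red" "x \<in> idx" "h \<in> carrier (G v)" "h \<noteq> \<one>\<^bsub>G v\<^esub>" "r = [] \<or> fst (hd r) \<noteq> x"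
    using Cons(2) by (simp_all add: red_Cons)
  obtain p where p: "p \<in> PP" "x = p <#\<^bsub>GP\<^esub> CC" using *(2) unfolding idx_def by blast
  let ?r = "shift (inv\<^bsub>GP\<^esub> p) r"
  have cl: "p \<in> carrier GP" "ev r \<in> carrier GP" "gen v h \<in> carrier GP"
    using p *(1,3) PP_closed ev_closed v by simp_all
  have r: "?r \<in> red" using shift_red[OF PP_inv[OF p(1)] *(1)] .
  have ne: "inv\<^bsub>GP\<^esub> p <#\<^bsub>GP\<^esub> y \<noteq> CC" if "y \<in> idx" "y \<noteq> x" for y
    using lcos_inv[OF that(1) PP_inv[OF p(1)]] that(2) p cl by auto
  have rb: "?r \<in> base"
  proof (cases r)
    case Nil
    then show ?thesis by (simp add: shift_def base_Nil)
  next
    case (Cons b r')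
    then show ?thesis using r ne[of "fst b"] *(5) redD[OF *(1), of "fst b" "snd b"]
      by (cases b) (simp add: base_def shift_def)
  qed
  have "ev (a # r) = p \<otimes>\<^bsub>GP\<^esub> (gen v h \<otimes>\<^bsub>GP\<^esub> (inv\<^bsub>GP\<^esub> p \<otimes>\<^bsub>GP\<^esub> ev r))"
    using cl a p(2) cj_eq[OF p(1) *(3)] by (simp add: GP.m_assoc)
  then have "gact (ev (a # r)) [] = gact p (gact (gen v h) (gact (inv\<^bsub>GP\<^esub> p) r))"
    using cl Cons.IH[OF *(1)] red_Nil by (simp add: gact_mult gact_closed)
  also have "\<dots> = shift p (vmul h ?r)"
    using cl gact_PP[OF PP_inv[OF p(1)] *(1)] gact_gen[OF v *(3) r] gact_closed[OF cl(3) r] gact_PP[OF p(1)]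
    by (simp add: act_simps)
  also have "vmul h ?r = (CC, h) # ?r"
    using vmul_cons[OF *(3) Gv.one_closed rb] *(3,4) by (simp add: cons_def)
  also have "shift p ((CC, h) # ?r) = a # r"
    using shift_inv[OF *(1) p(1)] p(2) a by (simp add: shift_def)
  finally show ?case .
qed

text \<open>\<open>M\<close> is the set of points minimising the maximal distance to a finite orbit; by
  \<open>rdist_between\<close> any two of its points are at distance at most 1.\<close>

lemma finite_invariant_clique:
  assumes A: "subgroup A GP" "finite A"
  obtains M where "M \<subseteq> red" "M \<noteq> {}" "\<And>n m. n \<in> M \<Longrightarrow> m \<in> M \<Longrightarrow> rdist n m \<le> 1"
    "\<And>a n. a \<in> A \<Longrightarrow> n \<in> M \<Longrightarrow> gact a n \<in> M"
proof -
  have AG: "a \<in> carrier GP" if "a \<in> A" for a using that subgroup.subset[OF A(1)] by blast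
  define bnd where "bnd n k \<longleftrightarrow> (\<forall>a\<in>A. rdist n (gact a []) \<le> k)" for n k
  define k where "k = (LEAST k. \<exists>n\<in>red. bnd n k)"
  have "bnd [] (Max ((\<lambda>a. rdist [] (gact a [])) ` A))"
    unfolding bnd_def using A(2) by (auto intro: Max_ge)
  then have ex: "\<exists>k. \<exists>n\<in>red. bnd n k" using red_Nil by blast
  have k: "\<exists>n\<in>red. bnd n k" unfolding k_def using LeastI_ex[OF ex] .
  have min: "k \<le> j" if "n \<in> red" "bnd n j" for n j
    unfolding k_def using that by (intro Least_le) blast
  define M where "M = {n \<in> red. bnd n k}"
  show thesis
  proof (rule that[of M])
    show "M \<subseteq> red" "M \<noteq> {}" using k by (auto simp: M_def)
  next
    fix a n assume a: "a \<in> A" and n: "n \<in> M"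
    have aG: "a \<in> carrier GP" and nr: "n \<in> red" using AG a n by (auto simp: M_def)
    have "rdist (gact a n) (gact b []) \<le> k" if b: "b \<in> A" for b
    proof -
      \<comment> \<open>The orbit point of \<open>b\<close> is the \<open>a\<close>-translate of the
        orbit point of \<open>?c\<close>, so \<open>a\<close> can be cancelled from the
        distance.\<close>
      let ?c = "inv\<^bsub>GP\<^esub> a \<otimes>\<^bsub>GP\<^esub> b"
      have c: "?c \<in> A" using subgroup.m_closed[OF A(1) subgroup.m_inv_closed[OF A(1) a] b] .
      have "gact a (gact ?c []) = gact b []"
        using AG[OF b] aG gact_inv(2)[OF aG] red_Nil by (simp add: gact_mult gact_closed)
      then have "rdist (gact a n) (gact b []) = rdist n (gact ?c [])"
        using rdist_gact[OF aG nr, of "gact ?c []"] gact_closed[OF AG[OF c] red_Nil] by simp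
      then show ?thesis using n c unfolding M_def bnd_def by simp
    qed
    then show "gact a n \<in> M" using gact_closed[OF aG nr] by (simp add: M_def bnd_def)
  next
    fix n m assume n: "n \<in> M" and m: "m \<in> M"
    then have nr: "n \<in> red" "m \<in> red" by (simp_all add: M_def)
    \<comment> \<open>By transitivity \<open>n\<close> can be moved to \<open>[]\<close>, where
      \<open>rdist n m\<close> becomes a length and \<open>rdist_between\<close> applies.\<close>
    let ?x = "ev n"
    have x: "?x \<in> carrier GP" "gact ?x [] = n" using nr ev_closed gact_ev by simp_all
    have xi: "inv\<^bsub>GP\<^esub> ?x \<in> carrier GP" using x by simp
    let ?m = "gact (inv\<^bsub>GP\<^esub> ?x) m"
    have mr: "?m \<in> red" using gact_closed[OF xi nr(2)] .
    have n0: "gact (inv\<^bsub>GP\<^esub> ?x) n = []" using gact_inv(1)[OF x(1) red_Nil] x(2) by simp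
    have len: "length ?m = rdist n m" using rdist_gact[OF xi nr] n0 by simp
    show "rdist n m \<le> 1"
    proof (rule ccontr)
      assume "\<not> rdist n m \<le> 1"
      then have 2: "2 \<le> length ?m" using len by simp
      have pr: "[hd ?m] \<in> red" using mr 2 by (cases ?m; cases "hd ?m") (auto simp: red_Cons red_Nil)
      let ?p = "gact ?x [hd ?m]"
      have lt: "rdist ?p (gact a []) < k" if a: "a \<in> A" for a
      proof -
        let ?o = "gact a []"
        have o: "?o \<in> red" using gact_closed[OF AG[OF a] red_Nil] .
        let ?o' = "gact (inv\<^bsub>GP\<^esub> ?x) ?o"
        have o': "?o' \<in> red" "gact ?x ?o' = ?o" using gact_closed[OF xi o] gact_inv(2)[OF x(1) o] .
        have "rdist ?p ?o = rdist [hd ?m] ?o'" using rdist_gact[OF x(1) pr o'(1)] o'(2) by simp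
        also have "\<dots> < max (length ?o') (rdist ?m ?o')" by (rule rdist_between[OF 2])
        also have "length ?o' = rdist n ?o" using rdist_gact[OF xi nr(1) o] n0 by simp
        also have "rdist ?m ?o' = rdist m ?o" using rdist_gact[OF xi nr(2) o] .
        finally show ?thesis using n m a unfolding M_def bnd_def by fastforce
      qed
      \<comment> \<open>A strict inequality at one orbit point makes \<open>k\<close> positive, so
        \<open>k - 1\<close> is a true decrease; the strict inequalities at all orbit points make it
        a bound for \<open>?p\<close>, against minimality of \<open>k\<close>.\<close>
      have "0 < k" using lt[OF subgroup.one_closed[OF A(1)]] by simp
      moreover have "bnd ?p (k - 1)" using lt unfolding bnd_def by fastforce
      then have "k \<le> k - 1" using min gact_closed[OF x(1) pr] by blast
      ultimately show False by simp
    qed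
  qed
qed

text \<open>A one-point invariant clique is a fixed point, whose stabiliser is conjugate into
  \<open>PP\<close>. A larger one can be moved so that it contains \<open>[]\<close> and
  \<open>[(CC, h)]\<close>. The words within distance 1 of both are the words
  \<open>cons k []\<close>, the orbit of \<open>[]\<close> under \<open>G v\<close>, and the
  elements in question are then products of an element of \<open>G v\<close> and an element of
  \<open>CC\<close>.\<close>

lemma conj_into_PP_or_star:
  assumes A: "subgroup A GP" "finite A"
  shows "\<exists>g\<in>carrier GP. conj_set GP g A \<subseteq> par (V - {v}) \<or> conj_set GP g A \<subseteq> par (insert v lk)"
proof -
  obtain M where M: "M \<subseteq> red" "M \<noteq> {}" "\<And>n m. n \<in> M \<Longrightarrow> m \<in> M \<Longrightarrow> rdist n m \<le> 1"
    "\<And>a n. a \<in> A \<Longrightarrow> n \<in> M \<Longrightarrow> gact a n \<in> M"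
    by (rule finite_invariant_clique[OF A]) (rule that, assumption+)
  have AG: "a \<in> carrier GP" if "a \<in> A" for a using that subgroup.subset[OF A(1)] by blast
  \<comment> \<open>The translate of \<open>M\<close> by the inverse of \<open>x\<close>, which the
    conjugates \<open>cnj x a\<close> preserve.\<close>
  define N where "N x = {r \<in> red. gact x r \<in> M}" for x
  \<comment> \<open>The double inverse makes the set of all \<open>cnj x a\<close> literally
    \<open>conj_set\<close> at the inverse of \<open>x\<close>.\<close>
  define cnj where "cnj x a = inv\<^bsub>GP\<^esub> x \<otimes>\<^bsub>GP\<^esub> a \<otimes>\<^bsub>GP\<^esub> inv\<^bsub>GP\<^esub> (inv\<^bsub>GP\<^esub> x)" for x a
  have cnj_closed: "cnj x a \<in> carrier GP" if "x \<in> carrier GP" "a \<in> A" for x a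
    using that AG by (simp add: cnj_def)
  have cnjN: "gact (cnj x a) r \<in> N x" if "x \<in> carrier GP" "a \<in> A" "r \<in> N x" for x a r
  proof -
    have "x \<otimes>\<^bsub>GP\<^esub> cnj x a = a \<otimes>\<^bsub>GP\<^esub> x"
      using that(1) AG[OF that(2)] by (simp add: cnj_def GP.m_assoc[symmetric])
    moreover have "r \<in> red" "gact x r \<in> M" using that(3) by (auto simp: N_def)
    ultimately have "gact x (gact (cnj x a) r) = gact a (gact x r)"
      using that AG cnj_closed gact_mult by metis
    then show ?thesis
      using M(4)[OF that(2) \<open>gact x r \<in> M\<close>] gact_closed[OF cnj_closed[OF that(1,2)] \<open>r \<in> red\<close>]
      by (simp add: N_def)
  qed
  have Nd: "rdist r r' \<le> 1" if "x \<in> carrier GP" "r \<in> N x" "r' \<in> N x" for x r r'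
    using that M(3)[of "gact x r" "gact x r'"] rdist_gact[of x r r'] by (simp add: N_def)
  obtain n where n: "n \<in> M" using M(2) by blast
  define x where "x = ev n"
  have x: "x \<in> carrier GP" "gact x [] = n" using n M(1) ev_closed gact_ev unfolding x_def by auto
  have nil: "[] \<in> N x" using x n red_Nil by (simp add: N_def)
  show ?thesis
  proof (cases "N x = {[]}")
    case True
    have "cnj x a \<in> PP" if "a \<in> A" for a
      using cnjN[OF x(1) that nil] True cnj_closed[OF x(1) that] stabilizer_Nil by simp
    then have "conj_set GP (inv\<^bsub>GP\<^esub> x) A \<subseteq> par (V - {v})"
      unfolding conj_set_def cnj_def PP_def by blast
    then show ?thesis using x by blast
  next
    case False
    then obtain m where m: "m \<in> N x" "m \<noteq> []" using nil by blast
    have "length m \<le> 1" using Nd[OF x(1) nil m(1)] by simp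
    then obtain y h where yh: "m = [(y, h)]" using m(2) by (cases m) auto
    have "m \<in> red" using m by (simp add: N_def)
    then have h: "y \<in> idx" "h \<in> carrier (G v)" "h \<noteq> \<one>\<^bsub>G v\<^esub>" using yh by (simp_all add: red_Cons)
    obtain p where p: "p \<in> PP" "y = p <#\<^bsub>GP\<^esub> CC" using h(1) unfolding idx_def by blast
    have pG: "p \<in> carrier GP" using PP_closed[OF p(1)] .
    \<comment> \<open>\<open>p\<close> fixes \<open>[]\<close> and carries \<open>[(CC, h)]\<close>
      to \<open>m\<close>, so both words belong to the translate \<open>N z\<close>.\<close>
    define z where "z = x \<otimes>\<^bsub>GP\<^esub> p"
    have z: "z \<in> carrier GP" using x pG by (simp add: z_def)
    have cr: "[(CC, h)] \<in> red" using h CC_idx by (simp add: red_Cons red_Nil)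
    have zN: "[] \<in> N z" "[(CC, h)] \<in> N z"
      using nil m yh p cr red_Nil x(1) pG
      by (simp_all add: N_def z_def gact_mult gact_PP shift_def)
    have "cnj z a \<in> par (insert v lk)" if a: "a \<in> A" for a
    proof -
      let ?b = "cnj z a"
      have b: "?b \<in> carrier GP" using cnj_closed[OF z a] .
      let ?r = "gact ?b []"
      have rN: "?r \<in> N z" using cnjN[OF z a zN(1)] .
      have r: "?r \<in> red" "length ?r \<le> 1" "rdist ?r [(CC, h)] \<le> 1"
        using rN Nd[OF z zN(1) rN] Nd[OF z rN zN(2)] by (simp_all add: N_def)
      obtain k where k: "k \<in> carrier (G v)" "?r = cons k []"
      proof (cases ?r)
        case Nil
        then show ?thesis using that[of "\<one>\<^bsub>G v\<^esub>"] by (simp add: cons_def)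
      next
        case (Cons c r')
        then obtain w j where w: "?r = [(w, j)]" using r(2) by (cases c) simp
        then have "w = CC" using r(3) by (simp split: if_splits)
        then show ?thesis using that[of j] w r(1) by (simp add: cons_def red_Cons)
      qed
      \<comment> \<open>Dividing \<open>?b\<close> by the element of \<open>G v\<close> that has the
        same effect on \<open>[]\<close> leaves an element fixing \<open>[]\<close>, hence one of
        \<open>PP\<close>.\<close>
      define c where "c = gen v (inv\<^bsub>G v\<^esub> k) \<otimes>\<^bsub>GP\<^esub> ?b"
      have gk: "gen v k \<in> carrier GP" "gen v (inv\<^bsub>G v\<^esub> k) \<in> carrier GP" using k v by simp_all
      have c: "c \<in> carrier GP" using b gk by (simp add: c_def)
      have "gen v k \<otimes>\<^bsub>GP\<^esub> gen v (inv\<^bsub>G v\<^esub> k) = \<one>\<^bsub>GP\<^esub>"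
        using gen_mult[OF v, of k "inv\<^bsub>G v\<^esub> k"] k gen_one[OF v] by simp
      then have bc: "?b = gen v k \<otimes>\<^bsub>GP\<^esub> c"
        using gk b unfolding c_def by (simp add: GP.m_assoc[symmetric])
      have "gact c [] = vmul (inv\<^bsub>G v\<^esub> k) (cons k [])"
        using gk b k r(1) v red_Nil cons_red[OF k(1) base_Nil]
        by (simp add: c_def gact_mult gact_gen act_simps)
      then have "gact c [] = []" using k vmul_cons[OF _ k(1) base_Nil] by (simp add: cons_def)
      then have cP: "c \<in> PP" using stabilizer_Nil[OF c] by simp
      have cs: "[(c <#\<^bsub>GP\<^esub> CC, h)] \<in> red" using shift_red[OF cP cr] by (simp add: shift_def)
      have bs: "gact ?b [(CC, h)] = vmul k [(c <#\<^bsub>GP\<^esub> CC, h)]"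
        unfolding bc using gk c cr k v gact_PP[OF cP cr] cs
        by (simp add: gact_mult gact_gen act_simps shift_def)
      have bN: "gact ?b [(CC, h)] \<in> N z" using cnjN[OF z a zN(2)] .
      have "c <#\<^bsub>GP\<^esub> CC = CC"
      proof (rule ccontr)
        \<comment> \<open>The image of \<open>[(CC, h)]\<close> would contain a letter at another
          index. Length at most 1 forces \<open>k\<close> to be the identity, and then the image is
          at distance 2 from \<open>[(CC, h)]\<close>.\<close>
        assume ne: "c <#\<^bsub>GP\<^esub> CC \<noteq> CC"
        then have bs': "gact ?b [(CC, h)] = cons k [(c <#\<^bsub>GP\<^esub> CC, h)]" using bs by (simp add: vmul_def)
        have "length (gact ?b [(CC, h)]) \<le> 1" using Nd[OF z zN(1) bN] by simp
        then have "k = \<one>\<^bsub>G v\<^esub>" using bs' by (simp add: cons_def split: if_splits)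
        then have "gact ?b [(CC, h)] = [(c <#\<^bsub>GP\<^esub> CC, h)]" using bs' by (simp add: cons_def)
        then show False using Nd[OF z bN zN(2)] ne by simp
      qed
      then have "c \<in> CC" using coset_CC_iff[OF c] by simp
      then have "c \<in> par (insert v lk)" using par_mono[of lk "insert v lk"] unfolding CC_def by blast
      then show ?thesis unfolding bc
        using subgroup.m_closed[OF par_subgroup gen_par[OF v insertI1 k(1)]] by simp
    qed
    then have "conj_set GP (inv\<^bsub>GP\<^esub> z) A \<subseteq> par (insert v lk)"
      unfolding conj_set_def cnj_def by blast
    then show ?thesis using z by blast
  qed
qed

end

section \<open>Conjugacy classes of finite subgroups\<close>

context group
begin

lemma conj_set_closed: "g \<in> carrier G \<Longrightarrow> A \<subseteq> carrier G \<Longrightarrow> conj_set G g A \<subseteq> carrier G"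
  unfolding conj_set_def by auto

lemma conj_set_conj_set:
  assumes "g \<in> carrier G" "h \<in> carrier G" "A \<subseteq> carrier G"
  shows "conj_set G g (conj_set G h A) = conj_set G (g \<otimes> h) A"
  unfolding conj_set_def image_image using assms
  by (intro image_cong) (auto simp: m_assoc inv_mult_group subset_iff)

lemma conj_set_one: "A \<subseteq> carrier G \<Longrightarrow> conj_set G \<one> A = A"
  unfolding conj_set_def by (force simp: image_iff)

lemma conj_set_inv: "g \<in> carrier G \<Longrightarrow> A \<subseteq> carrier G \<Longrightarrow> conj_set G (inv g) (conj_set G g A) = A"
  by (simp add: conj_set_conj_set conj_set_one)

lemma conj_set_mono: "A \<subseteq> B \<Longrightarrow> conj_set G g A \<subseteq> conj_set G g B"
  unfolding conj_set_def by blast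

lemma conj_iso: 
  assumes "g \<in> carrier G"
  shows "(\<lambda>a. g \<otimes> a \<otimes> inv g) \<in> iso G G"
proof -
  let ?c = "\<lambda>g a. g \<otimes> a \<otimes> inv g"
  have hom: "?c g \<in> hom G G"
  proof (rule homI)
    fix a b assume ab: "a \<in> carrier G" "b \<in> carrier G"
    have "?c g a \<otimes> ?c g b = g \<otimes> a \<otimes> (inv g \<otimes> g) \<otimes> b \<otimes> inv g"
      using assms ab by (simp only: m_assoc m_closed inv_closed)
    then show "?c g (a \<otimes> b) = ?c g a \<otimes> ?c g b" using assms ab by (simp add: m_assoc)
  qed (use assms in simp)
  have "?c h (?c k a) = a" if "h \<in> carrier G" "k \<in> carrier G" "h \<otimes> k = \<one>" "a \<in> carrier G" for h k a
  proof -
    have "?c h (?c k a) = h \<otimes> k \<otimes> a \<otimes> (inv k \<otimes> inv h)"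
      using that(1,2,4) by (simp only: m_assoc m_closed inv_closed)
    also have "inv k \<otimes> inv h = inv (h \<otimes> k)" using that(1,2) by (simp only: inv_mult_group)
    finally show ?thesis using that by simp
  qed
  from this[of g "inv g"] this[of "inv g" g] have "bij_betw (?c g) (carrier G) (carrier G)"
    using assms by (intro bij_betw_byWitness[where f' = "?c (inv g)"]) auto
  then show ?thesis using hom by (simp add: iso_def)
qed

lemma conj_set_subgroup:
  assumes "g \<in> carrier G" "subgroup A G"
  shows "subgroup (conj_set G g A) G"
  unfolding conj_set_def
  by (rule group_hom.subgroup_img_is_subgroup[OF _ assms(2)])
    (use conj_iso[OF assms(1)] in \<open>simp add: group_hom_def group_hom_axioms_def iso_def is_group\<close>)

lemma card_conj_set: 
  assumes "g \<in> carrier G" "A \<subseteq> carrier G"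
  shows "card (conj_set G g A) = card A"
  unfolding conj_set_def
  by (rule card_image) (use conj_iso[OF assms(1)] assms(2) in \<open>auto simp: iso_def bij_betw_def intro: inj_on_subset\<close>)

lemma finite_conj_set: "finite A \<Longrightarrow> finite (conj_set G g A)"
  by (simp add: conj_set_def)

lemma conj_set_is_iso:
  assumes "g \<in> carrier G" "A \<subseteq> carrier G"
  shows "G\<lparr>carrier := A\<rparr> \<cong> G\<lparr>carrier := conj_set G g A\<rparr>"
  unfolding conj_set_def by (rule is_isoI[OF iso_restrict_subgroup[OF conj_iso[OF assms(1)] assms(2)]])

lemma conj_class_iff: "S \<in> subgroup_conj_class G A \<longleftrightarrow> (\<exists>g\<in>carrier G. S = conj_set G g A)"
  unfolding subgroup_conj_class_def by blast

lemma self_conj_class: "A \<subseteq> carrier G \<Longrightarrow> A \<in> subgroup_conj_class G A"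
  unfolding conj_class_iff by (rule bexI[of _ \<one>]) (simp_all add: conj_set_one)

lemma conj_class_conj_set:
  assumes "g \<in> carrier G" "A \<subseteq> carrier G"
  shows "subgroup_conj_class G (conj_set G g A) = subgroup_conj_class G A"
proof -
  have "conj_set G h (conj_set G g A) \<in> subgroup_conj_class G A" if "h \<in> carrier G" for h
    unfolding conj_class_iff conj_set_conj_set[OF that assms] using m_closed[OF that assms(1)] by blast
  moreover have "conj_set G h A \<in> subgroup_conj_class G (conj_set G g A)" if "h \<in> carrier G" for h
  proof -
    have "conj_set G h A = conj_set G (h \<otimes> inv g) (conj_set G g A)"
      using that assms by (simp add: conj_set_conj_set m_assoc)
    then show ?thesis unfolding conj_class_iff using m_closed[OF that inv_closed[OF assms(1)]] by blast
  qed
  ultimately show ?thesis by (intro equalityI subsetI) (auto simp: conj_class_iff)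
qed

text \<open>The order is defined through arbitrary members of both classes; fixing one
  representative on each side turns it into conjugation into a given subgroup.\<close>

lemma CF_le_iff:
  assumes A: "A \<subseteq> carrier G" and B: "B \<subseteq> carrier G"
  shows "CF_le G (subgroup_conj_class G A) (subgroup_conj_class G B)
    \<longleftrightarrow> (\<exists>g\<in>carrier G. conj_set G g A \<subseteq> B)"
proof
  assume "CF_le G (subgroup_conj_class G A) (subgroup_conj_class G B)"
  then obtain a b g where g: "a \<in> carrier G" "b \<in> carrier G" "g \<in> carrier G"
    "conj_set G a A \<subseteq> conj_set G g (conj_set G b B)"
    unfolding CF_le_def subgroup_conj_class_def by blast
  let ?h = "inv (g \<otimes> b)"
  have "conj_set G (?h \<otimes> a) A = conj_set G ?h (conj_set G a A)" using g A by (simp add: conj_set_conj_set)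
  also have "\<dots> \<subseteq> conj_set G ?h (conj_set G (g \<otimes> b) B)"
    using g(4) conj_set_conj_set[OF g(3,2) B] by (intro conj_set_mono) simp
  also have "\<dots> = B" using g B by (intro conj_set_inv) simp_all
  finally show "\<exists>g\<in>carrier G. conj_set G g A \<subseteq> B" using g by (intro bexI[of _ "?h \<otimes> a"]) simp_all
next
  assume "\<exists>g\<in>carrier G. conj_set G g A \<subseteq> B"
  then obtain g where g: "g \<in> carrier G" "conj_set G g A \<subseteq> B" by blast
  have B1: "conj_set G \<one> B = B" using B by (rule conj_set_one)
  then show "CF_le G (subgroup_conj_class G A) (subgroup_conj_class G B)"
    unfolding CF_le_def
  proof (intro bexI)
    show "conj_set G g A \<subseteq> conj_set G \<one> B" using g(2) unfolding B1 .
    show "B \<in> subgroup_conj_class G B" using self_conj_class[OF B] .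
    show "conj_set G g A \<in> subgroup_conj_class G A" using g unfolding subgroup_conj_class_def by blast
  qed simp
qed

lemma CF_E:
  assumes "P \<in> CF G"
  obtains A where "subgroup A G" "finite A" "A \<subseteq> carrier G" "P = subgroup_conj_class G A"
proof -
  obtain A where "subgroup A G" "finite A" "P = subgroup_conj_class G A"
    using assms unfolding CF_def by blast
  then show ?thesis using that[of A] subgroup.subset by blast
qed

lemma CF_le_trans:
  assumes "P \<in> CF G" "Q \<in> CF G" "R \<in> CF G" "CF_le G P Q" "CF_le G Q R"
  shows "CF_le G P R"
proof -
  obtain A where A: "A \<subseteq> carrier G" "P = subgroup_conj_class G A" using assms(1) by (rule CF_E)
  obtain B where B: "B \<subseteq> carrier G" "Q = subgroup_conj_class G B" using assms(2) by (rule CF_E)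
  obtain C where C: "C \<subseteq> carrier G" "R = subgroup_conj_class G C" using assms(3) by (rule CF_E)
  obtain g h where g: "g \<in> carrier G" "conj_set G g A \<subseteq> B" "h \<in> carrier G" "conj_set G h B \<subseteq> C"
    using assms(4,5) unfolding A(2) B(2) C(2) CF_le_iff[OF A(1) B(1)] CF_le_iff[OF B(1) C(1)] by blast
  then have "conj_set G (h \<otimes> g) A \<subseteq> C"
    using A conj_set_mono[OF g(2), of h] conj_set_conj_set[OF g(3,1) A(1)] by (metis subset_trans)
  then show ?thesis unfolding A(2) C(2) CF_le_iff[OF A(1) C(1)] using m_closed[OF g(3,1)] by blast
qed

text \<open>Rests on finiteness: two subgroups conjugate into each other have the same cardinality,
  so the inclusion is an equality.\<close>

lemma CF_le_antisym:
  assumes "P \<in> CF G" "Q \<in> CF G" "CF_le G P Q" "CF_le G Q P"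
  shows "P = Q"
proof -
  obtain A where A: "A \<subseteq> carrier G" "finite A" "P = subgroup_conj_class G A" using assms(1) by (rule CF_E)
  obtain B where B: "B \<subseteq> carrier G" "finite B" "Q = subgroup_conj_class G B" using assms(2) by (rule CF_E)
  obtain g where g: "g \<in> carrier G" "conj_set G g A \<subseteq> B" 
    using assms(3) unfolding A(3) B(3) CF_le_iff[OF A(1) B(1)] by blast
  obtain h where h: "h \<in> carrier G" "conj_set G h B \<subseteq> A" 
    using assms(4) unfolding A(3) B(3) CF_le_iff[OF B(1) A(1)] by blast
  have "card B \<le> card A" using card_mono[OF A(2) h(2)] card_conj_set[OF h(1) B(1)] by simp
  then have "conj_set G g A = B" using g B card_conj_set[OF g(1) A(1)] by (intro card_seteq) simp_all
  then show ?thesis using A B conj_class_conj_set[OF g(1) A(1)] by simp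
qed

end

section \<open>Isomorphic groups have isomorphic posets of classes\<close>

text \<open>The induced map takes the image of every member of a class. Members \<open>S\<close> and
  \<open>T\<close> of corresponding classes need not correspond under the group isomorphism, so
  their isomorphism passes through conjugations.\<close>

lemma iso_CF:
  assumes "group A" "group B" "A \<cong> B"
  shows "\<exists>\<psi>. bij_betw \<psi> (CF A) (CF B)
    \<and> (\<forall>P\<in>CF A. \<forall>Q\<in>CF A. CF_le A P Q \<longleftrightarrow> CF_le B (\<psi> P) (\<psi> Q))
    \<and> (\<forall>P\<in>CF A. \<forall>S\<in>P. \<forall>T\<in>\<psi> P. A\<lparr>carrier := S\<rparr> \<cong> B\<lparr>carrier := T\<rparr>)"
proof -
  interpret A: group A by fact
  interpret B: group B by fact
  obtain h where h: "h \<in> iso A B" using assms(3) unfolding is_iso_def by blast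
  interpret h: group_hom A B h
    using h by (simp add: group_hom_def group_hom_axioms_def iso_def A.is_group B.is_group)
  have surj: "h ` carrier A = carrier B" and inj: "inj_on h (carrier A)"
    using h by (auto simp: iso_def bij_betw_def)
  define \<psi> where "\<psi> = (`) ((`) h)"
  have conj: "h ` conj_set A g S = conj_set B (h g) (h ` S)"
    if "g \<in> carrier A" "S \<subseteq> carrier A" for g S
    unfolding conj_set_def image_image using that by (intro image_cong) (auto simp: subset_iff)
  have \<psi>: "\<psi> (subgroup_conj_class A S) = subgroup_conj_class B (h ` S)" if S: "S \<subseteq> carrier A" for S
  proof -
    have "\<psi> (subgroup_conj_class A S) = (\<lambda>g. h ` conj_set A g S) ` carrier A"
      unfolding \<psi>_def subgroup_conj_class_def by blast
    also have "\<dots> = (\<lambda>y. conj_set B y (h ` S)) ` h ` carrier A"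
      unfolding image_image using conj[OF _ S] by (intro image_cong) simp_all
    also have "\<dots> = subgroup_conj_class B (h ` S)"
      unfolding surj subgroup_conj_class_def by blast
    finally show ?thesis .
  qed
  \<comment> \<open>\<open>h\<close> is injective only on the carrier, so injectivity of
    \<open>\<psi>\<close> requires all members of a class to lie inside the carrier.\<close>
  have sub: "S \<subseteq> carrier A" if PS: "P \<in> CF A" "S \<in> P" for P S
  proof -
    obtain T where T: "T \<subseteq> carrier A" "P = subgroup_conj_class A T" using PS(1) by (rule A.CF_E)
    then obtain g where "g \<in> carrier A" "S = conj_set A g T"
      using PS(2) unfolding subgroup_conj_class_def by blast
    then show ?thesis using A.conj_set_closed T(1) by simp
  qed
  have \<psi>surj: "\<psi> ` CF A = CF B"
  proof
    show "\<psi> ` CF A \<subseteq> CF B"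
    proof
      fix Q assume "Q \<in> \<psi> ` CF A"
      then obtain P where P: "P \<in> CF A" "Q = \<psi> P" by (rule imageE)
      obtain S where S: "subgroup S A" "finite S" "S \<subseteq> carrier A" "P = subgroup_conj_class A S"
        using P(1) by (rule A.CF_E)
      have "subgroup (h ` S) B" "finite (h ` S)" using h.subgroup_img_is_subgroup[OF S(1)] S(2) by simp_all
      then show "Q \<in> CF B" unfolding P(2) S(4) \<psi>[OF S(3)] CF_def by blast
    qed
    show "CF B \<subseteq> \<psi> ` CF A"
    proof
      fix Q assume "Q \<in> CF B"
      then obtain T where T: "subgroup T B" "finite T" "T \<subseteq> carrier B" "Q = subgroup_conj_class B T"
        by (rule B.CF_E)
      let ?k = "inv_into (carrier A) h"
      have k: "?k \<in> iso B A" using A.iso_set_sym[OF h] .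
      have "group_hom B A ?k"
        using k by (simp add: group_hom_def group_hom_axioms_def iso_def A.is_group B.is_group)
      then have S: "subgroup (?k ` T) A" by (rule group_hom.subgroup_img_is_subgroup) (rule T(1))
      have "h ` ?k ` T = T" by (rule image_inv_into_cancel[OF surj T(3)])
      then have "\<psi> (subgroup_conj_class A (?k ` T)) = Q" using \<psi>[OF subgroup.subset[OF S]] T(4) by simp
      moreover have "subgroup_conj_class A (?k ` T) \<in> CF A" using S T(2) unfolding CF_def by blast
      ultimately show "Q \<in> \<psi> ` CF A" by blast
    qed
  qed
  have \<psi>inj: "inj_on \<psi> (CF A)"
  proof (rule inj_onI)
    fix P Q assume PQ: "P \<in> CF A" "Q \<in> CF A" "\<psi> P = \<psi> Q"
    have "inj_on ((`) h) (Pow (carrier A))" using inj by (rule inj_on_image_Pow)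
    moreover have "P \<subseteq> Pow (carrier A)" "Q \<subseteq> Pow (carrier A)" using sub PQ by blast+
    ultimately show "P = Q" using PQ(3) unfolding \<psi>_def by (metis inj_on_image_eq_iff)
  qed
  have le: "CF_le A P Q \<longleftrightarrow> CF_le B (\<psi> P) (\<psi> Q)" if PQ: "P \<in> CF A" "Q \<in> CF A" for P Q
  proof -
    obtain S where S: "S \<subseteq> carrier A" "P = subgroup_conj_class A S" using PQ(1) by (rule A.CF_E)
    obtain T where T: "T \<subseteq> carrier A" "Q = subgroup_conj_class A T" using PQ(2) by (rule A.CF_E)
    have "CF_le B (\<psi> P) (\<psi> Q) \<longleftrightarrow> (\<exists>y\<in>carrier B. conj_set B y (h ` S) \<subseteq> h ` T)"
      unfolding S(2) T(2) \<psi>[OF S(1)] \<psi>[OF T(1)]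
      by (rule B.CF_le_iff) (use S(1) T(1) h.hom_closed in blast)+
    also have "\<dots> \<longleftrightarrow> (\<exists>g\<in>carrier A. h ` conj_set A g S \<subseteq> h ` T)"
      unfolding surj[symmetric] using conj[OF _ S(1)] by simp
    also have "\<dots> \<longleftrightarrow> (\<exists>g\<in>carrier A. conj_set A g S \<subseteq> T)"
    proof (rule bex_cong[OF refl])
      fix g assume "g \<in> carrier A"
      then have "conj_set A g S \<subseteq> carrier A" by (rule A.conj_set_closed[OF _ S(1)])
      then show "h ` conj_set A g S \<subseteq> h ` T \<longleftrightarrow> conj_set A g S \<subseteq> T"
        using inj T(1) unfolding inj_on_def by blast
    qed
    also have "\<dots> \<longleftrightarrow> CF_le A P Q" using S T A.CF_le_iff by simp
    finally show ?thesis by simp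
  qed
  have types: "A\<lparr>carrier := S\<rparr> \<cong> B\<lparr>carrier := T\<rparr>" if P: "P \<in> CF A" and S: "S \<in> P" and T: "T \<in> \<psi> P" for P S T
  proof -
    obtain C where C: "subgroup C A" "C \<subseteq> carrier A" "P = subgroup_conj_class A C" using P by (rule A.CF_E)
    obtain a where a: "a \<in> carrier A" "S = conj_set A a C" using S C unfolding subgroup_conj_class_def by blast
    obtain b where b: "b \<in> carrier A" "T = h ` conj_set A b C"
      using T C unfolding \<psi>_def subgroup_conj_class_def by blast
    have Sc: "A\<lparr>carrier := S\<rparr> \<cong> A\<lparr>carrier := C\<rparr>"
      using group.iso_sym[OF A.subgroup_imp_group[OF C(1)] A.conj_set_is_iso[OF a(1) C(2)]] a(2) by simp
    have "A\<lparr>carrier := conj_set A b C\<rparr> \<cong> B\<lparr>carrier := T\<rparr>"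
      unfolding b(2) by (rule is_isoI[OF iso_restrict_subgroup[OF h A.conj_set_closed[OF b(1) C(2)]]])
    then show ?thesis
      using iso_trans[OF Sc iso_trans[OF A.conj_set_is_iso[OF b(1) C(2)]]] by blast
  qed
  have "bij_betw \<psi> (CF A) (CF B)" using \<psi>inj \<psi>surj by (rule bij_betw_imageI)
  then show ?thesis using le types by (intro exI[of _ \<psi>] conjI ballI)
qed

section \<open>Conjugation into parabolic subgroups and the maximal classes\<close>

context graph_prod
begin

text \<open>Apply \<open>ret S\<close> to the conjugate of \<open>a\<close> by \<open>g\<close>: it
  fixes \<open>a\<close>, turns the conjugator into \<open>ret S g\<close> and carries
  \<open>par T\<close> into \<open>par (S \<inter> T)\<close>.\<close>

lemma conj_into_Int:
  assumes A: "A \<subseteq> par S" and g: "g \<in> carrier GP" and gA: "conj_set GP g A \<subseteq> par T"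
  shows "\<exists>g'\<in>carrier GP. conj_set GP g' A \<subseteq> par (S \<inter> T)"
proof (intro bexI)
  show "ret S g \<in> carrier GP" using g by simp
  show "conj_set GP (ret S g) A \<subseteq> par (S \<inter> T)"
    unfolding conj_set_def
  proof (rule image_subsetI)
    fix a assume a: "a \<in> A"
    then have aS: "a \<in> carrier GP" "ret S a = a" using A par_iff by blast+
    have "g \<otimes>\<^bsub>GP\<^esub> a \<otimes>\<^bsub>GP\<^esub> inv\<^bsub>GP\<^esub> g \<in> par T" using gA a unfolding conj_set_def by blast
    then have "ret S (g \<otimes>\<^bsub>GP\<^esub> a \<otimes>\<^bsub>GP\<^esub> inv\<^bsub>GP\<^esub> g) \<in> par (S \<inter> T)" by (rule ret_par)
    then show "ret S g \<otimes>\<^bsub>GP\<^esub> a \<otimes>\<^bsub>GP\<^esub> inv\<^bsub>GP\<^esub> ret S g \<in> par (S \<inter> T)"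
      using g aS by (simp add: ret_mult ret_inv)
  qed
qed

theorem finite_subgroup_conj_clique:
  assumes A: "subgroup A GP" "finite A"
  shows "\<exists>K. clique K \<and> (\<exists>g\<in>carrier GP. conj_set GP g A \<subseteq> par K)"
proof -
  have Asub: "A \<subseteq> carrier GP" using subgroup.subset[OF A(1)] .
  define Q where "Q S \<longleftrightarrow> S \<subseteq> V \<and> (\<exists>g\<in>carrier GP. conj_set GP g A \<subseteq> par S)" for S
  have "Q V" unfolding Q_def using GP.conj_set_closed[OF GP.one_closed Asub] par_V by blast
  then obtain S where S: "Q S" and min: "\<And>T. Q T \<Longrightarrow> card S \<le> card T"
    using ex_has_least_nat[of Q V card] by blast
  obtain g where g: "S \<subseteq> V" "g \<in> carrier GP" "conj_set GP g A \<subseteq> par S" using S unfolding Q_def by blast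
  let ?B = "conj_set GP g A"
  have finS: "finite S" using g finite_V finite_subset by blast
  have "E v w" if vw: "v \<in> S" "w \<in> S" "v \<noteq> w" for v w
  proof (rule ccontr)
    assume nE: "\<not> E v w"
    interpret graph_prod_vertex V E G v by unfold_locales (use vw g in blast)
    obtain T h where T: "T = V - {v} \<or> T = insert v lk" "h \<in> carrier GP" "conj_set GP h ?B \<subseteq> par T"
      using conj_into_PP_or_star[OF GP.conj_set_subgroup[OF g(2) A(1)] GP.finite_conj_set[OF A(2)]] by blast
    obtain h' where h': "h' \<in> carrier GP" "conj_set GP h' ?B \<subseteq> par (S \<inter> T)"
      using conj_into_Int[OF g(3) T(2,3)] by blast
    then have "Q (S \<inter> T)"
      unfolding Q_def using g GP.conj_set_conj_set[OF h'(1) g(2) Asub] GP.m_closed[OF h'(1) g(2)]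
      by (metis Int_lower1 subset_trans)
    \<comment> \<open>\<open>V - {v}\<close> misses \<open>v\<close>, and the star of
      \<open>v\<close> misses its non-neighbour \<open>w\<close>.\<close>
    moreover have "v \<notin> T \<or> w \<notin> T" using T(1) vw nE by (auto simp: lk_def)
    then have "S \<inter> T \<subset> S" using vw by blast
    ultimately show False using min psubset_card_mono[OF finS] by (meson leD)
  qed
  then have "clique S" using g unfolding clique_def by blast
  then show ?thesis using g by blast
qed

end

locale finite_graph_prod = graph_prod +
  assumes fin_vertex: "v \<in> V \<Longrightarrow> finite (carrier (G v))"
    and indec_vertex: "v \<in> V \<Longrightarrow> directly_indecomposable (G v)"
begin

definition cc :: "'a set \<Rightarrow> ('a \<times> 'b) list set set set" where
  "cc K = subgroup_conj_class GP (par K)"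

definition max_cliques :: "'a set set" where
  "max_cliques = {K. clique K \<and> (\<forall>L. clique L \<longrightarrow> K \<subseteq> L \<longrightarrow> K = L)}"

definition max_CF :: "('a \<times> 'b) list set set set set" where
  "max_CF = {P \<in> CF GP. \<forall>Q\<in>CF GP. CF_le GP P Q \<longrightarrow> P = Q}"

lemma cc_CF: "clique K \<Longrightarrow> cc K \<in> CF GP"
proof -
  assume K: "clique K"
  then have "finite (par K)" using finite_par fin_vertex clique_def by auto
  then show ?thesis unfolding cc_def CF_def using par_subgroup by blast
qed

lemma par_cc: "par K \<in> cc K"
  unfolding cc_def by (rule GP.self_conj_class[OF par_subset])

text \<open>For \<open>v\<close> in \<open>K\<close> but not in \<open>L\<close>, the retraction
  \<open>ret {v}\<close> kills \<open>par L\<close>, yet it sends a conjugate of a generator at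
  \<open>v\<close> to a conjugate of the same generator. A non-trivial generator would thus become
  trivial.\<close>

lemma cc_le_iff:
  assumes K: "clique K"
  shows "CF_le GP (cc K) (cc L) \<longleftrightarrow> K \<subseteq> L"
proof
  assume "K \<subseteq> L"
  then show "CF_le GP (cc K) (cc L)"
    unfolding cc_def using GP.CF_le_iff[OF par_subset par_subset] GP.conj_set_one[OF par_subset] par_mono
    by (metis GP.one_closed)
next
  assume "CF_le GP (cc K) (cc L)"
  then obtain g where g: "g \<in> carrier GP" "conj_set GP g (par K) \<subseteq> par L"
    unfolding cc_def using GP.CF_le_iff[OF par_subset par_subset] by blast
  show "K \<subseteq> L"
  proof
    fix v assume vK: "v \<in> K"
    then have v: "v \<in> V" using K unfolding clique_def by blast
    show "v \<in> L"
    proof (rule ccontr)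
      assume vL: "v \<notin> L"
      interpret Gv: group "G v" using vgroup v .
      obtain h where h: "h \<in> carrier (G v)" "h \<noteq> \<one>\<^bsub>G v\<^esub>"
        using indec_vertex[OF v] Gv.one_closed unfolding directly_indecomposable_def by blast
      let ?x = "gen v h" and ?r = "ret {v} g"
      have x: "?x \<in> carrier GP" "ret {v} ?x = ?x" using v h by (simp_all add: ret_gen)
      have "g \<otimes>\<^bsub>GP\<^esub> ?x \<otimes>\<^bsub>GP\<^esub> inv\<^bsub>GP\<^esub> g \<in> par L"
        using g(2) gen_par[OF v vK h(1)] unfolding conj_set_def by blast
      then have "ret {v} (g \<otimes>\<^bsub>GP\<^esub> ?x \<otimes>\<^bsub>GP\<^esub> inv\<^bsub>GP\<^esub> g) \<in> par {}"
        using ret_par[of _ L "{v}"] vL by simp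
      then have "?r \<otimes>\<^bsub>GP\<^esub> ?x \<otimes>\<^bsub>GP\<^esub> inv\<^bsub>GP\<^esub> ?r = \<one>\<^bsub>GP\<^esub>"
        using g x by (simp add: par_empty ret_mult ret_inv)
      then have "?r \<otimes>\<^bsub>GP\<^esub> ?x = ?r" using g x
        by (metis GP.inv_closed GP.inv_equality GP.inv_inv GP.m_closed ret_closed)
      then have "?x = \<one>\<^bsub>GP\<^esub>" using g x GP.l_cancel_one[of ?r ?x] by simp
      then show False using gen_eq_one[OF v h(1)] h(2) by simp
    qed
  qed
qed

lemma cc_inj: "inj_on cc {K. clique K}"
proof (rule inj_onI)
  fix K L assume *: "K \<in> {K. clique K}" "L \<in> {K. clique K}" "cc K = cc L"
  have sub: "M \<subseteq> N" if "clique M" "cc M = cc N" for M N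
    using cc_le_iff[OF that(1), of M] cc_le_iff[OF that(1), of N] unfolding that(2) by blast
  show "K = L" using sub[of K L] sub[of L K] * by simp
qed

lemma CF_le_clique:
  assumes "P \<in> CF GP"
  shows "\<exists>K. clique K \<and> CF_le GP P (cc K)"
proof -
  obtain A where A: "subgroup A GP" "finite A" "A \<subseteq> carrier GP" "P = subgroup_conj_class GP A"
    using assms by (rule GP.CF_E)
  then show ?thesis using finite_subgroup_conj_clique[OF A(1,2)] GP.CF_le_iff[OF A(3) par_subset]
    unfolding cc_def by blast
qed

lemma CF_le_Int:
  assumes P: "P \<in> CF GP" and S: "CF_le GP P (cc S)" and T: "CF_le GP P (cc T)"
  shows "CF_le GP P (cc (S \<inter> T))"
proof -
  obtain A where A: "A \<subseteq> carrier GP" "P = subgroup_conj_class GP A" using P by (rule GP.CF_E)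
  obtain g where g: "g \<in> carrier GP" "conj_set GP g A \<subseteq> par S"
    using S A GP.CF_le_iff[OF A(1) par_subset] unfolding cc_def by blast
  obtain h where h: "h \<in> carrier GP" "conj_set GP h A \<subseteq> par T"
    using T A GP.CF_le_iff[OF A(1) par_subset] unfolding cc_def by blast
  \<comment> \<open>The subgroup inside \<open>par S\<close> is the conjugate of \<open>A\<close> by
    \<open>g\<close>, so the conjugator into \<open>par T\<close> has to be rebased to
    \<open>h g^-1\<close>.\<close>
  have "conj_set GP (h \<otimes>\<^bsub>GP\<^esub> inv\<^bsub>GP\<^esub> g) (conj_set GP g A) = conj_set GP h A"
    using g h A by (simp add: GP.conj_set_conj_set GP.m_assoc)
  then obtain k where k: "k \<in> carrier GP" "conj_set GP k (conj_set GP g A) \<subseteq> par (S \<inter> T)"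
    using conj_into_Int[OF g(2), of "h \<otimes>\<^bsub>GP\<^esub> inv\<^bsub>GP\<^esub> g" T] g h by auto
  then have "conj_set GP (k \<otimes>\<^bsub>GP\<^esub> g) A \<subseteq> par (S \<inter> T)" using g A by (simp add: GP.conj_set_conj_set)
  then show ?thesis using A GP.CF_le_iff[OF A(1) par_subset] GP.m_closed[OF k(1) g(1)]
    unfolding cc_def by blast
qed

lemma CF_le_Inter:
  assumes "finite \<K>" "\<K> \<noteq> {}" "P \<in> CF GP" "\<And>K. K \<in> \<K> \<Longrightarrow> CF_le GP P (cc K)"
  shows "CF_le GP P (cc (\<Inter>\<K>))"
  using assms
proof (induction \<K> rule: finite_ne_induct)
  case (insert K \<K>)
  then show ?case using CF_le_Int[of P K "\<Inter>\<K>"] by simp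
qed simp

lemma max_cliques_clique: "K \<in> max_cliques \<Longrightarrow> clique K"
  by (simp add: max_cliques_def)

lemma finite_cliques: "finite {K. clique K}"
proof (rule finite_subset)
  show "{K. clique K} \<subseteq> Pow V" unfolding clique_def by blast
qed (simp add: finite_V)

lemma finite_max_cliques: "finite max_cliques"
  by (rule finite_subset[OF _ finite_cliques]) (simp add: max_cliques_def Collect_mono)

lemma clique_extend: "clique K \<Longrightarrow> \<exists>M\<in>max_cliques. K \<subseteq> M"
proof -
  assume "clique K"
  then obtain M where "clique M" "K \<subseteq> M" "\<And>L. clique L \<Longrightarrow> M \<subseteq> L \<Longrightarrow> M = L"
    using finite_has_maximal2[OF finite_cliques, of K] by auto
  then show ?thesis unfolding max_cliques_def by blast
qed

text \<open>Adjacency is visible in the family of maximal cliques alone, so a vertex bijection that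
  respects membership in maximal cliques is a graph isomorphism. Distinctness is separate, as a
  vertex shares a maximal clique with itself.\<close>

lemma adj_iff: "E v w \<longleftrightarrow> v \<in> V \<and> w \<in> V \<and> v \<noteq> w \<and> (\<exists>K\<in>max_cliques. v \<in> K \<and> w \<in> K)"
proof
  assume vw: "E v w"
  then have "clique {v, w}" using adj_in adj_sym unfolding clique_def by blast
  then obtain K where "K \<in> max_cliques" "{v, w} \<subseteq> K" using clique_extend by blast
  then show "v \<in> V \<and> w \<in> V \<and> v \<noteq> w \<and> (\<exists>K\<in>max_cliques. v \<in> K \<and> w \<in> K)"
    using vw adj_in adj_irrefl by blast
next
  assume "v \<in> V \<and> w \<in> V \<and> v \<noteq> w \<and> (\<exists>K\<in>max_cliques. v \<in> K \<and> w \<in> K)"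
  then show "E v w" using max_cliques_clique unfolding clique_def by blast
qed

text \<open>Every class lies below some \<open>cc L\<close>, so maximality among all classes reduces
  to maximality among cliques, where the order is inclusion.\<close>

lemma cc_max: "bij_betw cc max_cliques max_CF"
proof (rule bij_betw_imageI)
  show "inj_on cc max_cliques" using cc_inj by (rule inj_on_subset) (auto simp: max_cliques_def)
  show "cc ` max_cliques = max_CF"
  proof (intro equalityI subsetI)
    fix P assume "P \<in> cc ` max_cliques"
    then obtain K where K: "K \<in> max_cliques" "P = cc K" by blast
    have cK: "clique K" using K max_cliques_clique by blast
    have "P = Q" if Q: "Q \<in> CF GP" "CF_le GP P Q" for Q
    proof -
      obtain L where L: "clique L" "CF_le GP Q (cc L)" using CF_le_clique[OF Q(1)] by blast
      have "CF_le GP P (cc L)"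
        using GP.CF_le_trans[OF _ Q(1) cc_CF[OF L(1)] Q(2) L(2)] cc_CF[OF cK] K by simp
      then have "K = L" using K cc_le_iff[OF cK] L(1) unfolding max_cliques_def by blast
      then show "P = Q" using GP.CF_le_antisym[OF _ Q(1) Q(2)] cc_CF[OF cK] K L by simp
    qed
    then show "P \<in> max_CF" using cc_CF[OF cK] K unfolding max_CF_def by blast
  next
    fix P assume P: "P \<in> max_CF"
    then have PC: "P \<in> CF GP" by (simp add: max_CF_def)
    obtain K where K: "clique K" "CF_le GP P (cc K)" using CF_le_clique[OF PC] by blast
    then have PK: "P = cc K" using P cc_CF[OF K(1)] unfolding max_CF_def by blast
    have "K = L" if L: "clique L" "K \<subseteq> L" for L
    proof -
      have "CF_le GP P (cc L)" using PK cc_le_iff[OF K(1)] L by simp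
      then have "cc K = cc L" using P PK cc_CF[OF L(1)] unfolding max_CF_def by blast
      then show "K = L" using cc_inj K(1) L(1) by (auto dest: inj_onD)
    qed
    then show "P \<in> cc ` max_cliques" using K PK unfolding max_cliques_def by blast
  qed
qed

end

section \<open>Reconstruction of the graph\<close>

text \<open>To be used with the label consisting of the maximal cliques through a vertex and the
  isomorphism type of its group: equal counts suffice, and the bijection is arbitrary on each
  fibre.\<close>

lemma bij_betw_of_fibres:
  assumes "finite V" "finite W" "\<And>t. card {v \<in> V. l v = t} = card {w \<in> W. l' w = t}"
  shows "\<exists>f. bij_betw f V W \<and> (\<forall>v\<in>V. l' (f v) = l v)"
proof -
  have "\<exists>f. bij_betw f {v \<in> V. l v = t} {w \<in> W. l' w = t}" for t
    using assms by (intro finite_same_card_bij) auto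
  then obtain F where F: "\<And>t. bij_betw (F t) {v \<in> V. l v = t} {w \<in> W. l' w = t}" by metis
  define f where "f v = F (l v) v" for v
  have f: "f v \<in> W" "l' (f v) = l v" if "v \<in> V" for v
    using bij_betwE[OF F[of "l v"]] that unfolding f_def by auto
  have "inj_on f V"
  proof (rule inj_onI)
    fix v v' assume v: "v \<in> V" "v' \<in> V" "f v = f v'"
    then have "l v = l v'" using f by metis
    then show "v = v'" using v bij_betw_imp_inj_on[OF F[of "l v"]] unfolding f_def by (auto dest: inj_onD)
  qed
  moreover have "W \<subseteq> f ` V"
  proof
    fix w assume "w \<in> W"
    then have "w \<in> F (l' w) ` {v \<in> V. l v = l' w}" using bij_betw_imp_surj_on[OF F[of "l' w"]] by auto
    then obtain v where "v \<in> V" "l v = l' w" "w = F (l' w) v" by blast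
    then show "w \<in> f ` V" unfolding f_def by (intro image_eqI[of _ _ v]) simp_all
  qed
  ultimately have "bij_betw f V W" using f(1) unfolding bij_betw_def by blast
  then show ?thesis using f(2) by blast
qed

text \<open>Sorting the vertices by the exact value of \<open>mem\<close> gives a system that is
  triangular with respect to inclusion and hence can be inverted.\<close>

lemma card_superset_fibres:
  assumes "finite M" "finite V" "\<And>v. v \<in> V \<Longrightarrow> mem v \<subseteq> M"
  shows "card {v \<in> V. J \<subseteq> mem v \<and> P v} = (\<Sum>L | J \<subseteq> L \<and> L \<subseteq> M. card {v \<in> V. mem v = L \<and> P v})"
proof -
  have "{v \<in> V. J \<subseteq> mem v \<and> P v} = (\<Union>L\<in>{L. J \<subseteq> L \<and> L \<subseteq> M}. {v \<in> V. mem v = L \<and> P v})"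
    using assms(3) by blast
  moreover have "finite {L. J \<subseteq> L \<and> L \<subseteq> M}" using assms(1) by (auto intro: finite_subset[of _ "Pow M"])
  ultimately show ?thesis using assms(2) by (simp add: card_UN_disjoint disjoint_iff)
qed

text \<open>Moebius inversion over the sets \<open>mem v\<close>, by downward induction on \<open>J\<close>.\<close>

lemma card_fibres_eq:
  assumes M: "finite M" and fin: "finite V" "finite W"
    and mem: "\<And>v. v \<in> V \<Longrightarrow> mem v \<subseteq> M" "\<And>w. w \<in> W \<Longrightarrow> mem' w \<subseteq> M"
    and eq: "\<And>J. J \<subseteq> M \<Longrightarrow> J \<noteq> {} \<Longrightarrow> card {v \<in> V. J \<subseteq> mem v \<and> P v} = card {w \<in> W. J \<subseteq> mem' w \<and> Q w}"
    and J: "J \<subseteq> M" "J \<noteq> {}"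
  shows "card {v \<in> V. mem v = J \<and> P v} = card {w \<in> W. mem' w = J \<and> Q w}"
  using J
proof (induction "card (M - J)" arbitrary: J rule: less_induct)
  case less
  let ?U = "{L. J \<subseteq> L \<and> L \<subseteq> M}"
  have U: "finite ?U" "J \<in> ?U" using less M by (auto intro: finite_subset[of _ "Pow M"])
  have "card {v \<in> V. mem v = L \<and> P v} = card {w \<in> W. mem' w = L \<and> Q w}" if "L \<in> ?U - {J}" for L
  proof (rule less.hyps)
    show "card (M - L) < card (M - J)" using that M by (intro psubset_card_mono) auto
  qed (use that less.prems in auto)
  then have "(\<Sum>L\<in>?U - {J}. card {v \<in> V. mem v = L \<and> P v}) = (\<Sum>L\<in>?U - {J}. card {w \<in> W. mem' w = L \<and> Q w})"
    by (rule sum.cong[OF refl])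
  moreover have "(\<Sum>L\<in>?U. card {v \<in> V. mem v = L \<and> P v}) = (\<Sum>L\<in>?U. card {w \<in> W. mem' w = L \<and> Q w})"
    using eq[OF less.prems] card_superset_fibres[OF M fin(1) mem(1)] card_superset_fibres[OF M fin(2) mem(2)]
    by simp
  \<comment> \<open>The terms for \<open>L\<close> strictly above \<open>J\<close> agree by
    induction and cancel from the sums, leaving the terms at \<open>J\<close>.\<close>
  ultimately show ?case
    using sum.remove[OF U, of "\<lambda>L. card {v \<in> V. mem v = L \<and> P v}"]
      sum.remove[OF U, of "\<lambda>L. card {w \<in> W. mem' w = L \<and> Q w}"] by simp
qed

section \<open>Isomorphism types as labels\<close>

text \<open>The vertex groups of the two graphs live on different types; copies on
  \<open>nat\<close> provide labels of one type. A finite group has such a copy, so its label is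
  non-empty and determines it up to isomorphism.\<close>

definition iso_type :: "('a, 'c) monoid_scheme \<Rightarrow> nat monoid set" where
  "iso_type A = {K. A \<cong> K}"

lemma iso_type_eq_iff:
  assumes A: "group A" "finite (carrier A)" and B: "group B"
  shows "iso_type A = iso_type B \<longleftrightarrow> A \<cong> B"
proof
  assume AB: "A \<cong> B"
  note BA = group.iso_sym[OF A(1) AB]
  show "iso_type A = iso_type B"
    unfolding iso_type_def
  proof (intro Collect_cong iffI)
    fix K :: "nat monoid"
    show "B \<cong> K" if "A \<cong> K" using BA that by (rule iso_trans)
    show "A \<cong> K" if "B \<cong> K" using AB that by (rule iso_trans)
  qed
next
  assume eq: "iso_type A = iso_type B"
  interpret A: group A by fact
  obtain f :: "'a \<Rightarrow> nat" where f: "inj_on f (carrier A)"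
    using finite_imp_inj_to_nat_seg[OF A(2)] by blast
  let ?i = "inv_into (carrier A) f"
  let ?K = "\<lparr>carrier = f ` carrier A, monoid.mult = \<lambda>a b. f (?i a \<otimes>\<^bsub>A\<^esub> ?i b), one = f \<one>\<^bsub>A\<^esub>\<rparr> :: nat monoid"
  have "f \<in> iso A ?K" using f by (auto simp: iso_def hom_def bij_betw_def)
  then have K: "A \<cong> ?K" by (rule is_isoI)
  then have "?K \<in> iso_type A" unfolding iso_type_def by (rule CollectI)
  then have "B \<cong> ?K" unfolding eq unfolding iso_type_def by (rule CollectD)
  then have "?K \<cong> B" by (rule group.iso_sym[OF B])
  with K show "A \<cong> B" by (rule iso_trans)
qed

context finite_graph_prod
begin

lemma factor_iso_vertex:
  assumes K: "clique K" and i: "i \<in> K"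
  shows "G i \<cong> (GP\<lparr>carrier := par K\<rparr>)\<lparr>carrier := ret {i} ` carrier (GP\<lparr>carrier := par K\<rparr>)\<rparr>"
    and "directly_indecomposable ((GP\<lparr>carrier := par K\<rparr>)\<lparr>carrier := ret {i} ` carrier (GP\<lparr>carrier := par K\<rparr>)\<rparr>)"
proof -
  have V: "i \<in> V" using K i unfolding clique_def by blast
  have eq: "(GP\<lparr>carrier := par K\<rparr>)\<lparr>carrier := ret {i} ` carrier (GP\<lparr>carrier := par K\<rparr>)\<rparr> = GP\<lparr>carrier := par {i}\<rparr>"
    using ret_par_subset[of "{i}" K] i by simp
  show "G i \<cong> (GP\<lparr>carrier := par K\<rparr>)\<lparr>carrier := ret {i} ` carrier (GP\<lparr>carrier := par K\<rparr>)\<rparr>"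
    unfolding eq using vertex_iso[OF V] .
  show "directly_indecomposable ((GP\<lparr>carrier := par K\<rparr>)\<lparr>carrier := ret {i} ` carrier (GP\<lparr>carrier := par K\<rparr>)\<rparr>)"
    unfolding eq
    by (rule directly_indecomposable_iso[OF vgroup[OF V] par_group vertex_iso[OF V] indec_vertex[OF V]])
qed

end

text \<open>The direct factors of \<open>par K\<close> and \<open>par L\<close> are copies of the
  vertex groups, and Krull-Schmidt matches them. Which factors are matched is a matter of choice, so
  only the number of each type is retained.\<close>

lemma clique_iso_types:
  assumes "finite_graph_prod V E G" "finite_graph_prod W F H"
    and K: "graph_prod.clique V E K" and L: "graph_prod.clique W F L"
    and iso: "(graph_product V E G)\<lparr>carrier := graph_prod.par V E G K\<rparr>
      \<cong> (graph_product W F H)\<lparr>carrier := graph_prod.par W F H L\<rparr>"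
  shows "card {v \<in> K. iso_type (G v) = t} = card {w \<in> L. iso_type (H w) = t}"
proof -
  interpret a: finite_graph_prod V E G by fact
  interpret b: finite_graph_prod W F H by fact
  have KV: "v \<in> V" if "v \<in> K" for v using K that unfolding a.clique_def by blast
  have LW: "w \<in> W" if "w \<in> L" for w using L that unfolding b.clique_def by blast
  have "finite (carrier (a.GP\<lparr>carrier := a.par K\<rparr>))" using a.finite_par[OF K a.fin_vertex] KV by simp
  from krull_schmidt[OF a.par_decomposition[OF K] b.par_decomposition[OF L] this iso
      a.factor_iso_vertex(2)[OF K] b.factor_iso_vertex(2)[OF L]]
  obtain f where f: "bij_betw f K L" and fi: "\<And>i. i \<in> K \<Longrightarrow>
    (a.GP\<lparr>carrier := a.par K\<rparr>)\<lparr>carrier := a.ret {i} ` carrier (a.GP\<lparr>carrier := a.par K\<rparr>)\<rparr> \<cong>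
    (b.GP\<lparr>carrier := b.par L\<rparr>)\<lparr>carrier := b.ret {f i} ` carrier (b.GP\<lparr>carrier := b.par L\<rparr>)\<rparr>"
    by blast
  have t: "iso_type (G i) = iso_type (H (f i))" if i: "i \<in> K" for i
  proof -
    have fL: "f i \<in> L" using f i bij_betwE by blast
    have "G i \<cong> H (f i)"
      using iso_trans[OF a.factor_iso_vertex(1)[OF K i] iso_trans[OF fi[OF i]
        group.iso_sym[OF b.vgroup[OF LW[OF fL]] b.factor_iso_vertex(1)[OF L fL]]]] .
    then show ?thesis using iso_type_eq_iff[OF a.vgroup[OF KV[OF i]] a.fin_vertex[OF KV[OF i]] b.vgroup[OF LW[OF fL]]]
      by simp
  qed
  have "bij_betw f {v \<in> K. iso_type (G v) = t} {w \<in> L. iso_type (H w) = t}"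
    using f t unfolding bij_betw_def by (auto simp: inj_on_def)
  then show ?thesis by (rule bij_betw_same_card)
qed

lemma CF_iso_imp_labelled_graph_iso:
  assumes "finite_graph_prod V E G" "finite_graph_prod W F H"
    and \<psi>: "bij_betw \<psi> (CF (graph_product V E G)) (CF (graph_product W F H))"
    and le: "\<And>P Q. P \<in> CF (graph_product V E G) \<Longrightarrow> Q \<in> CF (graph_product V E G) \<Longrightarrow>
      CF_le (graph_product V E G) P Q \<longleftrightarrow> CF_le (graph_product W F H) (\<psi> P) (\<psi> Q)"
    and iso: "\<And>P A B. P \<in> CF (graph_product V E G) \<Longrightarrow> A \<in> P \<Longrightarrow> B \<in> \<psi> P \<Longrightarrow>
      (graph_product V E G)\<lparr>carrier := A\<rparr> \<cong> (graph_product W F H)\<lparr>carrier := B\<rparr>"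
  shows "labelled_graph_iso V E G W F H"
proof -
  interpret a: finite_graph_prod V E G by fact
  interpret b: finite_graph_prod W F H by fact
  have inj: "inj_on \<psi> (CF a.GP)" and surj: "\<psi> ` CF a.GP = CF b.GP"
    using \<psi> by (simp_all add: bij_betw_def)
  have max: "\<psi> P \<in> b.max_CF \<longleftrightarrow> P \<in> a.max_CF" if P: "P \<in> CF a.GP" for P
  proof -
    have "(\<forall>Q\<in>CF b.GP. CF_le b.GP (\<psi> P) Q \<longrightarrow> \<psi> P = Q) \<longleftrightarrow> (\<forall>Q\<in>CF a.GP. CF_le b.GP (\<psi> P) (\<psi> Q) \<longrightarrow> \<psi> P = \<psi> Q)"
      unfolding surj[symmetric] by (rule ball_simps)
    also have "\<dots> \<longleftrightarrow> (\<forall>Q\<in>CF a.GP. CF_le a.GP P Q \<longrightarrow> P = Q)"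
      using le[OF P] inj_on_eq_iff[OF inj P] by simp
    finally have "(\<forall>Q\<in>CF b.GP. CF_le b.GP (\<psi> P) Q \<longrightarrow> \<psi> P = Q) \<longleftrightarrow> (\<forall>Q\<in>CF a.GP. CF_le a.GP P Q \<longrightarrow> P = Q)" .
    moreover have "\<psi> P \<in> CF b.GP" using P unfolding surj[symmetric] by (rule imageI)
    ultimately show ?thesis using P by (simp only: a.max_CF_def b.max_CF_def mem_Collect_eq simp_thms)
  qed
  have "\<psi> ` a.max_CF = b.max_CF"
  proof
    show "\<psi> ` a.max_CF \<subseteq> b.max_CF" using max unfolding a.max_CF_def by blast
    show "b.max_CF \<subseteq> \<psi> ` a.max_CF"
    proof
      fix Q assume Q: "Q \<in> b.max_CF"
      then have "Q \<in> \<psi> ` CF a.GP" unfolding surj by (simp add: b.max_CF_def)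
      then obtain P where "P \<in> CF a.GP" "Q = \<psi> P" by blast
      then show "Q \<in> \<psi> ` a.max_CF" using Q max by blast
    qed
  qed
  moreover have "a.max_CF \<subseteq> CF a.GP" unfolding a.max_CF_def by (rule Collect_restrict)
  ultimately have \<psi>max: "bij_betw \<psi> a.max_CF b.max_CF"
    using inj_on_subset[OF inj] by (intro bij_betw_imageI)
  \<comment> \<open>The bijection of maximal cliques induced by \<open>\<psi>\<close>, through the
    correspondence of maximal cliques with maximal classes.\<close>
  define \<theta> where "\<theta> K = inv_into b.max_cliques b.cc (\<psi> (a.cc K))" for K
  have \<theta>: "bij_betw \<theta> a.max_cliques b.max_cliques"
    using bij_betw_trans[OF bij_betw_trans[OF a.cc_max \<psi>max] bij_betw_inv_into[OF b.cc_max]]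
    unfolding \<theta>_def comp_def .
  have \<theta>max: "\<theta> K \<in> b.max_cliques" if "K \<in> a.max_cliques" for K
    by (rule bij_betw_apply[OF \<theta> that])
  have \<theta>cc: "b.cc (\<theta> K) = \<psi> (a.cc K)" if "K \<in> a.max_cliques" for K
  proof -
    have "\<psi> (a.cc K) \<in> b.max_CF" 
      by (rule bij_betw_apply[OF \<psi>max bij_betw_apply[OF a.cc_max that]])
    then have "\<psi> (a.cc K) \<in> b.cc ` b.max_cliques" using bij_betw_imp_surj_on[OF b.cc_max] by simp
    then show ?thesis unfolding \<theta>_def by (rule f_inv_into_f)
  qed
  have clq: "a.clique K" "b.clique (\<theta> K)" "a.cc K \<in> CF a.GP" if "K \<in> a.max_cliques" for K
    using a.max_cliques_clique[OF that] b.max_cliques_clique[OF \<theta>max[OF that]]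
      a.cc_CF[OF a.max_cliques_clique[OF that]] by simp_all
  \<comment> \<open>On either side the class of the intersection is the meet of the classes of the
    cliques, and an order isomorphism preserves meets. The family is non-empty so that its
    intersection is a clique.\<close>
  have key: "card {v \<in> \<Inter>\<K>. iso_type (G v) = t} = card {w \<in> \<Inter>(\<theta> ` \<K>). iso_type (H w) = t}"
    if \<K>: "\<K> \<subseteq> a.max_cliques" "\<K> \<noteq> {}" for \<K> t
  proof -
    let ?K = "\<Inter>\<K>" and ?L = "\<Inter>(\<theta> ` \<K>)"
    have fin: "finite \<K>" using \<K>(1) a.finite_max_cliques finite_subset by blast
    obtain K1 where K1: "K1 \<in> \<K>" using \<K>(2) by blast
    have cK: "a.clique ?K" using a.clique_subset[OF clq(1)] K1 \<K>(1) by blast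
    have cL: "b.clique ?L" using b.clique_subset[OF clq(2)] K1 \<K>(1) by blast
    have KC: "a.cc ?K \<in> CF a.GP" and LC: "b.cc ?L \<in> CF b.GP" using a.cc_CF[OF cK] b.cc_CF[OF cL] by auto
    have \<psi>K: "\<psi> (a.cc ?K) \<in> CF b.GP" using KC unfolding surj[symmetric] by (rule imageI)
    have 1: "CF_le b.GP (\<psi> (a.cc ?K)) (b.cc ?L)"
    proof (rule b.CF_le_Inter)
      fix L assume "L \<in> \<theta> ` \<K>"
      then obtain K where K: "K \<in> \<K>" "L = \<theta> K" by blast
      have "CF_le a.GP (a.cc ?K) (a.cc K)" using a.cc_le_iff[OF cK] K by blast
      then show "CF_le b.GP (\<psi> (a.cc ?K)) (b.cc L)" using le[OF KC clq(3)] \<theta>cc K \<K>(1) by auto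
    qed (use fin \<K> \<psi>K in auto)
    \<comment> \<open>Since \<open>\<psi>\<close> is onto, the meet on the second side can be pulled
      back and compared with the meet on the first.\<close>
    obtain Q where Q: "Q \<in> CF a.GP" "b.cc ?L = \<psi> Q"
      using LC unfolding surj[symmetric] by blast
    have "CF_le a.GP Q (a.cc ?K)"
    proof (rule a.CF_le_Inter[OF fin \<K>(2) Q(1)])
      fix K assume K: "K \<in> \<K>"
      have "CF_le b.GP (b.cc ?L) (b.cc (\<theta> K))" using b.cc_le_iff[OF cL] K by blast
      then show "CF_le a.GP Q (a.cc K)" using le[OF Q(1) clq(3)] \<theta>cc K \<K>(1) Q(2) by auto
    qed
    then have "CF_le b.GP (b.cc ?L) (\<psi> (a.cc ?K))" using le[OF Q(1) KC] Q(2) by simp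
    then have "\<psi> (a.cc ?K) = b.cc ?L" by (rule b.GP.CF_le_antisym[OF \<psi>K LC 1])
    then have "a.GP\<lparr>carrier := a.par ?K\<rparr> \<cong> b.GP\<lparr>carrier := b.par ?L\<rparr>"
      using iso[OF KC a.par_cc] b.par_cc by simp
    then show ?thesis by (rule clique_iso_types[OF assms(1,2) cK cL])
  qed
  define mem where "mem v = {K \<in> a.max_cliques. v \<in> K}" for v
  \<comment> \<open>Cliques of the second graph are named by their preimages under
    \<open>\<theta>\<close>, so that the labels of both graphs are sets of cliques of the
    first.\<close>
  define mem' where "mem' w = {K \<in> a.max_cliques. w \<in> \<theta> K}" for w
  have mem_sub: "mem v \<subseteq> a.max_cliques" "mem' w \<subseteq> a.max_cliques" for v w
    by (auto simp: mem_def mem'_def)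
  have \<theta>surj: "\<exists>K\<in>a.max_cliques. L = \<theta> K" if "L \<in> b.max_cliques" for L
    using that bij_betw_imp_surj_on[OF \<theta>] by blast
  \<comment> \<open>Excludes the empty label, the one value of \<open>J\<close> to which the counts
    in \<open>key\<close> do not extend.\<close>
  have mem_ne: "mem v \<noteq> {}" if "v \<in> V" for v
  proof -
    have "a.clique {v}" using that by (simp add: a.clique_def)
    then obtain K where "K \<in> a.max_cliques" "{v} \<subseteq> K" using a.clique_extend by blast
    then show ?thesis unfolding mem_def by blast
  qed
  have mem'_ne: "mem' w \<noteq> {}" if "w \<in> W" for w
  proof -
    have "b.clique {w}" using that by (simp add: b.clique_def)
    then obtain L where "L \<in> b.max_cliques" "{w} \<subseteq> L" using b.clique_extend by blast
    then show ?thesis using \<theta>surj unfolding mem'_def by blast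
  qed
  have upper: "card {v \<in> V. J \<subseteq> mem v \<and> iso_type (G v) = t} = card {w \<in> W. J \<subseteq> mem' w \<and> iso_type (H w) = t}"
    if J: "J \<subseteq> a.max_cliques" "J \<noteq> {}" for J t
  proof -
    have "{v \<in> V. J \<subseteq> mem v \<and> iso_type (G v) = t} = {v \<in> \<Inter>J. iso_type (G v) = t}"
      using J clq(1) unfolding mem_def a.clique_def by blast
    moreover have "{w \<in> W. J \<subseteq> mem' w \<and> iso_type (H w) = t} = {w \<in> \<Inter>(\<theta> ` J). iso_type (H w) = t}"
      using J clq(2) unfolding mem'_def b.clique_def by blast
    ultimately show ?thesis using key[OF J] by simp
  qed
  have "card {v \<in> V. (mem v, iso_type (G v)) = jt} = card {w \<in> W. (mem' w, iso_type (H w)) = jt}" for jt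
  proof -
    obtain J t where jt: "jt = (J, t)" by fastforce
    have "card {v \<in> V. mem v = J \<and> iso_type (G v) = t} = card {w \<in> W. mem' w = J \<and> iso_type (H w) = t}"
    proof (cases "J \<subseteq> a.max_cliques \<and> J \<noteq> {}")
      case True
      show ?thesis
        by (rule card_fibres_eq[OF a.finite_max_cliques a.finite_V b.finite_V mem_sub(1) mem_sub(2) upper])
          (use True in auto)
    next
      case False
      then have "mem v \<noteq> J" if "v \<in> V" for v using mem_sub(1) mem_ne[OF that] by blast
      moreover have "mem' w \<noteq> J" if "w \<in> W" for w using False mem_sub(2) mem'_ne[OF that] by blast
      ultimately have "{v \<in> V. mem v = J \<and> iso_type (G v) = t} = {}"
        "{w \<in> W. mem' w = J \<and> iso_type (H w) = t} = {}" by blast+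
      then show ?thesis by (simp only: card.empty)
    qed
    then show ?thesis unfolding jt by simp
  qed
  from bij_betw_of_fibres[OF a.finite_V b.finite_V this]
  obtain f where f: "bij_betw f V W"
    and fl: "\<And>v. v \<in> V \<Longrightarrow> mem' (f v) = mem v \<and> iso_type (H (f v)) = iso_type (G v)" by auto
  have fW: "f v \<in> W" if "v \<in> V" for v using bij_betw_apply[OF f that] .
  have "E v v' \<longleftrightarrow> F (f v) (f v')" if v: "v \<in> V" "v' \<in> V" for v v'
  proof -
    \<comment> \<open>By \<open>adj_iff\<close> adjacency means being distinct with intersecting
      sets \<open>mem\<close>, and \<open>f\<close> respects both conditions.\<close>
    have "f v = f v' \<longleftrightarrow> v = v'" using f v by (meson bij_betw_imp_inj_on inj_on_eq_iff)
    moreover have "(\<exists>L\<in>b.max_cliques. f v \<in> L \<and> f v' \<in> L) \<longleftrightarrow> mem' (f v) \<inter> mem' (f v') \<noteq> {}"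
      using \<theta>surj \<theta>max unfolding mem'_def by blast
    moreover have "(\<exists>K\<in>a.max_cliques. v \<in> K \<and> v' \<in> K) \<longleftrightarrow> mem v \<inter> mem v' \<noteq> {}"
      unfolding mem_def by blast
    ultimately show ?thesis
      using fl[OF v(1)] fl[OF v(2)] v fW unfolding a.adj_iff[of v v'] b.adj_iff[of "f v" "f v'"] by simp
  qed
  moreover have "G v \<cong> H (f v)" if v: "v \<in> V" for v
    using iso_type_eq_iff[OF a.vgroup[OF v] a.fin_vertex[OF v] b.vgroup[OF fW[OF v]]] fl[OF v] by simp
  ultimately show ?thesis using f unfolding labelled_graph_iso_def by blast
qed

section \<open>From labelled graph isomorphisms to group isomorphisms\<close>

text \<open>Functoriality of the graph product. Recording the values on generators is enough,
  because \<open>hom_ext\<close> compares homomorphisms there.\<close>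

lemma graph_map_hom:
  assumes "graph_prod V E G" "graph_prod W F H"
    and f: "\<And>v. v \<in> V \<Longrightarrow> f v \<in> W" "\<And>v v'. E v v' \<Longrightarrow> F (f v) (f v')"
    and i: "\<And>v. v \<in> V \<Longrightarrow> i v \<in> hom (G v) (H (f v))"
  shows "\<exists>\<Phi>\<in>hom (graph_product V E G) (graph_product W F H).
    \<forall>v\<in>V. \<forall>g\<in>carrier (G v). \<Phi> (graph_prod.gen V E G v g) = graph_prod.gen W F H (f v) (i v g)"
proof -
  interpret a: graph_prod V E G by fact
  interpret b: graph_prod W F H by fact
  let ?\<phi> = "\<lambda>v g. b.gen (f v) (i v g)"
  have ic: "i v g \<in> carrier (H (f v))" if "v \<in> V" "g \<in> carrier (G v)" for v g
    using i that by (auto simp: hom_def)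
  have 1: "?\<phi> v \<in> hom (G v) b.GP" if "v \<in> V" for v
    using hom_compose[OF i[OF that] b.gen_hom[OF f(1)[OF that]]] by (simp add: comp_def)
  have 2: "?\<phi> v g \<otimes>\<^bsub>b.GP\<^esub> ?\<phi> w h = ?\<phi> w h \<otimes>\<^bsub>b.GP\<^esub> ?\<phi> v g"
    if "E v w" "g \<in> carrier (G v)" "h \<in> carrier (G w)" for v w g h
    by (rule b.gen_commute[OF f(2)[OF that(1)]]) (use ic that a.adj_in[OF that(1)] in auto)
  show ?thesis
  proof (intro bexI ballI)
    show "a.lift b.GP ?\<phi> \<in> hom a.GP b.GP"
      by (rule a.lift_hom(1)[where \<phi> = ?\<phi>, OF b.GP.is_group 1 2])
    show "a.lift b.GP ?\<phi> (a.gen v g) = ?\<phi> v g" if "v \<in> V" "g \<in> carrier (G v)" for v g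
      by (rule a.lift_hom(2)[where \<phi> = ?\<phi>, OF b.GP.is_group 1 2 that])
  qed
qed

lemma labelled_graph_iso_imp_iso:
  assumes "graph_prod V E G" "graph_prod W F H" "labelled_graph_iso V E G W F H"
  shows "graph_product V E G \<cong> graph_product W F H"
proof -
  interpret a: graph_prod V E G by fact
  interpret b: graph_prod W F H by fact
  obtain f where f: "bij_betw f V W" "\<And>v v'. v \<in> V \<Longrightarrow> v' \<in> V \<Longrightarrow> E v v' \<longleftrightarrow> F (f v) (f v')"
    and "\<And>v. v \<in> V \<Longrightarrow> G v \<cong> H (f v)"
    using assms(3) unfolding labelled_graph_iso_def by blast
  then have "\<forall>v. \<exists>i. v \<in> V \<longrightarrow> i \<in> iso (G v) (H (f v))" unfolding is_iso_def by blast
  then obtain i where i: "\<And>v. v \<in> V \<Longrightarrow> i v \<in> iso (G v) (H (f v))" by metis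
  define f' where "f' = inv_into V f"
  \<comment> \<open>The inverse of the isomorphism at the preimage vertex \<open>f' w\<close>; it
    starts at \<open>H w\<close> because \<open>f (f' w) = w\<close>.\<close>
  define i' where "i' w = inv_into (carrier (G (f' w))) (i (f' w))" for w
  have f': "f' w \<in> V" "f (f' w) = w" if "w \<in> W" for w
    using that bij_betw_imp_surj_on[OF f(1)] unfolding f'_def by (auto simp: inv_into_into f_inv_into_f)
  have f'f: "f' (f v) = v" if "v \<in> V" for v
    unfolding f'_def using that bij_betw_imp_inj_on[OF f(1)] by simp
  have fW: "f v \<in> W" if "v \<in> V" for v using bij_betw_apply[OF f(1) that] .
  have i': "i' w \<in> iso (H w) (G (f' w))" if "w \<in> W" for w
    using group.iso_set_sym[OF a.vgroup i, of "f' w"] f'[OF that] unfolding i'_def by simp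
  have ii': "i (f' w) (i' w h) = h" if "w \<in> W" "h \<in> carrier (H w)" for w h
    using i[of "f' w"] f'[OF that(1)] that(2) unfolding i'_def iso_def bij_betw_def
    by (auto simp: f_inv_into_f)
  have i'i: "i' (f v) (i v g) = g" if "v \<in> V" "g \<in> carrier (G v)" for v g
    using i[OF that(1)] f'f[OF that(1)] that(2) unfolding i'_def iso_def bij_betw_def by simp
  have ic: "i v g \<in> carrier (H (f v))" if "v \<in> V" "g \<in> carrier (G v)" for v g
    using i[OF that(1)] that(2) by (auto simp: iso_def hom_def)
  have ic': "i' w h \<in> carrier (G (f' w))" if "w \<in> W" "h \<in> carrier (H w)" for w h
    using i'[OF that(1)] that(2) by (auto simp: iso_def hom_def)
  have "\<exists>\<Phi>\<in>hom a.GP b.GP. \<forall>v\<in>V. \<forall>g\<in>carrier (G v). \<Phi> (a.gen v g) = b.gen (f v) (i v g)"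
  proof (rule graph_map_hom[OF assms(1,2)])
    show "F (f v) (f v')" if "E v v'" for v v' using that a.adj_in[OF that] f(2) by simp
    show "i v \<in> hom (G v) (H (f v))" if "v \<in> V" for v using i[OF that] by (simp add: iso_def)
  qed (rule fW)
  then obtain \<Phi> where \<Phi>: "\<Phi> \<in> hom a.GP b.GP"
    "\<And>v g. v \<in> V \<Longrightarrow> g \<in> carrier (G v) \<Longrightarrow> \<Phi> (a.gen v g) = b.gen (f v) (i v g)" by blast
  have "\<exists>\<Psi>\<in>hom b.GP a.GP. \<forall>w\<in>W. \<forall>h\<in>carrier (H w). \<Psi> (b.gen w h) = a.gen (f' w) (i' w h)"
  proof (rule graph_map_hom[OF assms(2,1)])
    show "E (f' w) (f' w')" if "F w w'" for w w'
      using that b.adj_in[OF that] f' f(2)[of "f' w" "f' w'"] by simp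
    show "i' w \<in> hom (H w) (G (f' w))" if "w \<in> W" for w using i'[OF that] by (simp add: iso_def)
  qed (rule f'(1))
  then obtain \<Psi> where \<Psi>: "\<Psi> \<in> hom b.GP a.GP"
    "\<And>w h. w \<in> W \<Longrightarrow> h \<in> carrier (H w) \<Longrightarrow> \<Psi> (b.gen w h) = a.gen (f' w) (i' w h)" by blast
  have 1: "\<Psi> (\<Phi> x) = x" if x: "x \<in> carrier a.GP" for x
  proof -
    have "(\<Psi> \<circ> \<Phi>) x = (\<lambda>x. x) x"
    proof (rule a.hom_ext[OF a.GP.is_group hom_compose[OF \<Phi>(1) \<Psi>(1)] _ _ x])
      show "(\<lambda>x. x) \<in> hom a.GP a.GP" by (simp add: hom_def)
    qed (simp add: \<Phi>(2) \<Psi>(2) fW ic f'f i'i)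
    then show ?thesis by simp
  qed
  have 2: "\<Phi> (\<Psi> y) = y" if y: "y \<in> carrier b.GP" for y
  proof -
    have "(\<Phi> \<circ> \<Psi>) y = (\<lambda>y. y) y"
    proof (rule b.hom_ext[OF b.GP.is_group hom_compose[OF \<Psi>(1) \<Phi>(1)] _ _ y])
      show "(\<lambda>y. y) \<in> hom b.GP b.GP" by (simp add: hom_def)
    qed (simp add: \<Phi>(2) \<Psi>(2) f' ic' ii')
    then show ?thesis by simp
  qed
  have "bij_betw \<Phi> (carrier a.GP) (carrier b.GP)"
    by (rule bij_betw_byWitness[where f' = \<Psi>]) 
      (use 1 2 \<Phi>(1) \<Psi>(1) in \<open>simp_all add: hom_def Pi_iff image_subset_iff\<close>)
  then show ?thesis using \<Phi>(1) by (intro is_isoI) (simp add: iso_def)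
qed

theorem theorem2p4:
  fixes V :: "'v set" and E :: "'v \<Rightarrow> 'v \<Rightarrow> bool" and G :: "'v \<Rightarrow> 'g monoid"
    and W :: "'w set" and F :: "'w \<Rightarrow> 'w \<Rightarrow> bool" and H :: "'w \<Rightarrow> 'h monoid"
  assumes "simplicial_graph V E" and "simplicial_graph W F"
    and "\<forall>v\<in>V. group (G v) \<and> finite (carrier (G v)) \<and> carrier (G v) \<noteq> {\<one>\<^bsub>G v\<^esub>}
                \<and> directly_indecomposable (G v)"
    and "\<forall>w\<in>W. group (H w) \<and> finite (carrier (H w)) \<and> carrier (H w) \<noteq> {\<one>\<^bsub>H w\<^esub>}
                \<and> directly_indecomposable (H w)"
  shows "(graph_product V E G \<cong> graph_product W F H \<longleftrightarrow> labelled_graph_iso V E G W F H)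
    \<and> (labelled_graph_iso V E G W F H \<longleftrightarrow>
        (\<exists>\<psi>. bij_betw \<psi> (CF (graph_product V E G)) (CF (graph_product W F H))
           \<and> (\<forall>P\<in>CF (graph_product V E G). \<forall>Q\<in>CF (graph_product V E G).
                CF_le (graph_product V E G) P Q \<longleftrightarrow> CF_le (graph_product W F H) (\<psi> P) (\<psi> Q))
           \<and> (\<forall>P\<in>CF (graph_product V E G). \<forall>A\<in>P. \<forall>B\<in>\<psi> P.
                (graph_product V E G)\<lparr>carrier := A\<rparr> \<cong> (graph_product W F H)\<lparr>carrier := B\<rparr>)))"
    (is "(?one \<longleftrightarrow> ?two) \<and> (?two \<longleftrightarrow> ?three)")
proof -
  interpret a: finite_graph_prod V E G
    by (intro finite_graph_prod.intro graph_prod.intro finite_graph_prod_axioms.intro)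
      (use assms in simp_all)
  interpret b: finite_graph_prod W F H
    by (intro finite_graph_prod.intro graph_prod.intro finite_graph_prod_axioms.intro)
      (use assms in simp_all)
  \<comment> \<open>The three implications form a cycle: functoriality, invariance of the poset of
    classes, and reconstruction.\<close>
  have "?two \<Longrightarrow> ?one"
    by (rule labelled_graph_iso_imp_iso[OF a.graph_prod_axioms b.graph_prod_axioms])
  moreover have "?one \<Longrightarrow> ?three"
    by (rule iso_CF[OF a.GP.is_group b.GP.is_group])
  moreover have "?three \<Longrightarrow> ?two"
    by (elim exE conjE,
        rule CF_iso_imp_labelled_graph_iso[OF a.finite_graph_prod_axioms b.finite_graph_prod_axioms])
      (assumption, blast, blast)
  ultimately show ?thesis by argo
qed

end
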